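(* The bit commitment scheme with classical communication described in the context satisfies correctness: there is a negligible function $\nu$ such that for each $b\in\{0,1\}$, if committer and receiver honestly execute the commit phase on input bit $b$ and then the reveal phase, the receiver outputs $b$ with probability at least $1-\nu(\lambda)$.
   Context: PRFS. A QPT algorithm $G$ is a (selectively secure) $(d,n)$-PRFS generator if $G_\lambda(k,x)$, for $k\in\{0,1\}^\lambda,x\in\{0,1\}^{d(\lambda)}$, is an $n(\lambda)$-qubit state, and for all polynomials $s,t$, all non-uniform QPT distinguishers $A$ (polynomial-size quantum circuits with quantum advice) and all families of sets of inputs $\{x_1,\dots,x_{s(\lambda)}\}\subseteq\{0,1\}^{d(\lambda)}$ there is a negligible $\varepsilon$ such that $A_\lambda$, given $x_1,\dots,x_s$, distinguishes $G_\lambda(k,x_1)^{\otimes t},\dots,G_\lambda(k,x_s)^{\otimes t}$ (for uniform $k$) from $|\vartheta_1\rangle^{\otimes t},\dots,|\vartheta_s\rangle^{\otimes t}$ (for independent Haar-random $n$-qubit states $|\vartheta_i\rangle$) with advantage at most $\varepsilon(\lambda)$. $G$ has the recognizable abort property if there are a QPT algorithm $\widehat G$ and an $(n+1)$-qubit state $|\bot\rangle=|1\rangle|\widehat\bot\rangle$ such that $\widehat G_\lambda(k,x)=\eta_{k,x}\,|0\rangle\langle0|\otimes|\psi_{k,x}\rangle\langle\psi_{k,x}|+(1-\eta_{k,x})|\bot\rangle\langle\bot|$ for some $\eta_{k,x}\in[0,1]$ and $n$-qubit pure state $|\psi_{k,x}\rangle$, and $G_\lambda(k,x)$ is obtained from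 $\widehat G_\lambda(k,x)$ by tracing out the first qubit. Parameters. $n(\lambda)=\lceil3\log_2\lambda\rceil$, $d(\lambda)=\lceil\log_2(3\lambda/n)\rceil\ge1$, $m=2^dn$, $L=3^8\,2^{3(n+1)+2}\lambda$. $G$ is a $(d,n)$-PRFS generator with recognizable abort. $\mathcal P_n$ is the set of $4^n$ $n$-qubit Pauli operators (tensor products of $I,X,Y,Z$). For $P_x\in\mathcal P_n$, $k\in\{0,1\}^\lambda$, $x\in\{0,1\}^d$, $b\in\{0,1\}$, let $\Phi_\lambda(P_x,k,x,b)=(I\otimes P_x^b)\,\widehat G_\lambda(k,x)\,(I\otimes P_x^b)$, a $2^{n+1}$-dimensional density matrix. Tomography. $\mathcal T$ is a tomography procedure that given $sN^2$ copies of an $N$-dimensional density matrix $\rho$ outputs a matrix $M$ with $\mathbb E\|M-\rho\|_F^2\le N/s$, in time $\mathrm{poly}(s,N)$ (such a procedure exists). $\mathcal T_{\rm imp}$, given $4sN^2\lambda$ copies of $\rho$, runs $\mathcal T(\rho^{\otimes4sN^2})$ independently $\lambda$ times to get $M_1,\dots,M_\lambda$ and outputs some $M_{i^*}$ with $|\{j:\|M_j-M_{i^*}\|_F^2\le4N/s\}|>\lambda/2$, or $\bot$ if none exists. $\mathsf{Tomography}(\rho^{\otimes L})=\mathcal T_{\rm imp}(\rho^{\otimes L})$ with $N=2^{n+1}$, $s=3^8 2^{n+1}$. $\mathsf{Verify}(\mathbf x,M)$: compute $\widehat M\leftarrow\mathsf{Tomography}(\Phi_\lambda(\mathbf x)^{\otimes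 L})$; output $\mathsf{Invalid}$ if $\langle\bot|M|\bot\rangle>\frac19$; otherwise output $\mathsf{Valid}$ if $\|M-\widehat M\|_F^2\le\frac4{729}$ and $\mathsf{Invalid}$ otherwise (also $\mathsf{Invalid}$ if $M$ or $\widehat M$ is the failure symbol). $\|\cdot\|_F$ is the Frobenius norm. Commitment scheme. Commit: the receiver samples $P=\bigotimes_{x\in\{0,1\}^d}P_x$ with independent uniform $P_x\in\mathcal P_n$ and sends $P$. The committer, on input $b$, samples $k\leftarrow\{0,1\}^\lambda$ uniformly, and for each $x\in\{0,1\}^d$ computes $M_x\leftarrow\mathsf{Tomography}(\Phi_\lambda(P_x,k,x,b)^{\otimes L})$; it sends $M=(M_x)_{x\in\{0,1\}^d}$. Reveal: the committer sends $(k,b)$. The receiver outputs $\bot$ if $b\notin\{0,1\}$; it outputs $b$ if $\mathsf{Verify}((P_x,k,x,b),M_x)=\mathsf{Valid}$ for every $x\in\{0,1\}^d$, and $\bot$ otherwise. *)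

theory Defs
  imports "HOL-Probability.Probability" "Jordan_Normal_Form.Schur_Decomposition"
begin

(* HOL-Analysis also has a type and a constant vec and the notation $; only the ones of
   Jordan_Normal_Form.Matrix are used below. *)
hide_type (open) Finite_Cartesian_Product.vec
hide_const (open) Finite_Cartesian_Product.vec
no_notation Finite_Cartesian_Product.vec_nth (infixl "$" 90)

section \<open>Asymptotics\<close>

definition negligible_fun :: "(nat \<Rightarrow> real) \<Rightarrow> bool" where
  "negligible_fun \<nu> \<longleftrightarrow> (\<forall>c::nat. \<forall>\<^sub>F l in sequentially. \<bar>\<nu> l\<bar> < 1 / real l ^ c)"

definition poly_bounded :: "(nat \<Rightarrow> nat) \<Rightarrow> bool" where
  "poly_bounded f \<longleftrightarrow> (\<exists>c. \<forall>l. f l \<le> l ^ c + c)"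


section \<open>States\<close>

text \<open>
  A register of \<open>q\<close> qubits has the basis \<open>{..<2 ^ q}\<close>; qubit 0 is the most significant bit, so that
  juxtaposition of registers is the tensor product in the same order.
\<close>

definition bits :: "nat \<Rightarrow> bool list set" where
  "bits l = {bs. length bs = l}"

definition index_of_bits :: "bool list \<Rightarrow> nat" where
  "index_of_bits bs = foldl (\<lambda>r b. 2 * r + of_bool b) 0 bs"

definition bits_of_index :: "nat \<Rightarrow> nat \<Rightarrow> bool list" where
  "bits_of_index q a = map (\<lambda>j. odd (a div 2 ^ (q - 1 - j))) [0..<q]"

definition ket :: "bool list \<Rightarrow> complex vec" where
  "ket bs = unit_vec (2 ^ length bs) (index_of_bits bs)"

definition tensor_mat :: "complex mat \<Rightarrow> complex mat \<Rightarrow> complex mat" (infixr "\<Otimes>" 72) where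
  "A \<Otimes> B = mat (dim_row A * dim_row B) (dim_col A * dim_col B)
     (\<lambda>(i, j). A $$ (i div dim_row B, j div dim_col B) * B $$ (i mod dim_row B, j mod dim_col B))"

definition tensor_list :: "complex mat list \<Rightarrow> complex mat" where
  "tensor_list As = foldr tensor_mat As (1\<^sub>m 1)"

definition tensor_vec :: "complex vec \<Rightarrow> complex vec \<Rightarrow> complex vec" where
  "tensor_vec v w = vec (dim_vec v * dim_vec w) (\<lambda>i. v $ (i div dim_vec w) * w $ (i mod dim_vec w))"

definition outer :: "complex vec \<Rightarrow> complex mat" where
  "outer v = mat (dim_vec v) (dim_vec v) (\<lambda>(i, j). v $ i * cnj (v $ j))"

definition pure_state :: "nat \<Rightarrow> complex vec \<Rightarrow> bool" where
  "pure_state N v \<longleftrightarrow> v \<in> carrier_vec N \<and> v \<bullet>c v = 1"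

definition density_matrix :: "nat \<Rightarrow> complex mat \<Rightarrow> bool" where
  "density_matrix N \<rho> \<longleftrightarrow> \<rho> \<in> carrier_mat N N \<and> mat_adjoint \<rho> = \<rho>
     \<and> (\<forall>v\<in>carrier_vec N. 0 \<le> Re ((\<rho> *\<^sub>v v) \<bullet>c v)) \<and> (\<Sum>i<N. \<rho> $$ (i, i)) = 1"

definition unitary_matrix :: "nat \<Rightarrow> complex mat \<Rightarrow> bool" where
  "unitary_matrix N U \<longleftrightarrow> U \<in> carrier_mat N N \<and> mat_adjoint U * U = 1\<^sub>m N"

definition frobenius_norm :: "complex mat \<Rightarrow> real" where
  "frobenius_norm A = sqrt (\<Sum>i<dim_row A. \<Sum>j<dim_col A. (cmod (A $$ (i, j)))\<^sup>2)"

text \<open>The reduced state of the first \<open>m\<close> of \<open>q\<close> qubits, resp. of all but the first of \<open>n + 1\<close> qubits.\<close>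

definition keep_first :: "nat \<Rightarrow> nat \<Rightarrow> complex mat \<Rightarrow> complex mat" where
  "keep_first m q \<rho> = mat (2 ^ m) (2 ^ m)
     (\<lambda>(i, j). \<Sum>k<2 ^ (q - m). \<rho> $$ (i * 2 ^ (q - m) + k, j * 2 ^ (q - m) + k))"

definition trace_out_first :: "nat \<Rightarrow> complex mat \<Rightarrow> complex mat" where
  "trace_out_first n \<rho> = mat (2 ^ n) (2 ^ n) (\<lambda>(i, j). \<Sum>a<2. \<rho> $$ (a * 2 ^ n + i, a * 2 ^ n + j))"

text \<open>
  The Haar measure on pure states of dimension \<open>N\<close>: the (unique) unitarily invariant probability
  measure on the unit sphere of \<open>\<complex>\<^sup>N\<close>. A vector is represented by its amplitude function on \<open>{..<N}\<close>,
  which gives access to the product \<open>\<sigma>\<close>-algebra.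
\<close>

definition haar_state_measure :: "nat \<Rightarrow> (nat \<Rightarrow> complex) measure \<Rightarrow> bool" where
  "haar_state_measure N \<mu> \<longleftrightarrow> prob_space \<mu> \<and> sets \<mu> = sets (\<Pi>\<^sub>M i\<in>{..<N}. borel)
     \<and> (AE f in \<mu>. pure_state N (vec N f))
     \<and> (\<forall>U. unitary_matrix N U \<longrightarrow>
          distr \<mu> (\<Pi>\<^sub>M i\<in>{..<N}. borel) (\<lambda>f. \<lambda>i\<in>{..<N}. (U *\<^sub>v vec N f) $ i) = \<mu>)"


section \<open>Quantum circuits\<close>

text \<open>Circuits over a fixed finite universal gate set; the ancillas start in \<open>|0\<rangle>\<close>.\<close>

datatype gate = Hadamard nat | TGate nat | CNOT nat nat | Toffoli nat nat nat

datatype circuit = Circuit (inputs: nat) (ancillas: nat) (gates: "gate list")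

definition width :: "circuit \<Rightarrow> nat" where
  "width C = inputs C + ancillas C"

definition circuit_size :: "circuit \<Rightarrow> nat" where
  "circuit_size C = width C + length (gates C)"

fun gate_qubits :: "gate \<Rightarrow> nat list" where
  "gate_qubits (Hadamard i) = [i]"
| "gate_qubits (TGate i) = [i]"
| "gate_qubits (CNOT i j) = [i, j]"
| "gate_qubits (Toffoli i j k) = [i, j, k]"

fun gate_op :: "gate \<Rightarrow> complex mat" where
  "gate_op (Hadamard i) = complex_of_real (1 / sqrt 2) \<cdot>\<^sub>m mat_of_rows_list 2 [[1, 1], [1, -1]]"
| "gate_op (TGate i) = mat_of_rows_list 2 [[1, 0], [0, cis (pi / 4)]]"
| "gate_op (CNOT i j) = mat 4 4 (\<lambda>(a, b). of_bool (a = Transposition.transpose 2 3 b))"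
| "gate_op (Toffoli i j k) = mat 8 8 (\<lambda>(a, b). of_bool (a = Transposition.transpose 6 7 b))"

text \<open>The operator \<open>U\<close> acting on the qubits \<open>ps\<close> (in this order) of \<open>q\<close> qubits.\<close>

definition local_op :: "nat \<Rightarrow> nat list \<Rightarrow> complex mat \<Rightarrow> complex mat" where
  "local_op q ps U = mat (2 ^ q) (2 ^ q) (\<lambda>(a, b).
     let u = bits_of_index q a; v = bits_of_index q b in
     if \<forall>j<q. j \<notin> set ps \<longrightarrow> u ! j = v ! j
     then U $$ (index_of_bits (map ((!) u) ps), index_of_bits (map ((!) v) ps)) else 0)"

definition valid_circuit :: "circuit \<Rightarrow> bool" where
  "valid_circuit C \<longleftrightarrow> (\<forall>g\<in>set (gates C). distinct (gate_qubits g) \<and> set (gate_qubits g) \<subseteq> {..<width C})"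

definition circuit_unitary :: "circuit \<Rightarrow> complex mat" where
  "circuit_unitary C =
     foldl (\<lambda>U g. local_op (width C) (gate_qubits g) (gate_op g) * U) (1\<^sub>m (2 ^ width C)) (gates C)"

definition run_circuit :: "circuit \<Rightarrow> complex mat \<Rightarrow> complex mat" where
  "run_circuit C \<rho> =
     circuit_unitary C * (\<rho> \<Otimes> outer (ket (replicate (ancillas C) False))) * mat_adjoint (circuit_unitary C)"

text \<open>Probability of outcome \<open>bs\<close> when the first \<open>length bs\<close> output qubits are measured.\<close>

definition outcome_prob :: "circuit \<Rightarrow> complex mat \<Rightarrow> bool list \<Rightarrow> real" where
  "outcome_prob C \<rho> bs =
     Re (keep_first (length bs) (width C) (run_circuit C \<rho>) $$ (index_of_bits bs, index_of_bits bs))"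


section \<open>Uniformity\<close>

text \<open>
  Deterministic one-tape Turing machines over the states \<open>{..<K}\<close> and the symbols \<open>{..<S}\<close>, with start
  state 0, halting state 1 and blank symbol 0.
\<close>

type_synonym tm = "nat \<Rightarrow> nat \<Rightarrow> nat \<times> nat \<times> int"

definition tm_wf :: "nat \<Rightarrow> nat \<Rightarrow> tm \<Rightarrow> bool" where
  "tm_wf K S \<delta> \<longleftrightarrow> (\<forall>q<K. \<forall>a<S. case \<delta> q a of (q', a', m) \<Rightarrow> q' < K \<and> a' < S \<and> m \<in> {-1, 0, 1})"

fun tm_step :: "tm \<Rightarrow> nat \<times> int \<times> (int \<Rightarrow> nat) \<Rightarrow> nat \<times> int \<times> (int \<Rightarrow> nat)" where
  "tm_step \<delta> (q, h, tape) =
     (if q = 1 then (q, h, tape)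
      else case \<delta> q (tape h) of (q', a', m) \<Rightarrow> (q', h + m, tape(h := a')))"

definition tm_computes :: "tm \<Rightarrow> nat list \<Rightarrow> nat list \<Rightarrow> nat \<Rightarrow> bool" where
  "tm_computes \<delta> w v steps \<longleftrightarrow>
     (case (tm_step \<delta> ^^ steps) (0, 0, \<lambda>i. if 0 \<le> i \<and> i < int (length w) then w ! nat i else 0) of
        (q, h, tape) \<Rightarrow> q = 1 \<and> (\<forall>i<length v. tape (int i) = v ! i) \<and> tape (int (length v)) = 0)"

text \<open>
  Circuits are written as words over the symbols \<open>{1..6}\<close>, numbers (at most polynomial) in unary.
\<close>

fun gate_word :: "gate \<Rightarrow> nat list" where
  "gate_word (Hadamard i) = 2 # replicate i 1"
| "gate_word (TGate i) = 3 # replicate i 1"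
| "gate_word (CNOT i j) = 4 # replicate i 1 @ 6 # replicate j 1"
| "gate_word (Toffoli i j k) = 5 # replicate i 1 @ 6 # replicate j 1 @ 6 # replicate k 1"

definition circuit_word :: "circuit \<Rightarrow> nat list" where
  "circuit_word C =
     replicate (inputs C) 1 @ 6 # replicate (ancillas C) 1 @ concat (map gate_word (gates C))"

definition unary_word :: "nat list \<Rightarrow> nat list" where
  "unary_word args = concat (map (\<lambda>a. replicate a 1 @ [6]) args)"

text \<open>A family of circuits, indexed by the unary arguments in \<open>D\<close>, that is computable in polynomial time.\<close>

definition uniform_family :: "nat list set \<Rightarrow> (nat list \<Rightarrow> circuit) \<Rightarrow> bool" where
  "uniform_family D C \<longleftrightarrow> (\<exists>K S \<delta> c. 2 \<le> K \<and> 7 \<le> S \<and> tm_wf K S \<delta> \<and>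
     (\<forall>args\<in>D. valid_circuit (C args) \<and>
        tm_computes \<delta> (unary_word args) (circuit_word (C args)) (length (unary_word args) ^ c + c)))"


section \<open>Pseudorandom function-like state generators\<close>

text \<open>
  In \<open>G l k x\<close>, \<open>l\<close> is the security parameter, \<open>k\<close> the key and \<open>x\<close> the input.
\<close>

type_synonym state_gen = "nat \<Rightarrow> bool list \<Rightarrow> bool list \<Rightarrow> complex mat"

text \<open>\<open>G\<close> is a QPT algorithm mapping \<open>k\<close> and \<open>x\<close>, of lengths \<open>l\<close> and \<open>d l\<close>, to an \<open>m l\<close>-qubit state.\<close>

definition qpt_state_gen :: "(nat \<Rightarrow> nat) \<Rightarrow> (nat \<Rightarrow> nat) \<Rightarrow> state_gen \<Rightarrow> bool" where
  "qpt_state_gen d m G \<longleftrightarrow> (\<exists>C. uniform_family {[l] |l. True} C \<and>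
     (\<forall>l. inputs (C [l]) = l + d l \<and> m l \<le> width (C [l]) \<and>
        (\<forall>k\<in>bits l. \<forall>x\<in>bits (d l).
           G l k x = keep_first (m l) (width (C [l])) (run_circuit (C [l]) (outer (ket (k @ x)))))))"

text \<open>
  A non-uniform distinguisher: polynomial-size circuits \<open>A\<close> with advice \<open>\<alpha>\<close> on \<open>a\<close> qubits, taking
  \<open>s\<close> classical strings of length \<open>d\<close>, followed by \<open>t\<close> copies of each of \<open>s\<close> states on \<open>n\<close> qubits,
  followed by the advice.
\<close>

definition distinguisher ::
    "(nat \<Rightarrow> nat) \<Rightarrow> (nat \<Rightarrow> nat) \<Rightarrow> (nat \<Rightarrow> nat) \<Rightarrow> (nat \<Rightarrow> nat) \<Rightarrow>
     (nat \<Rightarrow> circuit) \<Rightarrow> (nat \<Rightarrow> nat) \<Rightarrow> (nat \<Rightarrow> complex mat) \<Rightarrow> bool" where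
  "distinguisher d n s t A a \<alpha> \<longleftrightarrow> poly_bounded (\<lambda>l. circuit_size (A l)) \<and>
     (\<forall>l. valid_circuit (A l) \<and> 0 < width (A l) \<and>
        inputs (A l) = s l * d l + s l * t l * n l + a l \<and> density_matrix (2 ^ a l) (\<alpha> l))"

definition accept_prob :: "circuit \<Rightarrow> bool list list \<Rightarrow> nat \<Rightarrow> complex mat list \<Rightarrow> complex mat \<Rightarrow> real" where
  "accept_prob C xs t \<sigma>s \<alpha> =
     outcome_prob C (outer (ket (concat xs)) \<Otimes> tensor_list (concat (map (replicate t) \<sigma>s)) \<Otimes> \<alpha>) [True]"

definition prfs_prob :: "state_gen \<Rightarrow> nat \<Rightarrow> circuit \<Rightarrow> bool list list \<Rightarrow> nat \<Rightarrow> complex mat \<Rightarrow> real" where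
  "prfs_prob G l C xs t \<alpha> = (\<Sum>k\<in>bits l. accept_prob C xs t (map (G l k) xs) \<alpha>) / 2 ^ l"

definition haar_prob ::
    "(nat \<Rightarrow> (nat \<Rightarrow> complex) measure) \<Rightarrow> nat \<Rightarrow> circuit \<Rightarrow> bool list list \<Rightarrow> nat \<Rightarrow> complex mat \<Rightarrow> real" where
  "haar_prob haar n C xs t \<alpha> =
     (\<integral>\<theta>. accept_prob C xs t (map (\<lambda>i. outer (vec (2 ^ n) (\<theta> i))) [0..<length xs]) \<alpha>
        \<partial>(\<Pi>\<^sub>M i\<in>{..<length xs}. haar (2 ^ n)))"

definition prfs_generator ::
    "(nat \<Rightarrow> (nat \<Rightarrow> complex) measure) \<Rightarrow> (nat \<Rightarrow> nat) \<Rightarrow> (nat \<Rightarrow> nat) \<Rightarrow> state_gen \<Rightarrow> bool" where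
  "prfs_generator haar d n G \<longleftrightarrow> qpt_state_gen d n G \<and>
     (\<forall>l. \<forall>k\<in>bits l. \<forall>x\<in>bits (d l). density_matrix (2 ^ n l) (G l k x)) \<and>
     (\<forall>s t A a \<alpha> X. poly_bounded s \<longrightarrow> poly_bounded t \<longrightarrow> distinguisher d n s t A a \<alpha> \<longrightarrow>
        (\<forall>l. distinct (X l) \<and> length (X l) = s l \<and> set (X l) \<subseteq> bits (d l)) \<longrightarrow>
        (\<exists>\<epsilon>. negligible_fun \<epsilon> \<and>
           (\<forall>l. \<bar>prfs_prob G l (A l) (X l) (t l) (\<alpha> l) - haar_prob haar (n l) (A l) (X l) (t l) (\<alpha> l)\<bar> \<le> \<epsilon> l)))"

text \<open>\<open>bot_hat l\<close> is the \<open>n l\<close>-qubit part of the abort state.\<close>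

definition bot_state :: "complex vec \<Rightarrow> complex vec" where
  "bot_state bot_hat = tensor_vec (ket [True]) bot_hat"

definition recognizable_abort ::
    "(nat \<Rightarrow> nat) \<Rightarrow> (nat \<Rightarrow> nat) \<Rightarrow> state_gen \<Rightarrow> state_gen \<Rightarrow> (nat \<Rightarrow> complex vec) \<Rightarrow> bool" where
  "recognizable_abort d n G Ghat bot_hat \<longleftrightarrow>
     qpt_state_gen d (\<lambda>l. n l + 1) Ghat \<and> (\<forall>l. pure_state (2 ^ n l) (bot_hat l)) \<and>
     (\<forall>l. \<forall>k\<in>bits l. \<forall>x\<in>bits (d l).
        (\<exists>\<eta> \<psi>. 0 \<le> \<eta> \<and> \<eta> \<le> 1 \<and> pure_state (2 ^ n l) \<psi> \<and>
           Ghat l k x = complex_of_real \<eta> \<cdot>\<^sub>m (outer (ket [False]) \<Otimes> outer \<psi>)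
                        + complex_of_real (1 - \<eta>) \<cdot>\<^sub>m outer (bot_state (bot_hat l))) \<and>
        G l k x = trace_out_first (n l) (Ghat l k x))"


section \<open>Tomography\<close>

text \<open>
  An \<open>N\<close>-dimensional system is stored in \<open>\<lceil>log 2 N\<rceil>\<close> qubits, on the span of the first \<open>N\<close> basis states.
\<close>

definition qubits_for :: "nat \<Rightarrow> nat" where
  "qubits_for N = nat \<lceil>log 2 (real N)\<rceil>"

definition store :: "nat \<Rightarrow> complex mat \<Rightarrow> complex mat" where
  "store N \<rho> = mat (2 ^ qubits_for N) (2 ^ qubits_for N) (\<lambda>(i, j). if i < N \<and> j < N then \<rho> $$ (i, j) else 0)"

type_synonym tomo = "nat \<Rightarrow> nat \<Rightarrow> complex mat \<Rightarrow> complex mat pmf"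

text \<open>
  \<open>T s N \<rho>\<close> is the output distribution of the procedure on \<open>s * N\<^sup>2\<close> copies of \<open>\<rho>\<close>. Running in time
  \<open>poly(s, N)\<close>: uniform circuits (with \<open>s\<close> and \<open>N\<close> in unary) are run on the copies, \<open>r s N\<close> output
  qubits are measured, and \<open>dec s N\<close> is the encoding by which the output strings denote matrices.
\<close>

definition tomography_procedure :: "tomo \<Rightarrow> bool" where
  "tomography_procedure T \<longleftrightarrow>
     (\<forall>s N \<rho>. 1 \<le> s \<longrightarrow> 1 \<le> N \<longrightarrow> density_matrix N \<rho> \<longrightarrow>
        set_pmf (T s N \<rho>) \<subseteq> carrier_mat N N \<and>
        measure_pmf.expectation (T s N \<rho>) (\<lambda>M. (frobenius_norm (M - \<rho>))\<^sup>2) \<le> real N / real s) \<and>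
     (\<exists>C r (dec :: nat \<Rightarrow> nat \<Rightarrow> bool list \<Rightarrow> complex mat).
        uniform_family {[s, N] |s N. 1 \<le> s \<and> 1 \<le> N} C \<and>
        (\<forall>s N. 1 \<le> s \<longrightarrow> 1 \<le> N \<longrightarrow>
           inputs (C [s, N]) = s * N\<^sup>2 * qubits_for N \<and> r s N \<le> width (C [s, N]) \<and>
           (\<forall>\<rho> M. density_matrix N \<rho> \<longrightarrow>
              pmf (T s N \<rho>) M =
                (\<Sum>bs | bs \<in> bits (r s N) \<and> dec s N bs = M.
                   outcome_prob (C [s, N]) (tensor_list (replicate (s * N\<^sup>2) (store N \<rho>))) bs))))"

definition in_majority :: "real \<Rightarrow> complex mat list \<Rightarrow> nat \<Rightarrow> bool" where
  "in_majority r Ms i \<longleftrightarrow> i < length Ms \<and>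
     real (card {j. j < length Ms \<and> (frobenius_norm (Ms ! j - Ms ! i))\<^sup>2 \<le> r}) > real (length Ms) / 2"

text \<open>\<open>None\<close> is the failure symbol.\<close>

definition select_majority :: "real \<Rightarrow> complex mat list \<Rightarrow> complex mat option" where
  "select_majority r Ms =
     (if \<exists>i. in_majority r Ms i then Some (Ms ! (SOME i. in_majority r Ms i)) else None)"

definition tomography_imp ::
    "tomo \<Rightarrow> nat \<Rightarrow> nat \<Rightarrow> nat \<Rightarrow> complex mat \<Rightarrow> complex mat option pmf"
  where
  "tomography_imp T s N l \<rho> =
     map_pmf (select_majority (4 * real N / real s)) (replicate_pmf l (T (4 * s) N \<rho>))"


section \<open>The commitment scheme\<close>

definition out_len :: "nat \<Rightarrow> nat" where
  "out_len l = nat \<lceil>3 * log 2 (real l)\<rceil>"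

definition in_len :: "nat \<Rightarrow> nat" where
  "in_len l = nat \<lceil>log 2 (3 * real l / real (out_len l))\<rceil>"

text \<open>On \<open>3 ^ 8 * 2 ^ (3 * (n + 1) + 2) * l\<close> copies of \<open>\<rho>\<close>, where \<open>n = out_len l\<close>; see \<open>tomography_copies\<close>.\<close>

definition tomography ::
    "tomo \<Rightarrow> nat \<Rightarrow> complex mat \<Rightarrow> complex mat option pmf" where
  "tomography T l \<rho> = tomography_imp T (3 ^ 8 * 2 ^ (out_len l + 1)) (2 ^ (out_len l + 1)) l \<rho>"

lemma tomography_copies:
  fixes n l :: nat
  defines "s \<equiv> 3 ^ 8 * 2 ^ (n + 1)" and "N \<equiv> 2 ^ (n + 1)"
  shows "l * (4 * s * N\<^sup>2) = 3 ^ 8 * 2 ^ (3 * (n + 1) + 2) * l"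
proof -
  have "3 * (n + 1) + 2 = 2 + (n + 1) + (n + 1) * 2" by simp
  then show ?thesis unfolding s_def N_def
    by (simp only: power_add power_mult) simp
qed

definition pauli_set :: "complex mat set" where
  "pauli_set = {mat_of_rows_list 2 [[1, 0], [0, 1]], mat_of_rows_list 2 [[0, 1], [1, 0]],
                mat_of_rows_list 2 [[0, - \<i>], [\<i>, 0]], mat_of_rows_list 2 [[1, 0], [0, -1]]}"

definition paulis :: "nat \<Rightarrow> complex mat set" where
  "paulis n = {tensor_list Ps |Ps. length Ps = n \<and> set Ps \<subseteq> pauli_set}"

definition Phi :: "state_gen \<Rightarrow> nat \<Rightarrow> complex mat \<Rightarrow> bool list \<Rightarrow> bool list \<Rightarrow> nat \<Rightarrow> complex mat" where
  "Phi Ghat l P k x b = (1\<^sub>m 2 \<Otimes> (P ^\<^sub>m b)) * Ghat l k x * (1\<^sub>m 2 \<Otimes> (P ^\<^sub>m b))"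

text \<open>
  \<open>verify\<close> is given the state \<open>\<rho> = \<Phi>(x)\<close> to be tomographed; \<open>True\<close> is \<open>Valid\<close>. As \<open>M\<close> need not be
  Hermitian, \<open>\<langle>\<bottom>|M|\<bottom>\<rangle>\<close> is compared to \<open>1/9\<close> by its real part.
\<close>

definition verify ::
    "tomo \<Rightarrow> complex vec \<Rightarrow> nat \<Rightarrow>
     complex mat \<Rightarrow> complex mat option \<Rightarrow> bool pmf" where
  "verify T botv l \<rho> Mo =
     map_pmf (\<lambda>Mo'. case (Mo, Mo') of
         (Some M, Some M') \<Rightarrow> \<not> Re ((M *\<^sub>v botv) \<bullet>c botv) > 1 / 9 \<and> (frobenius_norm (M - M'))\<^sup>2 \<le> 4 / 729
       | _ \<Rightarrow> False)
     (tomography T l \<rho>)"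

text \<open>The receiver's first message \<open>\<Otimes>\<^sub>x P\<^sub>x\<close> is given by the family of its factors \<open>P\<^sub>x\<close>.\<close>

definition receiver_commit :: "nat \<Rightarrow> (bool list \<Rightarrow> complex mat) pmf" where
  "receiver_commit l = Pi_pmf (bits (in_len l)) (1\<^sub>m 1) (\<lambda>_. pmf_of_set (paulis (out_len l)))"

definition committer_commit ::
    "tomo \<Rightarrow> state_gen \<Rightarrow> nat \<Rightarrow>
     (bool list \<Rightarrow> complex mat) \<Rightarrow> nat \<Rightarrow> (bool list \<times> (bool list \<Rightarrow> complex mat option)) pmf" where
  "committer_commit T Ghat l P b = do {
     k \<leftarrow> pmf_of_set (bits l);
     M \<leftarrow> Pi_pmf (bits (in_len l)) None (\<lambda>x. tomography T l (Phi Ghat l (P x) k x b));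
     return_pmf (k, M)
   }"

definition receiver_reveal ::
    "tomo \<Rightarrow> state_gen \<Rightarrow> (nat \<Rightarrow> complex vec) \<Rightarrow> nat \<Rightarrow>
     (bool list \<Rightarrow> complex mat) \<Rightarrow> (bool list \<Rightarrow> complex mat option) \<Rightarrow> bool list \<times> nat \<Rightarrow> nat option pmf" where
  "receiver_reveal T Ghat bot_hat l P M = (\<lambda>(k, b).
     if b \<notin> {0, 1} then return_pmf None
     else do {
       v \<leftarrow> Pi_pmf (bits (in_len l)) False
              (\<lambda>x. verify T (bot_state (bot_hat l)) l (Phi Ghat l (P x) k x b) (M x));
       return_pmf (if \<forall>x\<in>bits (in_len l). v x then Some b else None)
     })"

definition honest_execution ::
    "tomo \<Rightarrow> state_gen \<Rightarrow> (nat \<Rightarrow> complex vec) \<Rightarrow>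
     nat \<Rightarrow> nat \<Rightarrow> nat option pmf" where
  "honest_execution T Ghat bot_hat l b = do {
     P \<leftarrow> receiver_commit l;
     (k, M) \<leftarrow> committer_commit T Ghat l P b;
     receiver_reveal T Ghat bot_hat l P M (k, b)
   }"

end

theory Submission
  imports Defs
begin

text \<open>
  The receiver accepts an honest opening unless a tomography fails or some state \<open>\<Phi>\<close> has weight more than
  \<open>2 / 27\<close> on the abort state. Tomography is accurate to within \<open>1 / 27\<close> except with exponentially small
  probability, by Markov's inequality for a single run and a Chernoff bound for the majority. The weight of
  \<open>\<Phi>\<close> on the abort state is at most the abort probability \<open>1 - \<eta>\<close>, and a union bound over the
  \<open>2 ^ d \<le> 6 \<lambda>\<close> inputs leaves only one claim: on average over the key, \<open>1 - \<eta>\<close> is negligible.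

  This follows from pseudorandomness with two distinguishers, both of which swap two blocks of qubits
  controlled on a qubit in the state \<open>|+\<rangle>\<close> or \<open>|-\<rangle>\<close>. Applied to two copies of the generated state
  \<open>\<rho> = \<eta> |\<psi>\<rangle>\<langle>\<psi>| + (1 - \<eta>) |\<bottom>\<rangle>\<langle>\<bottom>|\<close>, this measures the purity of \<open>\<rho>\<close>, which is 1 for Haar random
  states; so \<open>\<eta> (1 - \<eta>) (1 - |\<langle>\<psi>|\<bottom>\<rangle>|\<^sup>2)\<close> is negligible on average. Applied to \<open>\<lambda>\<close> copies of \<open>\<rho>\<close>
  and of the abort state, given as advice, it measures \<open>\<langle>\<bottom>|\<rho>|\<bottom>\<rangle> ^ \<lambda>\<close>, which is negligible for Haar
  random states. The Haar moment is bounded without computing it: by unitary invariance, \<open>|\<bottom>\<rangle>\<close> may be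
  replaced by a random sign vector, and Hoeffding's inequality applies for every fixed state.
\<close>


section \<open>Bit strings and matrix entries\<close>

text \<open>A state on about 3 log2 \<lambda> qubits is so small that a Haar random one has overlap
  of order \<lambda>^-3 with any fixed state. Comparing single copies with the abort state could
  therefore show at best that the abort probability is inverse polynomial. The power \<lambda> of
  the overlap removes this floor, but it only detects states within distance of order 1 / \<lambda>
  of the abort state. The purity test covers the others, at the price of a factor 2 \<lambda>. It
  cannot stand alone either: a generator that always aborts is perfectly pure. Security is
  selective, with the inputs fixed in advance, so both tests look at one input for each \<lambda>,
  the one with the largest average abort probability. The first bit of that input doubles as the
  control qubit of the swap.\<close>

lemma mat_adjoint_carrier [simp]: "A \<in> carrier_mat n m \<Longrightarrow> mat_adjoint A \<in> carrier_mat m n"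
  by (auto simp: mat_adjoint_def)

lemma dim_mat_adjoint [simp]: "dim_row (mat_adjoint A) = dim_col A" "dim_col (mat_adjoint A) = dim_row A"
  by (auto simp: mat_adjoint_def)

lemma index_mat_adjoint [simp]:
  "i < dim_col A \<Longrightarrow> j < dim_row A \<Longrightarrow> mat_adjoint A $$ (i, j) = conjugate (A $$ (j, i))"
  by (auto simp: mat_adjoint_def mat_of_rows_def)

lemma index_of_bits_simps [simp]: "index_of_bits [] = 0" 
  by (simp add: index_of_bits_def)

lemma index_of_bits_snoc [simp]: "index_of_bits (bs @ [b]) = 2 * index_of_bits bs + of_bool b"
  by (simp add: index_of_bits_def)

lemma index_of_bits_append: "index_of_bits (xs @ ys) = index_of_bits xs * 2 ^ length ys + index_of_bits ys"
proof (induction ys rule: rev_induct)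
  case (snoc b ys)
  then show ?case by (simp flip: append_assoc)
qed auto

lemma index_of_bits_Cons: "index_of_bits (b # bs) = of_bool b * 2 ^ length bs + index_of_bits bs"
  using index_of_bits_append[of "[b]" bs] by (simp add: index_of_bits_def)

lemma index_of_bits_less: "index_of_bits bs < 2 ^ length bs"
  by (induction bs) (auto simp: index_of_bits_Cons)

lemma index_of_bits_lt: "bs \<in> bits q \<Longrightarrow> index_of_bits bs < 2 ^ q"
  using index_of_bits_less[of bs] by (simp add: bits_def)

lemma length_bits_of_index [simp]: "length (bits_of_index q a) = q"
  by (simp add: bits_of_index_def)

lemma bits_of_index_in_bits [simp]: "bits_of_index q a \<in> bits q"
  by (simp add: bits_def)

lemma bits_of_index_Suc: "bits_of_index (Suc q) a = odd (a div 2 ^ q) # bits_of_index q a"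
  unfolding bits_of_index_def
  by (simp add: upt_conv_Cons map_Suc_upt[symmetric] del: upt_Suc)

lemma bits_of_index_add: "bits_of_index q (c * 2 ^ q + a) = bits_of_index q a"
proof (rule nth_equalityI)
  fix j assume "j < length (bits_of_index q (c * 2 ^ q + a))"
  then have j: "j < q" by simp
  define r where "r = q - 1 - j"
  have q: "q = Suc (j + r)" using j by (simp add: r_def)
  have "(c * 2 ^ q + a) div 2 ^ r = (c * 2 ^ Suc j) + a div 2 ^ r"
    unfolding q by (simp add: power_add mult.assoc[symmetric])
  then show "bits_of_index q (c * 2 ^ q + a) ! j = bits_of_index q a ! j"
    using j by (simp add: bits_of_index_def r_def)
qed simp

lemma bits_of_index_of_bits: "bs \<in> bits q \<Longrightarrow> bits_of_index q (index_of_bits bs) = bs"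
proof (induction bs arbitrary: q)
  case Nil then show ?case by (simp add: bits_def bits_of_index_def)
next
  case (Cons b bs)
  then obtain r where q: "q = Suc r" and bs: "bs \<in> bits r" by (auto simp: bits_def)
  have "index_of_bits bs < 2 ^ r" using index_of_bits_lt bs by blast
  then show ?case using Cons.IH[OF bs] bs bits_of_index_add[of r 1 "index_of_bits bs"]
    by (auto simp: q bits_of_index_Suc index_of_bits_Cons bits_def)
qed

lemma finite_bits [simp]: "finite (bits q)"
  using finite_lists_length_eq[of "UNIV :: bool set" q] by (simp add: bits_def)

lemma card_bits [simp]: "card (bits q) = 2 ^ q"
  using card_lists_length_eq[of "UNIV :: bool set" q] by (simp add: bits_def card_UNIV_bool)

lemma bij_betw_index_of_bits: "bij_betw index_of_bits (bits q) {..<2 ^ q}"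
proof -
  have "inj_on index_of_bits (bits q)"
    by (metis bits_of_index_of_bits inj_onI)
  moreover have "index_of_bits ` bits q \<subseteq> {..<2 ^ q}" using index_of_bits_lt by auto
  ultimately show ?thesis
    by (simp add: bij_betw_def card_image card_subset_eq)
qed

lemma index_of_bits_of_index: "a < 2 ^ q \<Longrightarrow> index_of_bits (bits_of_index q a) = a"
proof -
  assume "a < 2 ^ q"
  then have "a \<in> index_of_bits ` bits q"
    using bij_betw_imp_surj_on[OF bij_betw_index_of_bits[of q]] by simp
  then show ?thesis using bits_of_index_of_bits by auto
qed

lemma index_of_bits_eq_iff: "u \<in> bits q \<Longrightarrow> v \<in> bits q \<Longrightarrow> index_of_bits u = index_of_bits v \<longleftrightarrow> u = v"
  by (metis bits_of_index_of_bits)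

lemma sum_bits: "(\<Sum>i<2 ^ q. f i) = (\<Sum>u\<in>bits q. f (index_of_bits u))"
  by (rule sum.reindex_bij_betw[OF bij_betw_index_of_bits, symmetric])

lemma bits_0 [simp]: "bits 0 = {[]}"
  by (auto simp: bits_def)

lemma bits_nonempty [simp]: "bits q \<noteq> {}"
  using bits_of_index_in_bits by blast

lemma append_in_bits: "u \<in> bits p \<Longrightarrow> v \<in> bits q \<Longrightarrow> u @ v \<in> bits (p + q)"
  by (auto simp: bits_def)

lemma sum_bits_add: "(\<Sum>u\<in>bits (p + q). f u) = (\<Sum>u\<in>bits p. \<Sum>v\<in>bits q. f (u @ v))"
proof -
  have "(\<Sum>u\<in>bits (p + q). f u) = (\<Sum>(u, v)\<in>bits p \<times> bits q. f (u @ v))"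
    by (rule sum.reindex_bij_witness[where i = "\<lambda>(u, v). u @ v" and j = "\<lambda>w. (take p w, drop p w)"])
       (auto simp: bits_def)
  then show ?thesis by (simp add: sum.cartesian_product)
qed

lemma sum_bits_Suc: "(\<Sum>u\<in>bits (Suc q). f u) = (\<Sum>u\<in>bits q. f (False # u)) + (\<Sum>u\<in>bits q. f (True # u))"
proof -
  have "bits 1 = {[False], [True]}" by (auto simp: bits_def length_Suc_conv)
  then show ?thesis using sum_bits_add[of f 1 q] by simp
qed

text \<open>Addressing entries by bit strings turns tensor products into concatenation and the
  qubits of a gate into list positions, which replaces the division with remainder in
  \<open>tensor_mat\<close>.\<close>

definition entry :: "complex mat \<Rightarrow> bool list \<Rightarrow> bool list \<Rightarrow> complex" where
  "entry A u v = A $$ (index_of_bits u, index_of_bits v)"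

lemma dim_tensor_mat [simp]: "dim_row (A \<Otimes> B) = dim_row A * dim_row B" "dim_col (A \<Otimes> B) = dim_col A * dim_col B"
  by (simp_all add: tensor_mat_def)

lemma tensor_carrier [simp]:
  "A \<in> carrier_mat a b \<Longrightarrow> B \<in> carrier_mat c d \<Longrightarrow> A \<Otimes> B \<in> carrier_mat (a * c) (b * d)"
  by (simp add: tensor_mat_def)

lemma index_tensor: 
  "i < dim_row A * dim_row B \<Longrightarrow> j < dim_col A * dim_col B \<Longrightarrow>
   (A \<Otimes> B) $$ (i, j) = A $$ (i div dim_row B, j div dim_col B) * B $$ (i mod dim_row B, j mod dim_col B)"
  by (simp add: tensor_mat_def)

lemma entry_tensor:
  assumes "A \<in> carrier_mat (2 ^ p) (2 ^ p)" "B \<in> carrier_mat (2 ^ q) (2 ^ q)"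
    and "u \<in> bits p" "v \<in> bits q" "u' \<in> bits p" "v' \<in> bits q"
  shows "entry (A \<Otimes> B) (u @ v) (u' @ v') = entry A u u' * entry B v v'"
proof -
  have lt: "index_of_bits (u @ v) < 2 ^ p * 2 ^ q" "index_of_bits (u' @ v') < 2 ^ p * 2 ^ q"
    using index_of_bits_lt[OF append_in_bits[OF assms(3,4)]] 
      index_of_bits_lt[OF append_in_bits[OF assms(5,6)]] by (simp_all add: power_add)
  have v: "index_of_bits v < 2 ^ q" "index_of_bits v' < 2 ^ q" using index_of_bits_lt assms by auto
  have l: "length v = q" "length v' = q" using assms by (auto simp: bits_def)
  show ?thesis
    using lt v assms(1,2) unfolding entry_def
    by (subst index_tensor) (auto simp: index_of_bits_append l)
qed

lemma entry_mult:
  assumes "A \<in> carrier_mat (2 ^ q) (2 ^ q)" "B \<in> carrier_mat (2 ^ q) (2 ^ q)" "u \<in> bits q" "v \<in> bits q"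
  shows "entry (A * B) u v = (\<Sum>w\<in>bits q. entry A u w * entry B w v)"
proof -
  have "entry (A * B) u v = (\<Sum>i<2 ^ q. A $$ (index_of_bits u, i) * B $$ (i, index_of_bits v))"
    using assms by (auto simp: entry_def scalar_prod_def atLeast0LessThan index_of_bits_lt)
  then show ?thesis by (simp add: sum_bits entry_def)
qed

lemma entry_adjoint:
  assumes "A \<in> carrier_mat (2 ^ q) (2 ^ q)" "u \<in> bits q" "v \<in> bits q"
  shows "entry (mat_adjoint A) u v = cnj (entry A v u)"
  using assms by (simp add: entry_def index_of_bits_lt conjugate_complex_def)

lemma entry_one: "u \<in> bits q \<Longrightarrow> v \<in> bits q \<Longrightarrow> entry (1\<^sub>m (2 ^ q)) u v = of_bool (u = v)"
  by (simp add: entry_def index_of_bits_lt index_of_bits_eq_iff)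

lemma outer_carrier [simp]: "v \<in> carrier_vec N \<Longrightarrow> outer v \<in> carrier_mat N N"
  by (simp add: outer_def)

lemma entry_outer_ket:
  "x \<in> bits q \<Longrightarrow> u \<in> bits q \<Longrightarrow> v \<in> bits q \<Longrightarrow> entry (outer (ket x)) u v = of_bool (u = x \<and> v = x)"
  by (auto simp: entry_def outer_def ket_def index_of_bits_lt bits_def index_of_bits_less
      index_of_bits_eq_iff[unfolded bits_def, of _ "length x"])


section \<open>The block-swap circuit\<close>

lemma tensor_one_right [simp]: "A \<Otimes> 1\<^sub>m 1 = A"
  by (rule eq_matI) (auto simp: index_tensor)

lemma outer_ket_Nil: "outer (ket []) = 1\<^sub>m 1"
  by (rule eq_matI) (auto simp: outer_def ket_def)

lemma local_op_carrier [simp]: "local_op q ps U \<in> carrier_mat (2 ^ q) (2 ^ q)"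
  by (simp add: local_op_def)

lemma entry_local_op:
  assumes "u \<in> bits q" "v \<in> bits q"
  shows "entry (local_op q ps U) u v =
    (if \<forall>j<q. j \<notin> set ps \<longrightarrow> u ! j = v ! j then entry U (map ((!) u) ps) (map ((!) v) ps) else 0)"
  using assms by (auto simp: entry_def local_op_def Let_def index_of_bits_lt bits_of_index_of_bits)

definition hadamard_entry :: "bool \<Rightarrow> bool \<Rightarrow> complex" where
  "hadamard_entry a b = complex_of_real (1 / sqrt 2) * (if a \<and> b then -1 else 1)"

lemma entry_hadamard_0:
  assumes "a # u \<in> bits q" "b # v \<in> bits q"
  shows "entry (local_op q [0] (gate_op (Hadamard 0))) (a # u) (b # v) = of_bool (u = v) * hadamard_entry a b"
proof -
  obtain r where q: "q = Suc r" "length u = r" "length v = r" using assms by (auto simp: bits_def)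
  have "(\<forall>j<q. j \<notin> set [0] \<longrightarrow> (a # u) ! j = (b # v) ! j) \<longleftrightarrow> u = v"
    unfolding q(1) using q(2,3) by (simp add: list_eq_iff_nth_eq All_less_Suc2)
  moreover have "entry (gate_op (Hadamard 0)) [a] [b] = hadamard_entry a b"
    by (cases a; cases b)
      (simp_all add: entry_def index_of_bits_def hadamard_entry_def mat_of_rows_list_def)
  ultimately show ?thesis using assms
    by (subst entry_local_op) auto
qed

section \<open>Toffoli gates as permutations of basis states\<close>

definition toffoli_map :: "nat \<Rightarrow> nat \<Rightarrow> nat \<Rightarrow> bool list \<Rightarrow> bool list" where
  "toffoli_map i j k v = v[k := (v ! k \<noteq> (v ! i \<and> v ! j))]"

lemma length_toffoli_map [simp]: "length (toffoli_map i j k v) = length v"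
  by (simp add: toffoli_map_def)

lemma toffoli_map_invol:
  assumes "i \<noteq> k" "j \<noteq> k" shows "toffoli_map i j k (toffoli_map i j k v) = v"
proof (cases "k < length v")
  case True
  then show ?thesis using assms by (auto simp: toffoli_map_def list_update_same_conv)
qed (simp add: toffoli_map_def list_update_beyond)

lemma entry_toffoli_gate:
  "entry (gate_op (Toffoli i j k)) [a, b, c] [a', b', c'] =
    of_bool (a = a' \<and> b = b' \<and> c = (c' \<noteq> (a' \<and> b')))"
  by (cases a; cases b; cases c; cases a'; cases b'; cases c')
    (simp_all add: entry_def index_of_bits_def Transposition.transpose_def)

lemma entry_toffoli:
  assumes "u \<in> bits q" "v \<in> bits q" "distinct [i, j, k]" "{i, j, k} \<subseteq> {..<q}"
  shows "entry (local_op q [i, j, k] (gate_op (Toffoli i j k))) u v = of_bool (u = toffoli_map i j k v)"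
proof -
  have l: "length u = q" "length v = q" using assms by (auto simp: bits_def)
  have "u = toffoli_map i j k v \<longleftrightarrow> (\<forall>p<q. u ! p = toffoli_map i j k v ! p)"
    using l by (auto simp: list_eq_iff_nth_eq)
  also have "\<dots> \<longleftrightarrow> (\<forall>p<q. p \<notin> set [i, j, k] \<longrightarrow> u ! p = v ! p) \<and> u ! i = v ! i \<and> u ! j = v ! j
      \<and> u ! k = (v ! k \<noteq> (v ! i \<and> v ! j))"
    using assms(3,4) l unfolding toffoli_map_def
    by (auto simp: nth_list_update)
  finally show ?thesis using assms(1,2)
    by (subst entry_local_op) (auto simp: entry_toffoli_gate simp del: gate_op.simps)
qed

text \<open>Three XORs, here controlled on qubit 0, exchange two bits.\<close>

definition cswap_gates :: "nat \<Rightarrow> nat \<Rightarrow> gate list" where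
  "cswap_gates i j = [Toffoli 0 i j, Toffoli 0 j i, Toffoli 0 i j]"

definition cswap :: "nat \<Rightarrow> nat \<Rightarrow> bool list \<Rightarrow> bool list" where
  "cswap i j v = (if v ! 0 then v[i := v ! j, j := v ! i] else v)"

text \<open>It describes the circuit on Toffoli gates; Hadamard gates do not permute the basis and
  are handled apart by \<open>entry_hadamard_0\<close>.\<close>

fun gate_map :: "gate \<Rightarrow> bool list \<Rightarrow> bool list" where
  "gate_map (Toffoli i j k) v = toffoli_map i j k v"
| "gate_map _ v = v"

lemma length_fold_gate_map [simp]: "length (fold gate_map gs v) = length v"
proof (induction gs arbitrary: v)
  case (Cons g gs) then show ?case by (cases g) auto
qed simp

lemma fold_cswap_gates:
  assumes "0 < i" "0 < j" "i \<noteq> j" "i < length v" "j < length v"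
  shows "fold gate_map (cswap_gates i j) v = cswap i j v"
proof (rule nth_equalityI)
  fix p assume "p < length (fold gate_map (cswap_gates i j) v)"
  then show "fold gate_map (cswap_gates i j) v ! p = cswap i j v ! p"
    using assms by (auto simp: cswap_gates_def cswap_def toffoli_map_def nth_list_update)
qed (simp add: cswap_def)

text \<open>With \<open>d\<close> the length of the classical input, qubit 0 is its first bit, and
  the two blocks of \<open>m\<close> qubits after the input are exchanged under its control.\<close>

definition swap_gates :: "nat \<Rightarrow> nat \<Rightarrow> gate list" where
  "swap_gates d m = concat (map (\<lambda>i. cswap_gates (d + i) (d + m + i)) [0..<m])"

text \<open>Induction on the number \<open>r\<close> of pairs already exchanged. The pairs are
  disjoint and avoid qubit 0, so the positions \<open>d + r\<close> and \<open>d + m + r\<close> and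
  the control still hold their original bits.\<close>

lemma fold_swap_gates_nth:
  assumes "0 < d" "r \<le> m" "length v = d + 2 * m" "p < d + 2 * m"
  shows "fold gate_map (concat (map (\<lambda>i. cswap_gates (d + i) (d + m + i)) [0..<r])) v ! p =
    (if v ! 0 \<and> d \<le> p \<and> p < d + r then v ! (p + m)
     else if v ! 0 \<and> d + m \<le> p \<and> p < d + m + r then v ! (p - m) else v ! p)"
  using assms(2,4)
proof (induction r arbitrary: p)
  case (Suc r)
  let ?v = "fold gate_map (concat (map (\<lambda>i. cswap_gates (d + i) (d + m + i)) [0..<r])) v"
  have IH: "p < d + 2 * m \<Longrightarrow> ?v ! p = (if v ! 0 \<and> d \<le> p \<and> p < d + r then v ! (p + m)
     else if v ! 0 \<and> d + m \<le> p \<and> p < d + m + r then v ! (p - m) else v ! p)" for p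
    using Suc by simp
  have "fold gate_map (concat (map (\<lambda>i. cswap_gates (d + i) (d + m + i)) [0..<Suc r])) v
      = cswap (d + r) (d + m + r) ?v"
    using assms Suc.prems by (simp add: fold_cswap_gates)
  moreover have "?v ! 0 = v ! 0" using IH[of 0] assms(1) Suc.prems by simp
  moreover have "?v ! (d + r) = v ! (d + r)" using IH[of "d + r"] Suc.prems by simp
  moreover have "?v ! (d + m + r) = v ! (d + m + r)" using IH[of "d + m + r"] Suc.prems by simp
  moreover have "length ?v = d + 2 * m" using assms by simp
  ultimately have "fold gate_map (concat (map (\<lambda>i. cswap_gates (d + i) (d + m + i)) [0..<Suc r])) v ! p
      = (if v ! 0 then if p = d + m + r then v ! (d + r) else if p = d + r then v ! (d + m + r) else ?v ! p
         else ?v ! p)"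
    using Suc.prems by (simp add: cswap_def nth_list_update)
  then show ?case using IH[OF Suc.prems(2)] Suc.prems(1) by (auto simp: add.commute add.left_commute)
qed auto

lemma fold_swap_gates:
  assumes "length a = m" "length b = m"
  shows "fold gate_map (swap_gates (Suc (length x)) m) (c # x @ a @ b) = (if c then c # x @ b @ a else c # x @ a @ b)"
proof (rule nth_equalityI)
  fix p assume "p < length (fold gate_map (swap_gates (Suc (length x)) m) (c # x @ a @ b))"
  then have p: "p < Suc (length x) + 2 * m" using assms by simp
  show "fold gate_map (swap_gates (Suc (length x)) m) (c # x @ a @ b) ! p =
     (if c then c # x @ b @ a else c # x @ a @ b) ! p"
  proof -
    consider (0) "p = 0" | (x) "0 < p" "p \<le> length x" | (a) "length x < p" "p \<le> length x + m"
      | (b) "length x + m < p" by linarith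
    then have "(if c \<and> Suc (length x) \<le> p \<and> p < Suc (length x) + m then (c # x @ a @ b) ! (p + m)
        else if c \<and> Suc (length x) + m \<le> p \<and> p < Suc (length x) + m + m then (c # x @ a @ b) ! (p - m)
        else (c # x @ a @ b) ! p) = (if c then c # x @ b @ a else c # x @ a @ b) ! p"
    proof cases
      case a
      define r where "r = p - Suc (length x)"
      have "p = Suc (length x) + r" "r < m" using a by (simp_all add: r_def)
      then show ?thesis using assms by (simp add: nth_append)
    next
      case b
      define r where "r = p - Suc (length x + m)"
      have "p = Suc (length x) + m + r" using b by (simp add: r_def)
      then show ?thesis using assms p by (simp add: nth_append)
    qed (auto simp: nth_append nth_Cons')
    moreover have "length (c # x @ a @ b) = Suc (length x) + 2 * m" using assms by simp
    ultimately show ?thesis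
      using fold_swap_gates_nth[of "Suc (length x)" m m "c # x @ a @ b" p] p
      by (simp only: swap_gates_def nth_Cons_0 zero_less_Suc order_refl)
  qed
qed (use assms in auto)

text \<open>A swap test without ancilla: the first Hadamard gate acts on the first bit of the
  classical input. That bit decides whether outcome 1 signals the antisymmetric subspace (bit 0) or
  the symmetric one (bit 1).\<close>

definition swap_circuit :: "nat \<Rightarrow> nat \<Rightarrow> circuit" where
  "swap_circuit d m = Circuit (d + 2 * m) 0 (Hadamard 0 # swap_gates d m @ [Hadamard 0])"

lemma set_swap_gates:
  assumes "0 < d" "g \<in> set (swap_gates d m)"
  obtains i j k where "g = Toffoli i j k" "distinct [i, j, k]" "{i, j, k} \<subseteq> {..<d + 2 * m}"
  using assms by (auto simp: swap_gates_def cswap_gates_def)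

lemma valid_swap_circuit:
  assumes "0 < d" shows "valid_circuit (swap_circuit d m)"
proof -
  have "distinct (gate_qubits g) \<and> set (gate_qubits g) \<subseteq> {..<d + 2 * m}" if "g \<in> set (swap_gates d m)" for g
    using set_swap_gates[OF assms that] by (metis gate_qubits.simps(4) empty_set list.simps(15))
  then show ?thesis using assms by (auto simp: valid_circuit_def swap_circuit_def width_def)
qed

lemma length_swap_gates: "length (swap_gates d m) = 3 * m"
  by (simp add: swap_gates_def cswap_gates_def length_concat comp_def sum_list_triv)

abbreviation "apply_gate q U g \<equiv> local_op q (gate_qubits g) (gate_op g) * U"

lemma foldl_gates_carrier:
  "X \<in> carrier_mat (2 ^ q) (2 ^ q) \<Longrightarrow> foldl (apply_gate q) X gs \<in> carrier_mat (2 ^ q) (2 ^ q)"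
proof (induction gs arbitrary: X)
  case (Cons g gs)
  then have "apply_gate q X g \<in> carrier_mat (2 ^ q) (2 ^ q)"
    by (intro mult_carrier_mat[OF local_op_carrier])
  then show ?case using Cons.IH by simp
qed simp

text \<open>A permutation matrix multiplied from the left moves row \<open>u\<close> to row
  \<open>gate_map g u\<close>. If the row label follows the gates, the entry stays constant, and no
  inverse permutation has to be described.\<close>

lemma entry_foldl_toffoli:
  assumes "X \<in> carrier_mat (2 ^ q) (2 ^ q)" "u \<in> bits q" "v \<in> bits q"
    and "\<And>g. g \<in> set gs \<Longrightarrow> \<exists>i j k. g = Toffoli i j k \<and> distinct [i, j, k] \<and> {i, j, k} \<subseteq> {..<q}"
  shows "entry (foldl (apply_gate q) X gs) (fold gate_map gs u) v = entry X u v"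
  using assms
proof (induction gs arbitrary: X u)
  case (Cons g gs)
  obtain i j k where g: "g = Toffoli i j k" "distinct [i, j, k]" "{i, j, k} \<subseteq> {..<q}"
    using Cons.prems(4)[of g] by auto
  have tu: "toffoli_map i j k u \<in> bits q" using Cons.prems by (simp add: bits_def)
  have "entry (foldl (apply_gate q) X (g # gs)) (fold gate_map (g # gs) u) v
      = entry (foldl (apply_gate q) (apply_gate q X g) gs) (fold gate_map gs (toffoli_map i j k u)) v"
    by (simp add: g)
  also have "\<dots> = entry (apply_gate q X g) (toffoli_map i j k u) v"
    by (rule Cons.IH[OF mult_carrier_mat[OF local_op_carrier Cons.prems(1)] tu Cons.prems(3)])
       (use Cons.prems(4) in auto)
  also have "\<dots> = (\<Sum>w\<in>bits q. of_bool (toffoli_map i j k u = toffoli_map i j k w) * entry X w v)"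
  proof -
    have "entry (local_op q (gate_qubits g) (gate_op g)) (toffoli_map i j k u) w
        = of_bool (toffoli_map i j k u = toffoli_map i j k w)" if "w \<in> bits q" for w
      using entry_toffoli[OF tu that g(2,3)] by (simp add: g(1) del: gate_op.simps)
    then show ?thesis
      using entry_mult[OF local_op_carrier Cons.prems(1) tu Cons.prems(3)] by simp
  qed
  \<comment> \<open>A Toffoli gate is an involution on labels, so equal images mean equal labels,
    and only \<open>w = u\<close> survives in the sum.\<close>
  also have "\<dots> = (\<Sum>w\<in>bits q. of_bool (u = w) * entry X w v)"
  proof (intro sum.cong refl)
    fix w
    have "toffoli_map i j k u = toffoli_map i j k w \<longleftrightarrow> u = w"
      using g(2) toffoli_map_invol[of i k j] by (auto simp del: toffoli_map_invol) metis
    then show "of_bool (toffoli_map i j k u = toffoli_map i j k w) * entry X w v = of_bool (u = w) * entry X w v"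
      by simp
  qed
  also have "\<dots> = entry X u v" using Cons.prems by (simp add: of_bool_def if_distribR sum.delta' if_distrib[of "\<lambda>z. z * _"] cong: if_cong)
  finally show ?case .
qed simp

section \<open>Acceptance probability of the swap circuit\<close>

definition block_swap :: "nat \<Rightarrow> nat \<Rightarrow> bool list \<Rightarrow> bool list" where
  "block_swap d m z = take d z @ drop m (drop d z) @ take m (drop d z)"

lemma block_swap_append [simp]: "x \<in> bits d \<Longrightarrow> a \<in> bits m \<Longrightarrow> b \<in> bits m \<Longrightarrow> block_swap d m (x @ a @ b) = x @ b @ a"
  by (simp add: block_swap_def bits_def)

lemma bits_blocks:
  assumes "z \<in> bits (d + 2 * m)"
  obtains x a b where "z = x @ a @ b" "x \<in> bits d" "a \<in> bits m" "b \<in> bits m"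
proof
  show "z = take d z @ take m (drop d z) @ drop m (drop d z)" by (simp only: append_take_drop_id)
qed (use assms in \<open>auto simp: bits_def\<close>)

lemma block_swap_in_bits: "z \<in> bits (d + 2 * m) \<Longrightarrow> block_swap d m z \<in> bits (d + 2 * m)"
  by (erule bits_blocks) (simp, simp add: bits_def)

lemma block_swap_invol: "z \<in> bits (d + 2 * m) \<Longrightarrow> block_swap d m (block_swap d m z) = z"
  by (erule bits_blocks) simp

text \<open>Up to normalisation, the Hadamard gate maps the basis state of a bit \<open>b\<close> to
  |0> + \<open>sgb b\<close> |1>.\<close>

definition sgb :: "bool \<Rightarrow> complex" where "sgb b = (if b then -1 else 1)"

lemma circuit_unitary_carrier [simp]:
  "circuit_unitary C \<in> carrier_mat (2 ^ width C) (2 ^ width C)"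
  unfolding circuit_unitary_def by (rule foldl_gates_carrier) simp

lemma Cons_in_bits: "b # z \<in> bits (Suc q) \<longleftrightarrow> z \<in> bits q"
  by (simp add: bits_def)

lemma hadamard_entry_sq:
  "hadamard_entry True False * hadamard_entry False b = 1 / 2"
  "hadamard_entry True True * hadamard_entry True b = - sgb b / 2"
  by (auto simp: hadamard_entry_def sgb_def simp flip: of_real_mult)

text \<open>Let S be the block swap. The path through control 0 contributes the identity and the one
  through control 1 contributes S; the last Hadamard gate subtracts them. Only rows with control
  \<open>True\<close> are computed because only outcome 1 is measured later.\<close>

lemma entry_swap_unitary:
  assumes y: "y \<in> bits (d + 2 * m)" and z: "z \<in> bits (d + 2 * m)"
  shows "entry (circuit_unitary (swap_circuit (Suc d) m)) (True # y) (b # z)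
    = (of_bool (y = z) - sgb b * of_bool (block_swap d m y = z)) / 2"
proof -
  define q where "q = Suc (d + 2 * m)"
  define H where "H = local_op q [0] (gate_op (Hadamard 0))"
  define Y where "Y = foldl (apply_gate q) H (swap_gates (Suc d) m)"
  have H: "H \<in> carrier_mat (2 ^ q) (2 ^ q)" by (simp add: H_def)
  then have Y: "Y \<in> carrier_mat (2 ^ q) (2 ^ q)" unfolding Y_def by (rule foldl_gates_carrier)
  have U: "circuit_unitary (swap_circuit (Suc d) m) = H * Y"
    using right_mult_one_mat[OF H]
    by (simp add: circuit_unitary_def swap_circuit_def width_def q_def[symmetric] Y_def H_def del: gate_op.simps)
  have in_q: "c # w \<in> bits q \<longleftrightarrow> w \<in> bits (d + 2 * m)" for c w by (simp add: q_def Cons_in_bits)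
  have fold: "fold gate_map (swap_gates (Suc d) m) (c # w) = c # (if c then block_swap d m w else w)"
    if "w \<in> bits (d + 2 * m)" for c w
    using that
  proof (rule bits_blocks)
    fix x a b assume "w = x @ a @ b" "x \<in> bits d" "a \<in> bits m" "b \<in> bits m"
    then show ?thesis using fold_swap_gates[of a m b x c] by (simp add: bits_def block_swap_def)
  qed
  \<comment> \<open>The row is written as the image of \<open>c # w\<close> under the controlled
    swap, the form in which \<open>entry_foldl_toffoli\<close> applies.\<close>
  have entY: "entry Y (c # (if c then block_swap d m w else w)) (b # z) = hadamard_entry c b * of_bool (w = z)"
    if w: "w \<in> bits (d + 2 * m)" for c w
  proof -
    have "entry Y (fold gate_map (swap_gates (Suc d) m) (c # w)) (b # z) = entry H (c # w) (b # z)"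
      unfolding Y_def
    proof (rule entry_foldl_toffoli)
      fix g assume "g \<in> set (swap_gates (Suc d) m)"
      then show "\<exists>i j k. g = Toffoli i j k \<and> distinct [i, j, k] \<and> {i, j, k} \<subseteq> {..<q}"
        using set_swap_gates[of "Suc d" g m] unfolding q_def by (metis add_Suc zero_less_Suc)
    qed (use H w z in_q in auto)
    then show ?thesis using w z fold in_q by (simp add: H_def entry_hadamard_0 del: gate_op.simps)
  qed
  have "entry (H * Y) (True # y) (b # z) = (\<Sum>w\<in>bits q. entry H (True # y) w * entry Y w (b # z))"
    using H Y y z in_q by (intro entry_mult) auto
  also have "\<dots> = (\<Sum>w\<in>bits (d + 2 * m). entry H (True # y) (False # w) * entry Y (False # w) (b # z))
      + (\<Sum>w\<in>bits (d + 2 * m). entry H (True # y) (True # w) * entry Y (True # w) (b # z))"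
    unfolding q_def by (rule sum_bits_Suc)
  also have "\<dots> = hadamard_entry True False * entry Y (False # y) (b # z)
      + hadamard_entry True True * entry Y (True # y) (b # z)"
  proof (rule arg_cong2[where f = "(+)"])
    have "(\<Sum>w\<in>bits (d + 2 * m). entry H (True # y) (c # w) * entry Y (c # w) (b # z))
        = (\<Sum>w\<in>bits (d + 2 * m). if w = y then hadamard_entry True c * entry Y (c # y) (b # z) else 0)" for c
      using y in_q by (intro sum.cong) (auto simp: H_def entry_hadamard_0 simp del: gate_op.simps)
    then show "(\<Sum>w\<in>bits (d + 2 * m). entry H (True # y) (False # w) * entry Y (False # w) (b # z))
        = hadamard_entry True False * entry Y (False # y) (b # z)"
      "(\<Sum>w\<in>bits (d + 2 * m). entry H (True # y) (True # w) * entry Y (True # w) (b # z))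
        = hadamard_entry True True * entry Y (True # y) (b # z)"
      using y by simp_all
  qed
  also have "\<dots> = hadamard_entry True False * (hadamard_entry False b * of_bool (y = z))
      + hadamard_entry True True * (hadamard_entry True b * of_bool (block_swap d m y = z))"
    using entY[OF y, of False] entY[OF block_swap_in_bits[OF y], of True] y
    by (simp add: block_swap_invol)
  also have "\<dots> = (of_bool (y = z) - sgb b * of_bool (block_swap d m y = z)) / 2"
    by (simp only: mult.assoc[symmetric] hadamard_entry_sq) (simp add: field_simps)
  finally show ?thesis by (simp add: U)
qed

text \<open>The hypotheses put the control qubit of \<open>R\<close> into the basis state
  \<open>x0\<close>. With S the block swap and K = (1 - \<open>sgb x0\<close> S) / 2, the outcome
  probability is the trace of K R K. As S is an involution, K is a projector, and the trace of K R
  remains.\<close>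

lemma swap_circuit_outcome_aux:
  assumes R: "R \<in> carrier_mat (2 ^ Suc (d + 2 * m)) (2 ^ Suc (d + 2 * m))"
    and R0: "\<And>b z w. b \<noteq> x0 \<Longrightarrow> z \<in> bits (d + 2 * m) \<Longrightarrow> w \<in> bits (Suc (d + 2 * m)) \<Longrightarrow> entry R (b # z) w = 0"
      "\<And>b z w. b \<noteq> x0 \<Longrightarrow> z \<in> bits (d + 2 * m) \<Longrightarrow> w \<in> bits (Suc (d + 2 * m)) \<Longrightarrow> entry R w (b # z) = 0"
  shows "outcome_prob (swap_circuit (Suc d) m) R [True] =
    (Re (\<Sum>y\<in>bits (d + 2 * m). entry R (x0 # y) (x0 # y))
     - Re (sgb x0 * (\<Sum>y\<in>bits (d + 2 * m). entry R (x0 # y) (x0 # block_swap d m y)))) / 2"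
proof -
  let ?p = "d + 2 * m" and ?U = "circuit_unitary (swap_circuit (Suc d) m)" and ?s = "block_swap d m"
  let ?q = "Suc ?p"
  have U: "?U \<in> carrier_mat (2 ^ ?q) (2 ^ ?q)"
    using circuit_unitary_carrier[of "swap_circuit (Suc d) m"] by (simp add: width_def swap_circuit_def)
  have row: "(\<Sum>w\<in>bits ?q. entry ?U (True # y) w * F w) = (F (x0 # y) - sgb x0 * F (x0 # ?s y)) / 2"
    if F: "\<And>b z. b \<noteq> x0 \<Longrightarrow> z \<in> bits ?p \<Longrightarrow> F (b # z) = 0" and y: "y \<in> bits ?p" for F y
  proof -
    have "(\<Sum>w\<in>bits ?q. entry ?U (True # y) w * F w) = (\<Sum>z\<in>bits ?p. entry ?U (True # y) (x0 # z) * F (x0 # z))"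
      using F[of "\<not> x0"] by (cases x0) (simp_all add: sum_bits_Suc)
    also have "\<dots> = (\<Sum>z\<in>bits ?p. (of_bool (y = z) * F (x0 # z) - sgb x0 * (of_bool (?s y = z) * F (x0 # z))) / 2)"
      using y by (intro sum.cong) (auto simp: entry_swap_unitary field_simps)
    also have "\<dots> = (F (x0 # y) - sgb x0 * F (x0 # ?s y)) / 2"
      using y block_swap_in_bits[OF y]
      by (simp add: sum_divide_distrib[symmetric] sum_subtractf sum_distrib_left[symmetric]
          of_bool_def if_distrib[of "\<lambda>z. z * _"] sum.delta' cong: if_cong)
    finally show ?thesis .
  qed
  have M: "run_circuit (swap_circuit (Suc d) m) R = ?U * R * mat_adjoint ?U"
    using tensor_one_right[of R] by (simp add: run_circuit_def swap_circuit_def outer_ket_Nil)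
  have ent: "entry (?U * R * mat_adjoint ?U) (True # y) (True # y) =
     (entry R (x0 # y) (x0 # y) - sgb x0 * entry R (x0 # y) (x0 # ?s y)
      - sgb x0 * entry R (x0 # ?s y) (x0 # y) + entry R (x0 # ?s y) (x0 # ?s y)) / 4"
    if y: "y \<in> bits ?p" for y
  proof -
    have Ty: "True # y \<in> bits ?q" using y by (simp add: Cons_in_bits)
    have col: "entry (?U * R) (True # y) w = (entry R (x0 # y) w - sgb x0 * entry R (x0 # ?s y) w) / 2"
      if w: "w \<in> bits ?q" for w
      unfolding entry_mult[OF U R Ty w] by (rule row) (use R0(1) w y in auto)
    have UR: "?U * R \<in> carrier_mat (2 ^ ?q) (2 ^ ?q)" using U R by simp
    have sg: "cnj (sgb x0) = sgb x0" "sgb x0 * sgb x0 = 1" by (auto simp: sgb_def)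
    have "entry (?U * R * mat_adjoint ?U) (True # y) (True # y)
        = (\<Sum>w\<in>bits ?q. entry (?U * R) (True # y) w * cnj (entry ?U (True # y) w))"
      unfolding entry_mult[OF UR mat_adjoint_carrier[OF U] Ty Ty]
      by (intro sum.cong refl arg_cong2[where f = "(*)"] entry_adjoint[OF U _ Ty])
    \<comment> \<open>Conjugation brings the sum over columns into the form of \<open>row\<close>,
      whose weights are the unconjugated entries of the unitary. As \<open>sgb x0\<close> is real,
      conjugating back does not affect it.\<close>
    also have "\<dots> = cnj (\<Sum>w\<in>bits ?q. entry ?U (True # y) w * cnj (entry (?U * R) (True # y) w))"
      by (simp add: mult.commute)
    also have "\<dots> = cnj ((cnj (entry (?U * R) (True # y) (x0 # y)) - sgb x0 * cnj (entry (?U * R) (True # y) (x0 # ?s y))) / 2)"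
      using y R0 block_swap_in_bits[OF y] by (subst row) (auto simp: col Cons_in_bits)
    also have "\<dots> = (entry (?U * R) (True # y) (x0 # y) - sgb x0 * entry (?U * R) (True # y) (x0 # ?s y)) / 2"
      by (simp add: sg)
    also have "\<dots> = (entry R (x0 # y) (x0 # y) - sgb x0 * entry R (x0 # y) (x0 # ?s y)
      - sgb x0 * entry R (x0 # ?s y) (x0 # y) + entry R (x0 # ?s y) (x0 # ?s y)) / 4"
      using y block_swap_in_bits[OF y] sg(2)
      by (simp add: col Cons_in_bits field_simps)
    finally show ?thesis .
  qed
  \<comment> \<open>Summed over \<open>y\<close>, the involution identifies the two diagonal terms
    with each other, and likewise the two cross terms. Four quarters thus become two halves.\<close>
  have reindex: "(\<Sum>y\<in>bits ?p. f (?s y) y) = (\<Sum>y\<in>bits ?p. f y (?s y))" for f :: "bool list \<Rightarrow> bool list \<Rightarrow> complex"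
    by (rule sum.reindex_bij_witness[where i = ?s and j = ?s]) (auto simp: block_swap_invol block_swap_in_bits)
  have reindex2: "(\<Sum>y\<in>bits ?p. entry R (x0 # ?s y) (x0 # ?s y)) = (\<Sum>y\<in>bits ?p. entry R (x0 # y) (x0 # y))"
    by (rule sum.reindex_bij_witness[where i = ?s and j = ?s]) (auto simp: block_swap_invol block_swap_in_bits)
  have reindex1: "(\<Sum>y\<in>bits ?p. entry R (x0 # ?s y) (x0 # y)) = (\<Sum>y\<in>bits ?p. entry R (x0 # y) (x0 # ?s y))"
    by (rule reindex)
  have "outcome_prob (swap_circuit (Suc d) m) R [True] =
      Re (\<Sum>k<2 ^ ?p. (?U * R * mat_adjoint ?U) $$ (2 ^ ?p + k, 2 ^ ?p + k))"
    unfolding outcome_prob_def M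
    by (simp add: keep_first_def index_of_bits_Cons width_def swap_circuit_def)
  also have "\<dots> = Re (\<Sum>y\<in>bits ?p. entry (?U * R * mat_adjoint ?U) (True # y) (True # y))"
    by (subst sum_bits) (auto simp: entry_def index_of_bits_Cons bits_def intro!: sum.cong arg_cong[where f = Re])
  also have "\<dots> = Re (((\<Sum>y\<in>bits ?p. entry R (x0 # y) (x0 # y))
     - sgb x0 * (\<Sum>y\<in>bits ?p. entry R (x0 # y) (x0 # ?s y))) / 2)"
    by (simp add: ent sum_divide_distrib[symmetric] sum.distrib sum_subtractf sum_distrib_left[symmetric] reindex1 reindex2)
  finally show ?thesis by (simp add: algebra_simps)
qed

lemma swap_circuit_outcome:
  assumes d: "0 < d" and x: "x \<in> bits d" and W: "W \<in> carrier_mat (2 ^ (2 * m)) (2 ^ (2 * m))"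
  shows "outcome_prob (swap_circuit d m) (outer (ket x) \<Otimes> W) [True] =
    (Re (\<Sum>u\<in>bits (2 * m). entry W u u)
     - Re (sgb (hd x) * (\<Sum>a\<in>bits m. \<Sum>b\<in>bits m. entry W (a @ b) (b @ a)))) / 2"
proof -
  obtain e x0 x' where e: "d = Suc e" "x = x0 # x'" "x' \<in> bits e"
    using d x by (cases d; cases x) (auto simp: bits_def)
  let ?R = "outer (ket x) \<Otimes> W" and ?p = "e + 2 * m"
  have kx: "outer (ket x) \<in> carrier_mat (2 ^ Suc e) (2 ^ Suc e)"
    using x e by (intro outer_carrier) (simp add: ket_def bits_def)
  then have R: "?R \<in> carrier_mat (2 ^ Suc ?p) (2 ^ Suc ?p)"
    using tensor_carrier[OF kx W] by (simp add: power_add mult.assoc)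
  have split: "\<exists>c u v. w = (c # u) @ v \<and> c # u \<in> bits (Suc e) \<and> u \<in> bits e \<and> v \<in> bits (2 * m)" if "w \<in> bits (Suc ?p)" for w
  proof -
    obtain c w' where w: "w = c # w'" "w' \<in> bits ?p" using \<open>w \<in> bits (Suc ?p)\<close> by (cases w) (auto simp: bits_def)
    then have "w = (c # take e w') @ drop e w'" "take e w' \<in> bits e" "drop e w' \<in> bits (2 * m)"
      by (auto simp: bits_def)
    then show ?thesis using Cons_in_bits by blast
  qed
  have ent: "entry ?R (b # u @ v) (b' # u' @ v') = of_bool (b = x0 \<and> b' = x0 \<and> u = x' \<and> u' = x') * entry W v v'"
    if "u \<in> bits e" "v \<in> bits (2 * m)" "u' \<in> bits e" "v' \<in> bits (2 * m)" for b b' u v u' v'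
  proof -
    have "entry ?R ((b # u) @ v) ((b' # u') @ v') = entry (outer (ket x)) (b # u) (b' # u') * entry W v v'"
      by (rule entry_tensor[OF kx W]) (use that in \<open>auto simp: Cons_in_bits\<close>)
    also have "entry (outer (ket x)) (b # u) (b' # u') = of_bool (b = x0 \<and> b' = x0 \<and> u = x' \<and> u' = x')"
      using that x e by (subst entry_outer_ket[where q = "Suc e"]) (auto simp: Cons_in_bits)
    finally show ?thesis by simp
  qed
  have z: "entry ?R (b # z) w = 0" "entry ?R w (b # z) = 0"
    if bzw: "b \<noteq> x0" "z \<in> bits ?p" "w \<in> bits (Suc ?p)" for b z w
  proof -
    obtain c u v where w: "w = c # u @ v" "u \<in> bits e" "v \<in> bits (2 * m)" using split[OF bzw(3)] by auto
    obtain c' u' v' where z: "b # z = c' # u' @ v'" "u' \<in> bits e" "v' \<in> bits (2 * m)"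
      using split[of "b # z"] bzw by (metis Cons_in_bits append_Cons)
    show "entry ?R (b # z) w = 0" "entry ?R w (b # z) = 0"
      using ent[OF z(2,3) w(2,3)] ent[OF w(2,3) z(2,3)] z(1) w(1) bzw(1) by auto
  qed
  have t: "(\<Sum>y\<in>bits ?p. entry ?R (x0 # y) (x0 # y)) = (\<Sum>u\<in>bits (2 * m). entry W u u)"
  proof -
    have "(\<Sum>y\<in>bits ?p. entry ?R (x0 # y) (x0 # y)) = (\<Sum>u\<in>bits e. \<Sum>v\<in>bits (2 * m). of_bool (u = x') * entry W v v)"
      by (subst sum_bits_add, intro sum.cong refl) (subst ent, auto)
    also have "\<dots> = (\<Sum>u\<in>bits e. if u = x' then \<Sum>v\<in>bits (2 * m). entry W v v else 0)"
      by (intro sum.cong) auto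
    finally show ?thesis using e(3) by simp
  qed
  have s: "(\<Sum>y\<in>bits ?p. entry ?R (x0 # y) (x0 # block_swap e m y)) = (\<Sum>a\<in>bits m. \<Sum>b\<in>bits m. entry W (a @ b) (b @ a))"
  proof -
    have "(\<Sum>y\<in>bits ?p. entry ?R (x0 # y) (x0 # block_swap e m y)) 
      = (\<Sum>u\<in>bits e. \<Sum>a\<in>bits m. \<Sum>b\<in>bits m. entry ?R (x0 # u @ a @ b) (x0 # u @ b @ a))"
      unfolding mult_2 by (simp add: sum_bits_add)
    also have "\<dots> = (\<Sum>u\<in>bits e. \<Sum>a\<in>bits m. \<Sum>b\<in>bits m. of_bool (u = x') * entry W (a @ b) (b @ a))"
      by (intro sum.cong refl) (subst ent, auto simp: mult_2 append_in_bits)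
    also have "\<dots> = (\<Sum>u\<in>bits e. if u = x' then \<Sum>a\<in>bits m. \<Sum>b\<in>bits m. entry W (a @ b) (b @ a) else 0)"
      by (intro sum.cong) auto
    finally show ?thesis using e(3) by simp
  qed
  show ?thesis
    unfolding e(1) by (subst swap_circuit_outcome_aux[where ?x0.0 = x0]) (use R z t s in \<open>auto simp: e\<close>)
qed


section \<open>Overlaps, pure states and the swap test\<close>

definition btrace :: "nat \<Rightarrow> complex mat \<Rightarrow> complex" where
  "btrace q A = (\<Sum>u\<in>bits q. entry A u u)"

text \<open>The trace of the product of \<open>A\<close> and \<open>B\<close>. It is what the cross
  term of \<open>swap_circuit_outcome\<close> gives for \<open>A \<Otimes> B\<close>: exchanging the
  blocks contracts the indices of \<open>A\<close> with those of \<open>B\<close>.\<close>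

definition overlap :: "nat \<Rightarrow> complex mat \<Rightarrow> complex mat \<Rightarrow> complex" where
  "overlap q A B = (\<Sum>u\<in>bits q. \<Sum>v\<in>bits q. entry A u v * entry B v u)"

lemma btrace_eq: "btrace q A = (\<Sum>i<2 ^ q. A $$ (i, i))"
  by (simp add: btrace_def sum_bits entry_def)

lemma overlap_eq: "overlap q A B = (\<Sum>i<2 ^ q. \<Sum>j<2 ^ q. A $$ (i, j) * B $$ (j, i))"
  by (simp add: overlap_def sum_bits entry_def)

lemma btrace_tensor:
  assumes "A \<in> carrier_mat (2 ^ p) (2 ^ p)" "B \<in> carrier_mat (2 ^ q) (2 ^ q)"
  shows "btrace (p + q) (A \<Otimes> B) = btrace p A * btrace q B"
proof -
  have "btrace (p + q) (A \<Otimes> B) = (\<Sum>u\<in>bits p. \<Sum>v\<in>bits q. entry A u u * entry B v v)"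
    unfolding btrace_def sum_bits_add by (intro sum.cong refl entry_tensor[OF assms(1,2)])
  then show ?thesis by (simp add: btrace_def sum_product)
qed

lemma overlap_tensor:
  assumes "A \<in> carrier_mat (2 ^ p) (2 ^ p)" "B \<in> carrier_mat (2 ^ q) (2 ^ q)"
    "A' \<in> carrier_mat (2 ^ p) (2 ^ p)" "B' \<in> carrier_mat (2 ^ q) (2 ^ q)"
  shows "overlap (p + q) (A \<Otimes> B) (A' \<Otimes> B') = overlap p A A' * overlap q B B'"
proof -
  have "overlap (p + q) (A \<Otimes> B) (A' \<Otimes> B') =
     (\<Sum>u\<in>bits p. \<Sum>v\<in>bits q. \<Sum>u'\<in>bits p. \<Sum>v'\<in>bits q. (entry A u u' * entry B v v') * (entry A' u' u * entry B' v' v))"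
    unfolding overlap_def sum_bits_add
    by (intro sum.cong refl arg_cong2[where f = "(*)"] entry_tensor[OF assms(1,2)] entry_tensor[OF assms(3,4)])
  also have "\<dots> = (\<Sum>u\<in>bits p. \<Sum>u'\<in>bits p. \<Sum>v\<in>bits q. \<Sum>v'\<in>bits q. (entry A u u' * entry A' u' u) * (entry B v v' * entry B' v' v))"
    by (subst sum.swap[of _ "bits p" "bits q"]) (simp add: mult_ac)
  also have "\<dots> = overlap p A A' * overlap q B B'"
    by (simp add: overlap_def sum_distrib_left[symmetric] sum_distrib_right[symmetric])
  finally show ?thesis .
qed

lemma tensor_list_Cons: "tensor_list (A # As) = A \<Otimes> tensor_list As"
  by (simp add: tensor_list_def)

lemma tensor_list_Nil [simp]: "tensor_list [] = 1\<^sub>m 1"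
  by (simp add: tensor_list_def)

lemma tensor_power_carrier:
  assumes "A \<in> carrier_mat (2 ^ q) (2 ^ q)"
  shows "tensor_list (replicate t A) \<in> carrier_mat (2 ^ (t * q)) (2 ^ (t * q))"
  by (induction t) (auto simp: tensor_list_Cons power_add intro!: tensor_carrier assms)

lemma btrace_tensor_power:
  assumes "A \<in> carrier_mat (2 ^ q) (2 ^ q)"
  shows "btrace (t * q) (tensor_list (replicate t A)) = btrace q A ^ t"
proof (induction t)
  case (Suc t)
  then show ?case using btrace_tensor[OF assms tensor_power_carrier[OF assms]] by (simp add: tensor_list_Cons)
qed (simp add: btrace_def entry_def)

lemma overlap_tensor_power:
  assumes "A \<in> carrier_mat (2 ^ q) (2 ^ q)" "B \<in> carrier_mat (2 ^ q) (2 ^ q)"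
  shows "overlap (t * q) (tensor_list (replicate t A)) (tensor_list (replicate t B)) = overlap q A B ^ t"
proof (induction t)
  case (Suc t)
  then show ?case
    using overlap_tensor[OF assms(1) tensor_power_carrier[OF assms(1)] assms(2) tensor_power_carrier[OF assms(2)]]
    by (simp add: tensor_list_Cons)
qed (simp add: overlap_def entry_def)

lemma swap_test:
  assumes d: "0 < d" and x: "x \<in> bits d" and R: "R \<in> carrier_mat (2 ^ m) (2 ^ m)" and S: "S \<in> carrier_mat (2 ^ m) (2 ^ m)"
  shows "outcome_prob (swap_circuit d m) (outer (ket x) \<Otimes> R \<Otimes> S) [True] =
    (Re (btrace m R * btrace m S) - Re (sgb (hd x) * overlap m R S)) / 2"
proof -
  have "R \<Otimes> S \<in> carrier_mat (2 ^ (2 * m)) (2 ^ (2 * m))"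
    using tensor_carrier[OF R S] by (simp add: mult_2 power_add)
  moreover have "(\<Sum>u\<in>bits (2 * m). entry (R \<Otimes> S) u u) = btrace m R * btrace m S"
    using btrace_tensor[OF R S] by (simp add: mult_2 btrace_def)
  moreover have "(\<Sum>a\<in>bits m. \<Sum>b\<in>bits m. entry (R \<Otimes> S) (a @ b) (b @ a)) = overlap m R S"
    unfolding overlap_def by (intro sum.cong refl entry_tensor[OF R S])
  ultimately show ?thesis using swap_circuit_outcome[OF d x, of "R \<Otimes> S" m] by simp
qed

text \<open>The advice \<open>1\<^sub>m 1\<close> is the empty register. The traces stay in the
  formula because it will be applied to every amplitude function \<theta>, whereas Haar states are
  normalised only almost everywhere.\<close>

lemma accept_purity_test:
  assumes "0 < d" "x \<in> bits d" "\<rho> \<in> carrier_mat (2 ^ n) (2 ^ n)"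
  shows "accept_prob (swap_circuit d n) [x] 2 [\<rho>] (1\<^sub>m 1) =
    (Re (btrace n \<rho> * btrace n \<rho>) - Re (sgb (hd x) * overlap n \<rho> \<rho>)) / 2"
proof -
  have "tensor_list (concat (map (replicate 2) [\<rho>])) = \<rho> \<Otimes> \<rho>"
    using tensor_one_right[of \<rho>] by (simp add: numeral_2_eq_2 tensor_list_Cons)
  moreover have "(\<rho> \<Otimes> \<rho>) \<Otimes> 1\<^sub>m 1 = \<rho> \<Otimes> \<rho>" by (rule tensor_one_right)
  ultimately show ?thesis using swap_test[OF assms(1,2,3,3)] by (simp add: accept_prob_def)
qed

text \<open>Swapping whole blocks of \<open>t\<close> copies produces the \<open>t\<close>-th power
  of the overlap. The second block is the advice, so the circuit does not have to prepare
  \<sigma>.\<close>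

lemma accept_overlap_test:
  assumes "0 < d" "x \<in> bits d" "\<rho> \<in> carrier_mat (2 ^ n) (2 ^ n)" "\<sigma> \<in> carrier_mat (2 ^ n) (2 ^ n)"
  shows "accept_prob (swap_circuit d (t * n)) [x] t [\<rho>] (tensor_list (replicate t \<sigma>)) =
    (Re (btrace n \<rho> ^ t * btrace n \<sigma> ^ t) - Re (sgb (hd x) * overlap n \<rho> \<sigma> ^ t)) / 2"
  using swap_test[OF assms(1,2) tensor_power_carrier[OF assms(3)] tensor_power_carrier[OF assms(4)], of t]
    overlap_tensor_power[OF assms(3,4)] btrace_tensor_power[OF assms(3)] btrace_tensor_power[OF assms(4)]
  by (simp add: accept_prob_def)

lemma index_outer: "v \<in> carrier_vec N \<Longrightarrow> i < N \<Longrightarrow> j < N \<Longrightarrow> outer v $$ (i, j) = v $ i * cnj (v $ j)"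
  by (simp add: outer_def)

lemma cscalar_prod_eq: "w \<in> carrier_vec N \<Longrightarrow> v \<bullet>c w = (\<Sum>i<N. v $ i * cnj (w $ i))"
  by (simp add: scalar_prod_def atLeast0LessThan)

lemma cscalar_prod_self: "v \<in> carrier_vec N \<Longrightarrow> v \<bullet>c v = complex_of_real (\<Sum>i<N. (cmod (v $ i))\<^sup>2)"
  by (simp add: cscalar_prod_eq complex_norm_square del: of_real_power)

lemma btrace_outer: "v \<in> carrier_vec (2 ^ q) \<Longrightarrow> btrace q (outer v) = v \<bullet>c v"
  by (simp add: btrace_eq index_outer cscalar_prod_eq)

lemma cscalar_prod_cnj: "v \<in> carrier_vec N \<Longrightarrow> w \<in> carrier_vec N \<Longrightarrow> cnj (v \<bullet>c w) = w \<bullet>c v"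
  by (simp add: cscalar_prod_eq mult.commute)

lemma overlap_outer:
  assumes "v \<in> carrier_vec (2 ^ q)" "w \<in> carrier_vec (2 ^ q)"
  shows "overlap q (outer v) (outer w) = complex_of_real ((cmod (v \<bullet>c w))\<^sup>2)"
proof -
  have "overlap q (outer v) (outer w) = (\<Sum>i<2 ^ q. \<Sum>j<2 ^ q. (v $ i * cnj (w $ i)) * (w $ j * cnj (v $ j)))"
    using assms by (simp add: overlap_eq index_outer mult_ac)
  also have "\<dots> = (v \<bullet>c w) * cnj (v \<bullet>c w)"
    using assms by (simp add: cscalar_prod_cnj) (simp add: cscalar_prod_eq sum_product)
  finally show ?thesis by (simp only: complex_norm_square)
qed

lemma pure_stateD: "pure_state N v \<Longrightarrow> v \<in> carrier_vec N" "pure_state N v \<Longrightarrow> v \<bullet>c v = 1"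
  by (auto simp: pure_state_def)

lemma mat_vec_inner:
  assumes "A \<in> carrier_mat N N" "v \<in> carrier_vec N" "w \<in> carrier_vec N"
  shows "(A *\<^sub>v v) \<bullet>c w = (\<Sum>i<N. \<Sum>j<N. A $$ (i, j) * v $ j * cnj (w $ i))"
  using assms by (simp add: cscalar_prod_eq mult_mat_vec_def scalar_prod_def atLeast0LessThan sum_distrib_right)

lemma outer_mat_vec_inner:
  assumes "v \<in> carrier_vec N" "w \<in> carrier_vec N"
  shows "(outer v *\<^sub>v w) \<bullet>c w = complex_of_real ((cmod (v \<bullet>c w))\<^sup>2)"
proof -
  have "(outer v *\<^sub>v w) \<bullet>c w = (\<Sum>i<N. \<Sum>j<N. (v $ i * cnj (w $ i)) * (w $ j * cnj (v $ j)))"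
    using assms mat_vec_inner[OF outer_carrier[OF assms(1)] assms(2,2)] by (simp add: index_outer mult_ac)
  also have "\<dots> = (v \<bullet>c w) * cnj (v \<bullet>c w)"
    using assms by (simp add: cscalar_prod_cnj) (simp add: cscalar_prod_eq sum_product)
  finally show ?thesis by (simp only: complex_norm_square)
qed

text \<open>The common shape of the states below: with \<open>w\<close> the abort state it is a
  generated state, with or without flag qubit, and conjugation by a Pauli operator preserves the
  shape. Pure states are the case of weight 1.\<close>

definition mix :: "real \<Rightarrow> complex vec \<Rightarrow> complex vec \<Rightarrow> complex mat" where
  "mix \<eta> v w = complex_of_real \<eta> \<cdot>\<^sub>m outer v + complex_of_real (1 - \<eta>) \<cdot>\<^sub>m outer w"

lemma mix_carrier [simp]: "v \<in> carrier_vec N \<Longrightarrow> w \<in> carrier_vec N \<Longrightarrow> mix \<eta> v w \<in> carrier_mat N N"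
  by (simp add: mix_def)

lemma dim_mix [simp]: "dim_row (mix \<eta> v w) = dim_vec w" "dim_col (mix \<eta> v w) = dim_vec w"
  by (auto simp: mix_def outer_def)

lemma index_mix:
  "v \<in> carrier_vec N \<Longrightarrow> w \<in> carrier_vec N \<Longrightarrow> i < N \<Longrightarrow> j < N \<Longrightarrow>
   mix \<eta> v w $$ (i, j) = complex_of_real \<eta> * outer v $$ (i, j) + complex_of_real (1 - \<eta>) * outer w $$ (i, j)"
  by (simp add: mix_def outer_def)

lemma mix_inner:
  assumes "v \<in> carrier_vec N" "w \<in> carrier_vec N" "z \<in> carrier_vec N"
  shows "(mix \<eta> v w *\<^sub>v z) \<bullet>c z = complex_of_real (\<eta> * (cmod (v \<bullet>c z))\<^sup>2 + (1 - \<eta>) * (cmod (w \<bullet>c z))\<^sup>2)"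
proof -
  have "(mix \<eta> v w *\<^sub>v z) \<bullet>c z = complex_of_real \<eta> * ((outer v *\<^sub>v z) \<bullet>c z) + complex_of_real (1 - \<eta>) * ((outer w *\<^sub>v z) \<bullet>c z)"
    using assms mat_vec_inner[OF _ assms(3,3)]
    by (simp add: index_mix distrib_right sum.distrib sum_distrib_left mult.assoc del: of_real_diff)
  then show ?thesis using assms by (simp add: outer_mat_vec_inner)
qed

lemma density_mix:
  assumes "pure_state N v" "pure_state N w" "0 \<le> \<eta>" "\<eta> \<le> 1"
  shows "density_matrix N (mix \<eta> v w)"
proof -
  note c = pure_stateD(1)[OF assms(1)] pure_stateD(1)[OF assms(2)]
  have "mat_adjoint (mix \<eta> v w) = mix \<eta> v w"
    using c by (intro eq_matI) (auto simp: index_mix index_outer mult.commute)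
  moreover have "(\<Sum>i<N. mix \<eta> v w $$ (i, i)) = complex_of_real \<eta> * (v \<bullet>c v) + complex_of_real (1 - \<eta>) * (w \<bullet>c w)"
    using c by (simp add: index_mix index_outer cscalar_prod_eq sum.distrib sum_distrib_left del: of_real_diff)
  moreover have "\<dots> = 1" using assms by (simp add: pure_stateD)
  ultimately show ?thesis
    using assms c unfolding density_matrix_def by (auto simp: mix_inner)
qed

lemma mix_1: "v \<in> carrier_vec N \<Longrightarrow> mix 1 v v = outer v"
  by (rule eq_matI) (auto simp: mix_def outer_def)

lemma density_outer: "pure_state N v \<Longrightarrow> density_matrix N (outer v)"
  using density_mix[of N v v 1] mix_1[of v N] by (simp add: pure_state_def)

lemma btrace_mix:
  assumes "pure_state (2 ^ q) v" "pure_state (2 ^ q) w" "0 \<le> \<eta>" "\<eta> \<le> 1"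
  shows "btrace q (mix \<eta> v w) = 1"
  using density_mix[OF assms] by (simp add: btrace_eq density_matrix_def)

lemma overlap_mix_left:
  assumes "v \<in> carrier_vec (2 ^ q)" "w \<in> carrier_vec (2 ^ q)"
  shows "overlap q (mix \<eta> v w) B = complex_of_real \<eta> * overlap q (outer v) B + complex_of_real (1 - \<eta>) * overlap q (outer w) B"
  using assms by (simp add: overlap_eq index_mix distrib_right sum.distrib sum_distrib_left mult.assoc del: of_real_diff)

lemma overlap_commute: "overlap q A B = overlap q B A"
  unfolding overlap_def by (subst sum.swap) (simp add: mult.commute)

lemma overlap_mix_outer:
  assumes "pure_state (2 ^ q) v" "pure_state (2 ^ q) w"
  shows "overlap q (mix \<eta> v w) (outer w) = complex_of_real (\<eta> * (cmod (v \<bullet>c w))\<^sup>2 + (1 - \<eta>))"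
  using assms by (simp add: overlap_mix_left overlap_outer pure_stateD)

text \<open>The purity is \<eta>^2 + (1 - \<eta>)^2 + 2 \<eta> (1 - \<eta>) g with g the squared
  overlap. Written as 1 minus a deficit, it shows what the purity test detects.\<close>

lemma overlap_mix_mix:
  assumes "pure_state (2 ^ q) v" "pure_state (2 ^ q) w"
  shows "overlap q (mix \<eta> v w) (mix \<eta> v w) =
    complex_of_real (1 - 2 * \<eta> * (1 - \<eta>) * (1 - (cmod (v \<bullet>c w))\<^sup>2))"
proof -
  have "cmod (w \<bullet>c v) = cmod (v \<bullet>c w)"
    using cscalar_prod_cnj[of v "2 ^ q" w] assms by (metis complex_mod_cnj pure_stateD(1))
  then have "overlap q (mix \<eta> v w) (mix \<eta> v w) = complex_of_real
     (\<eta> * (\<eta> + (1 - \<eta>) * (cmod (v \<bullet>c w))\<^sup>2) + (1 - \<eta>) * (\<eta> * (cmod (v \<bullet>c w))\<^sup>2 + (1 - \<eta>)))"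
    using assms
    by (simp add: overlap_mix_left overlap_commute[of q "outer _" "mix _ _ _"] overlap_outer pure_stateD)
  also have "\<dots> = complex_of_real (1 - 2 * \<eta> * (1 - \<eta>) * (1 - (cmod (v \<bullet>c w))\<^sup>2))"
    by (intro arg_cong[where f = complex_of_real]) (simp add: algebra_simps power2_eq_square)
  finally show ?thesis .
qed

lemma dim_tensor_vec [simp]: "dim_vec (tensor_vec v w) = dim_vec v * dim_vec w"
  by (simp add: tensor_vec_def)

lemma outer_tensor: "outer v \<Otimes> outer w = outer (tensor_vec v w)"
proof (rule eq_matI)
  fix i j assume "i < dim_row (outer (tensor_vec v w))" "j < dim_col (outer (tensor_vec v w))"
  then have ij: "i < dim_vec v * dim_vec w" "j < dim_vec v * dim_vec w" by (auto simp: outer_def)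
  then have "0 < dim_vec w" by (cases "dim_vec w") auto
  with ij show "(outer v \<Otimes> outer w) $$ (i, j) = outer (tensor_vec v w) $$ (i, j)"
    by (subst index_tensor) (auto simp: outer_def tensor_vec_def less_mult_imp_div_less)
qed (auto simp: outer_def)

lemma pure_tensor:
  assumes "pure_state (2 ^ p) v" "pure_state (2 ^ q) w"
  shows "pure_state (2 ^ (p + q)) (tensor_vec v w)"
proof -
  note c = pure_stateD(1)[OF assms(1)] pure_stateD(1)[OF assms(2)]
  have t: "tensor_vec v w \<in> carrier_vec (2 ^ (p + q))" by (intro carrier_vecI) (simp add: power_add carrier_vecD[OF c(1)] carrier_vecD[OF c(2)])
  have "tensor_vec v w \<bullet>c tensor_vec v w = btrace (p + q) (outer v \<Otimes> outer w)"
    by (simp add: outer_tensor btrace_outer[OF t])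
  also have "\<dots> = 1" using btrace_tensor[OF outer_carrier[OF c(1)] outer_carrier[OF c(2)]]
    by (simp add: btrace_outer[OF c(1)] btrace_outer[OF c(2)] pure_stateD(2)[OF assms(1)] pure_stateD(2)[OF assms(2)])
  finally show ?thesis using t by (simp add: pure_state_def)
qed

text \<open>This makes the copies of the abort state admissible as advice: because they form a pure
  state, positivity of general tensor products is not called for.\<close>

lemma pure_tensor_power:
  assumes "pure_state (2 ^ q) v"
  shows "\<exists>w. pure_state (2 ^ (t * q)) w \<and> tensor_list (replicate t (outer v)) = outer w"
proof (induction t)
  case 0
  have "pure_state 1 (unit_vec 1 0)" by (simp add: pure_state_def cscalar_prod_eq[where N = 1])
  moreover have "outer (unit_vec 1 0) = 1\<^sub>m 1" by (rule eq_matI) (auto simp: outer_def)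
  ultimately show ?case by (auto intro!: exI[of _ "unit_vec 1 0"])
next
  case (Suc t)
  then obtain w where "pure_state (2 ^ (t * q)) w" "tensor_list (replicate t (outer v)) = outer w" by blast
  then have "pure_state (2 ^ (Suc t * q)) (tensor_vec v w)"
    "tensor_list (replicate (Suc t) (outer v)) = outer (tensor_vec v w)"
    using pure_tensor[OF assms, of "t * q" w] by (simp_all add: tensor_list_Cons outer_tensor)
  then show ?case by blast
qed

lemma density_tensor_power:
  "pure_state (2 ^ q) v \<Longrightarrow> density_matrix (2 ^ (t * q)) (tensor_list (replicate t (outer v)))"
  using pure_tensor_power density_outer by metis

lemma density_one: "density_matrix 1 (1\<^sub>m 1)"
  using density_tensor_power[of 0 "unit_vec 1 0" 0] 
  by (simp add: pure_state_def cscalar_prod_eq[where N = 1])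


section \<open>Moments of Haar random states\<close>

lemma cauchy_schwarz_sum:
  fixes a b :: "nat \<Rightarrow> complex"
  assumes "(\<Sum>i<N. (cmod (a i))\<^sup>2) = 1" "(\<Sum>i<N. (cmod (b i))\<^sup>2) = 1"
  shows "cmod (\<Sum>i<N. a i * cnj (b i)) \<le> 1"
proof -
  have "cmod (\<Sum>i<N. a i * cnj (b i)) \<le> (\<Sum>i<N. \<bar>cmod (a i)\<bar> * \<bar>cmod (b i)\<bar>)"
    by (rule order_trans[OF norm_sum]) (simp add: norm_mult)
  also have "\<dots> \<le> L2_set (\<lambda>i. cmod (a i)) {..<N} * L2_set (\<lambda>i. cmod (b i)) {..<N}"
    by (rule L2_set_mult_ineq)
  finally show ?thesis using assms by (simp add: L2_set_def)
qed

lemma pure_state_iff: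
  "pure_state N v \<longleftrightarrow> v \<in> carrier_vec N \<and> (\<Sum>i<N. (cmod (v $ i))\<^sup>2) = 1"
proof (cases "v \<in> carrier_vec N")
  case True
  show ?thesis unfolding pure_state_def cscalar_prod_self[OF True] of_real_eq_1_iff by simp
qed (simp add: pure_state_def)

lemma pure_inner_le_1: "pure_state N v \<Longrightarrow> pure_state N w \<Longrightarrow> cmod (v \<bullet>c w) \<le> 1"
  by (auto simp: pure_state_iff cscalar_prod_eq intro: cauchy_schwarz_sum)

section \<open>Unitaries carrying one pure state to another\<close>

definition householder :: "nat \<Rightarrow> (nat \<Rightarrow> complex) \<Rightarrow> complex mat" where
  "householder N w = mat N N (\<lambda>(i, j). of_bool (i = j) - 2 / (\<Sum>k<N. w k * cnj (w k)) * w i * cnj (w j))"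

lemma householder_unitary: "unitary_matrix N (householder N w)"
proof -
  define S where "S = (\<Sum>k<N. w k * cnj (w k))"
  define \<beta> where "\<beta> = 2 / S"
  have "cnj S = S" by (simp add: S_def mult.commute)
  then have cb: "cnj \<beta> = \<beta>" by (simp add: \<beta>_def)
  \<comment> \<open>This includes \<open>S = 0\<close>, where \<open>\<beta> = 2 / 0 = 0\<close> and
    the reflection degenerates to the identity.\<close>
  have bb: "\<beta> * \<beta> * S = 2 * \<beta>" by (cases "S = 0") (auto simp: \<beta>_def)
  have H: "householder N w \<in> carrier_mat N N" by (simp add: householder_def)
  have "mat_adjoint (householder N w) * householder N w = 1\<^sub>m N"
  proof (rule eq_matI)
    fix i j assume "i < dim_row (1\<^sub>m N :: complex mat)" "j < dim_col (1\<^sub>m N :: complex mat)"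
    then have ij: "i < N" "j < N" by auto
    have "(mat_adjoint (householder N w) * householder N w) $$ (i, j)
      = (\<Sum>k<N. cnj (householder N w $$ (k, i)) * householder N w $$ (k, j))"
      using ij H by (simp add: scalar_prod_def atLeast0LessThan)
    also have "\<dots> = (\<Sum>k<N. (of_bool (k = i) - \<beta> * cnj (w k) * w i) * (of_bool (k = j) - \<beta> * w k * cnj (w j)))"
      using ij cb by (intro sum.cong) (auto simp: householder_def S_def[symmetric] \<beta>_def[symmetric])
    also have "\<dots> = (\<Sum>k<N. of_bool (k = i) * of_bool (k = j) - of_bool (k = i) * (\<beta> * w k * cnj (w j))
        - of_bool (k = j) * (\<beta> * cnj (w k) * w i) + (\<beta> * \<beta> * w i * cnj (w j)) * (w k * cnj (w k)))"
      by (intro sum.cong) (auto simp: algebra_simps)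
    also have "\<dots> = of_bool (i = j) - \<beta> * w i * cnj (w j) - \<beta> * cnj (w j) * w i + (\<beta> * \<beta> * w i * cnj (w j)) * S"
      using ij unfolding S_def
      by (simp add: sum.distrib sum_subtractf sum_distrib_left[symmetric] of_bool_def if_distrib[of "\<lambda>z. z * _"] sum.delta cong: if_cong)
    also have "\<dots> = of_bool (i = j) + (\<beta> * \<beta> * S - 2 * \<beta>) * (w i * cnj (w j))" by (simp add: algebra_simps)
    also have "\<dots> = 1\<^sub>m N $$ (i, j)" using ij bb by simp
    finally show "(mat_adjoint (householder N w) * householder N w) $$ (i, j) = 1\<^sub>m N $$ (i, j)" .
  qed (use H in auto)
  then show ?thesis using H by (simp add: unitary_matrix_def)
qed

text \<open>The reflection that exchanges \<open>p\<close> and \<open>q\<close>, after a phase has been chosen that makes their inner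
  product real. If \<open>p = q\<close> up to this phase, division by zero makes \<open>householder\<close> the identity.\<close>

lemma unitary_transport:
  assumes p: "pure_state N p" and q: "pure_state N q"
  shows "\<exists>U. unitary_matrix N U \<and> (\<forall>v\<in>carrier_vec N. cmod ((U *\<^sub>v v) \<bullet>c p) = cmod (v \<bullet>c q))"
proof -
  note pc = pure_stateD(1)[OF p] and qc = pure_stateD(1)[OF q]
  define c where "c = (if p \<bullet>c q = 0 then 1 else sgn (p \<bullet>c q))"
  have c1: "cmod c = 1" by (simp add: c_def norm_sgn)
  have cc: "c * cnj c = 1" by (simp add: complex_norm_square[symmetric] c1)
  have re: "cnj c * (p \<bullet>c q) = complex_of_real (cmod (p \<bullet>c q))"
    by (auto simp: c_def sgn_div_norm complex_norm_square[symmetric] scaleR_conv_of_real field_simps power2_eq_square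
        simp flip: of_real_mult)
  define r where "r = complex_of_real (cmod (p \<bullet>c q))"
  define w where "w = (\<lambda>i. p $ i - c * q $ i)"
  define S where "S = (\<Sum>k<N. w k * cnj (w k))"
  define ip where "ip a b = (\<Sum>i<N. a i * cnj (b i))" for a b :: "nat \<Rightarrow> complex"
  have pp: "ip (\<lambda>i. p $ i) (\<lambda>i. p $ i) = 1" "ip (\<lambda>i. q $ i) (\<lambda>i. q $ i) = 1"
    using pure_stateD(2)[OF p] pure_stateD(2)[OF q] pc qc by (simp_all add: ip_def cscalar_prod_eq)
  have pq: "cnj c * ip (\<lambda>i. p $ i) (\<lambda>i. q $ i) = r" using re qc by (simp add: ip_def cscalar_prod_eq r_def)
  have qp: "c * ip (\<lambda>i. q $ i) (\<lambda>i. p $ i) = r"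
    using arg_cong[OF pq, of cnj] by (simp add: ip_def mult.commute r_def)
  have wp: "ip w (\<lambda>i. p $ i) = 1 - r"
    using pp(1) qp by (simp add: ip_def w_def left_diff_distrib sum_subtractf sum_distrib_left mult.assoc)
  have wq: "cnj c * ip w (\<lambda>i. q $ i) = r - 1"
  proof -
    have "ip w (\<lambda>i. q $ i) = ip (\<lambda>i. p $ i) (\<lambda>i. q $ i) - c * ip (\<lambda>i. q $ i) (\<lambda>i. q $ i)"
      by (simp add: ip_def w_def left_diff_distrib sum_subtractf sum_distrib_left mult.assoc)
    then show ?thesis using pq pp(2) cc by (simp add: right_diff_distrib mult.commute)
  qed
  have S: "S = 2 * (1 - r)"
  proof -
    have "S = ip w (\<lambda>i. p $ i) - cnj c * ip w (\<lambda>i. q $ i)"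
      by (simp add: S_def ip_def w_def right_diff_distrib sum_subtractf sum_distrib_left mult_ac)
    then show ?thesis using wp wq by simp
  qed
  have "cmod ((householder N w *\<^sub>v v) \<bullet>c p) = cmod (v \<bullet>c q)" if v: "v \<in> carrier_vec N" for v
  proof -
    let ?v = "\<lambda>i. v $ i"
    have H: "householder N w \<in> carrier_mat N N" by (simp add: householder_def)
    have "(householder N w *\<^sub>v v) \<bullet>c p = (\<Sum>i<N. \<Sum>j<N. (of_bool (i = j) - 2 / S * w i * cnj (w j)) * v $ j * cnj (p $ i))"
      using mat_vec_inner[OF H v pc] by (simp add: householder_def S_def)
    also have "\<dots> = (\<Sum>i<N. \<Sum>j<N. of_bool (i = j) * (v $ j * cnj (p $ i)) - 2 / S * ((w i * cnj (p $ i)) * (v $ j * cnj (w j))))"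
      by (intro sum.cong refl) (simp add: algebra_simps)
    also have "\<dots> = ip ?v (\<lambda>i. p $ i) - 2 / S * (ip w (\<lambda>i. p $ i) * ip ?v w)"
    proof -
      have "(\<Sum>i<N. \<Sum>j<N. of_bool (i = j) * (v $ j * cnj (p $ i))) = (\<Sum>i<N. v $ i * cnj (p $ i))"
        by (simp add: of_bool_def if_distrib[of "\<lambda>z. z * _"] sum.delta' cong: if_cong)
      moreover have "(\<Sum>i<N. \<Sum>j<N. 2 / S * ((w i * cnj (p $ i)) * (v $ j * cnj (w j))))
        = 2 / S * ((\<Sum>i<N. w i * cnj (p $ i)) * (\<Sum>j<N. v $ j * cnj (w j)))"
        unfolding sum_product by (simp only: sum_distrib_left)
      ultimately show ?thesis by (simp only: sum_subtractf ip_def)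
    qed
    \<comment> \<open>For \<open>r\<close> other than 1 the coefficient 2 (1 - r) / S equals 1, so
      the reflection subtracts exactly \<open>ip ?v w\<close>. For \<open>r = 1\<close> the vector
      \<open>w\<close> vanishes and both inner products agree.\<close>
    also have "\<dots> = cnj c * ip ?v (\<lambda>i. q $ i)"
    proof -
      have vw: "ip ?v w = ip ?v (\<lambda>i. p $ i) - cnj c * ip ?v (\<lambda>i. q $ i)"
        by (simp add: ip_def w_def right_diff_distrib sum_subtractf sum_distrib_left mult_ac)
      show ?thesis
      proof (cases "r = 1")
        case True
        then have "complex_of_real (\<Sum>k<N. (cmod (w k))\<^sup>2) = 0"
          using S by (simp add: S_def complex_norm_square del: of_real_power)
        then have "(\<Sum>k<N. (cmod (w k))\<^sup>2) = 0" by (simp only: of_real_eq_0_iff)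
        then have "w k = 0" if "k < N" for k using that by (simp add: sum_nonneg_eq_0_iff)
        then have "ip ?v w = 0" by (simp add: ip_def)
        then show ?thesis using vw by simp
      next
        case False
        then show ?thesis by (simp add: S wp vw field_simps)
      qed
    qed
    finally show ?thesis using qc c1 by (simp add: norm_mult ip_def cscalar_prod_eq)
  qed
  then show ?thesis using householder_unitary by blast
qed

text \<open>The sub-Gaussian estimate of cosh. It is Hoeffding's bound on the logarithmic moment
  generating function of a fair bit at the argument 2 x; multiplication by exp (- x) centres the
  bit.\<close>

lemma exp_add_exp_minus_le: "exp x + exp (- x) \<le> 2 * exp (x\<^sup>2 / 2)" for x :: real
proof -
  have *: "exp x + exp (- x) \<le> 2 * exp (x\<^sup>2 / 2)" if "0 \<le> x" for x :: real
  proof -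
    have pos: "0 < 1 + 1 / 2 * (exp (2 * x) - 1)" by (simp add: field_simps add_pos_pos)
    have "ln (1 + 1 / 2 * (exp (2 * x) - 1)) \<le> x + x\<^sup>2 / 2"
      using Hoeffdings_lemma_aux[of "2 * x" "1 / 2"] that by (simp add: field_simps)
    then have "1 + 1 / 2 * (exp (2 * x) - 1) \<le> exp (x + x\<^sup>2 / 2)"
      using pos by (metis exp_ln exp_le_cancel_iff)
    moreover have "1 + 1 / 2 * (E - 1) \<le> F \<Longrightarrow> 1 + E \<le> 2 * F" for E F :: real by (simp add: field_simps)
    ultimately have "1 + exp (2 * x) \<le> 2 * exp (x + x\<^sup>2 / 2)" by blast
    then have "(1 + exp (2 * x)) * exp (- x) \<le> 2 * exp (x + x\<^sup>2 / 2) * exp (- x)"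
      by (intro mult_right_mono) auto
    then show ?thesis by (simp add: algebra_simps flip: exp_add)
  qed
  show ?thesis using *[of "\<bar>x\<bar>"] by (cases "0 \<le> x") (auto simp: abs_if add.commute)
qed

section \<open>Sums of random signs\<close>

definition signs :: "nat \<Rightarrow> (nat \<Rightarrow> real) set" where
  "signs N = PiE {..<N} (\<lambda>_. {1, -1})"

lemma finite_signs [simp]: "finite (signs N)"
  by (simp add: signs_def finite_PiE)

lemma card_signs: "card (signs N) = 2 ^ N"
  by (simp add: signs_def card_PiE numeral_2_eq_2)

text \<open>The sum over all sign vectors factors over the coordinates, and each factor is a
  cosh.\<close>

lemma sign_sum_exp:
  assumes "(\<Sum>i<N. (a i)\<^sup>2) \<le> 1"
  shows "(\<Sum>\<epsilon>\<in>signs N. exp (s * (\<Sum>i<N. \<epsilon> i * a i))) \<le> 2 ^ N * exp (s\<^sup>2 / 2)"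
proof -
  have "(\<Sum>\<epsilon>\<in>signs N. exp (s * (\<Sum>i<N. \<epsilon> i * a i))) = (\<Sum>\<epsilon>\<in>signs N. \<Prod>i<N. exp (s * a i * \<epsilon> i))"
    by (intro sum.cong refl) (simp add: sum_distrib_left exp_sum[symmetric] mult_ac)
  also have "\<dots> = (\<Prod>i<N. \<Sum>e\<in>{1, -1}. exp (s * a i * e))"
    unfolding signs_def by (rule prod_sum_PiE[symmetric]) auto
  also have "\<dots> \<le> (\<Prod>i<N. 2 * exp ((s * a i)\<^sup>2 / 2))"
    using exp_add_exp_minus_le by (intro prod_mono) (auto intro: add_nonneg_nonneg)
  also have "\<dots> = 2 ^ N * exp (s\<^sup>2 / 2 * (\<Sum>i<N. (a i)\<^sup>2))"
    by (simp add: prod.distrib exp_sum[symmetric] sum_distrib_left power_mult_distrib)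
  also have "\<dots> \<le> 2 ^ N * exp (s\<^sup>2 / 2)"
    using assms by (simp add: mult_left_le)
  finally show ?thesis .
qed

lemma sign_sum_tail:
  assumes "(\<Sum>i<N. (a i)\<^sup>2) \<le> 1"
  shows "(\<Sum>\<epsilon>\<in>signs N. of_bool ((\<Sum>i<N. \<epsilon> i * a i)\<^sup>2 > real N / 4)) \<le> 2 ^ N * (2 * exp (- real N / 8))"
proof -
  \<comment> \<open>The threshold for the absolute value of the sum, since
    \<open>s\<^sup>2 = N / 4\<close>, and at the same time the optimal Chernoff parameter for it.
    The exponent becomes s^2 / 2 - s^2 = - N / 8.\<close>
  define s where "s = sqrt (real N) / 2"
  have ss: "s\<^sup>2 = real N / 4" "0 \<le> s" by (auto simp: s_def power_divide)
  have ind: "of_bool (A\<^sup>2 > real N / 4) \<le> (exp (s * A) + exp ((- s) * A)) * exp (- s\<^sup>2)" for A :: real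
  proof (cases "A\<^sup>2 > real N / 4")
    case True
    then have "s\<^sup>2 < \<bar>A\<bar>\<^sup>2" using ss by simp
    then have "s < \<bar>A\<bar>" using power_less_imp_less_base[of s 2 "\<bar>A\<bar>"] by simp
    then have "s * s \<le> s * \<bar>A\<bar>" using ss by (intro mult_left_mono) auto
    then have "exp (s\<^sup>2) \<le> exp (s * \<bar>A\<bar>)" by (simp add: power2_eq_square)
    also have "\<dots> \<le> exp (s * A) + exp ((- s) * A)" by (cases "0 \<le> A") (auto simp: abs_if)
    finally show ?thesis using True by (simp add: exp_minus field_simps)
  qed (simp add: add_nonneg_nonneg)
  have "(\<Sum>\<epsilon>\<in>signs N. of_bool ((\<Sum>i<N. \<epsilon> i * a i)\<^sup>2 > real N / 4)) \<le>
     (\<Sum>\<epsilon>\<in>signs N. (exp (s * (\<Sum>i<N. \<epsilon> i * a i)) + exp ((- s) * (\<Sum>i<N. \<epsilon> i * a i))) * exp (- s\<^sup>2))"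
    by (intro sum_mono ind)
  also have "\<dots> = ((\<Sum>\<epsilon>\<in>signs N. exp (s * (\<Sum>i<N. \<epsilon> i * a i))) + (\<Sum>\<epsilon>\<in>signs N. exp ((- s) * (\<Sum>i<N. \<epsilon> i * a i)))) * exp (- s\<^sup>2)"
    by (simp only: sum_distrib_right sum.distrib[symmetric])
  also have "\<dots> \<le> (2 ^ N * exp (s\<^sup>2 / 2) + 2 ^ N * exp ((- s)\<^sup>2 / 2)) * exp (- s\<^sup>2)"
    by (intro mult_right_mono add_mono sign_sum_exp assms) auto
  also have "\<dots> = 2 ^ N * (2 * (exp (s\<^sup>2 / 2) * exp (- s\<^sup>2)))" by simp
  also have "exp (s\<^sup>2 / 2) * exp (- s\<^sup>2) = exp (- real N / 8)"
    by (simp add: ss(1) flip: exp_add)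
  finally show ?thesis .
qed

text \<open>Real and imaginary part are real sums of random signs. Unless one of their squares
  exceeds N / 4, the squared overlap is at most 1 / 2, and it never exceeds 1. The 4 counts two
  parts with two tails each.\<close>

lemma sign_average_bound:
  fixes \<theta> :: "nat \<Rightarrow> complex"
  assumes N: "0 < N" and \<theta>: "(\<Sum>i<N. (cmod (\<theta> i))\<^sup>2) = 1"
  shows "(\<Sum>\<epsilon>\<in>signs N. (cmod (\<Sum>i<N. \<theta> i * complex_of_real (\<epsilon> i / sqrt (real N)))) ^ (2 * t)) / 2 ^ N
     \<le> 1 / 2 ^ t + 4 * exp (- real N / 8)"
proof -
  define A B where "A \<epsilon> = (\<Sum>i<N. \<epsilon> i * Re (\<theta> i))" and "B \<epsilon> = (\<Sum>i<N. \<epsilon> i * Im (\<theta> i))" for \<epsilon> :: "nat \<Rightarrow> real"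
  have le: "(\<Sum>i<N. (Re (\<theta> i))\<^sup>2) \<le> 1" "(\<Sum>i<N. (Im (\<theta> i))\<^sup>2) \<le> 1"
    unfolding \<theta>[symmetric] by (auto intro!: sum_mono sum_nonneg simp: cmod_power2)
  have pw: "(cmod (\<Sum>i<N. \<theta> i * complex_of_real (\<epsilon> i / sqrt (real N)))) ^ (2 * t) \<le>
     1 / 2 ^ t + of_bool ((A \<epsilon>)\<^sup>2 > real N / 4) + of_bool ((B \<epsilon>)\<^sup>2 > real N / 4)"
    if e: "\<epsilon> \<in> signs N" for \<epsilon>
  proof -
    define f where "f = (cmod (\<Sum>i<N. \<theta> i * complex_of_real (\<epsilon> i / sqrt (real N))))\<^sup>2"
    have e1: "(\<epsilon> i)\<^sup>2 = 1" if "i < N" for i using e that by (auto simp: signs_def PiE_def Pi_def power2_eq_1_iff)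
    have "cmod (\<Sum>i<N. \<theta> i * cnj (complex_of_real (\<epsilon> i / sqrt (real N)))) \<le> 1"
      using N e1 by (intro cauchy_schwarz_sum \<theta>) (simp add: norm_divide power_divide)
    then have f1: "f \<le> 1" by (simp add: f_def power_le_one)
    have "(\<Sum>i<N. \<theta> i * complex_of_real (\<epsilon> i / sqrt (real N))) = Complex (A \<epsilon> / sqrt (real N)) (B \<epsilon> / sqrt (real N))"
      by (simp add: complex_eq_iff A_def B_def sum_divide_distrib mult.commute)
    then have f: "f = ((A \<epsilon>)\<^sup>2 + (B \<epsilon>)\<^sup>2) / real N"
      using N by (simp add: f_def cmod_power2 power_divide add_divide_distrib)
    have "f ^ t \<le> 1 / 2 ^ t + of_bool ((A \<epsilon>)\<^sup>2 > real N / 4) + of_bool ((B \<epsilon>)\<^sup>2 > real N / 4)"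
    proof (cases "(A \<epsilon>)\<^sup>2 > real N / 4 \<or> (B \<epsilon>)\<^sup>2 > real N / 4")
      case True
      have "f ^ t \<le> 1" using f1 by (intro power_le_one) (auto simp: f_def)
      also have "1 \<le> of_bool ((A \<epsilon>)\<^sup>2 > real N / 4) + (of_bool ((B \<epsilon>)\<^sup>2 > real N / 4) :: real)" using True by auto
      finally show ?thesis by (simp add: add.assoc add_increasing)
    next
      case False
      then have "f \<le> 1 / 2" using N by (simp add: f field_simps)
      then have "f ^ t \<le> (1 / 2) ^ t" by (intro power_mono) (auto simp: f_def)
      then show ?thesis using False by (simp add: power_one_over)
    qed
    then show ?thesis by (simp add: f_def power_mult)
  qed
  have "(\<Sum>\<epsilon>\<in>signs N. (cmod (\<Sum>i<N. \<theta> i * complex_of_real (\<epsilon> i / sqrt (real N)))) ^ (2 * t))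
    \<le> (\<Sum>\<epsilon>\<in>signs N. 1 / 2 ^ t + of_bool ((A \<epsilon>)\<^sup>2 > real N / 4) + of_bool ((B \<epsilon>)\<^sup>2 > real N / 4))"
    by (intro sum_mono pw)
  also have "\<dots> \<le> 2 ^ N * (1 / 2 ^ t) + 2 ^ N * (2 * exp (- real N / 8)) + 2 ^ N * (2 * exp (- real N / 8))"
    unfolding sum.distrib A_def B_def
    by (intro add_mono sign_sum_tail le) (simp add: card_signs)
  also have "\<dots> = 2 ^ N * (1 / 2 ^ t + 4 * exp (- real N / 8))" by (simp add: algebra_simps)
  finally show ?thesis by (simp add: field_simps)
qed

section \<open>Moments under the Haar measure\<close>

lemma haar_moment_measurable [measurable]:
  "(\<lambda>\<theta>. (cmod (vec N \<theta> \<bullet>c p)) ^ k) \<in> borel_measurable (\<Pi>\<^sub>M i\<in>{..<N}. borel)" if "p \<in> carrier_vec N"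
  using that by (simp add: cscalar_prod_eq)

lemma haar_moment_transport:
  assumes h: "haar_state_measure N \<mu>" and p: "pure_state N p" and q: "pure_state N q"
  shows "(\<integral>\<theta>. (cmod (vec N \<theta> \<bullet>c p)) ^ k \<partial>\<mu>) = (\<integral>\<theta>. (cmod (vec N \<theta> \<bullet>c q)) ^ k \<partial>\<mu>)"
proof -
  obtain U where U: "unitary_matrix N U" "\<And>v. v \<in> carrier_vec N \<Longrightarrow> cmod ((U *\<^sub>v v) \<bullet>c p) = cmod (v \<bullet>c q)"
    using unitary_transport[OF p q] by blast
  define T where "T \<theta> = (\<lambda>i\<in>{..<N}. (U *\<^sub>v vec N \<theta>) $ i)" for \<theta>
  have Uc: "U \<in> carrier_mat N N" using U by (simp add: unitary_matrix_def)
  have s: "sets \<mu> = sets (\<Pi>\<^sub>M i\<in>{..<N}. borel)" using h by (simp add: haar_state_measure_def)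
  have "(\<lambda>\<theta>. (U *\<^sub>v vec N \<theta>) $ i) \<in> borel_measurable (\<Pi>\<^sub>M i\<in>{..<N}. borel)" if "i < N" for i
    using that Uc by (simp add: mult_mat_vec_def scalar_prod_def)
  then have "T \<in> (\<Pi>\<^sub>M i\<in>{..<N}. borel) \<rightarrow>\<^sub>M (\<Pi>\<^sub>M i\<in>{..<N}. borel)"
    unfolding T_def by (intro measurable_restrict) auto
  then have Tm: "T \<in> \<mu> \<rightarrow>\<^sub>M (\<Pi>\<^sub>M i\<in>{..<N}. borel)"
    using measurable_cong_sets[OF s refl] by blast
  have vT: "vec N (T \<theta>) = U *\<^sub>v vec N \<theta>" for \<theta>
    using Uc by (intro eq_vecI) (auto simp: T_def)
  have "(\<integral>\<theta>. (cmod (vec N \<theta> \<bullet>c p)) ^ k \<partial>\<mu>)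
      = (\<integral>\<theta>. (cmod (vec N \<theta> \<bullet>c p)) ^ k \<partial>distr \<mu> (\<Pi>\<^sub>M i\<in>{..<N}. borel) T)"
    using h U(1) by (simp add: haar_state_measure_def T_def[abs_def])
  also have "\<dots> = (\<integral>\<theta>. (cmod (vec N (T \<theta>) \<bullet>c p)) ^ k \<partial>\<mu>)"
    by (intro integral_distr Tm haar_moment_measurable pure_stateD[OF p])
  also have "\<dots> = (\<integral>\<theta>. (cmod (vec N \<theta> \<bullet>c q)) ^ k \<partial>\<mu>)"
    by (simp add: vT U(2))
  finally show ?thesis .
qed

text \<open>The integral is the same for every sign vector, hence equal to its average over them,
  and the average is bounded under the integral. The bound is crude, but negligible for t =
  \<lambda> and N = 2 ^ n, as 2 ^ n is at least \<lambda>^3.\<close>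

lemma haar_moment_bound:
  assumes h: "haar_state_measure N \<mu>" and p: "pure_state N p" and N: "0 < N"
  shows "(\<integral>\<theta>. (cmod (vec N \<theta> \<bullet>c p)) ^ (2 * t) \<partial>\<mu>) \<le> 1 / 2 ^ t + 4 * exp (- real N / 8)"
proof -
  interpret prob_space \<mu> using h by (simp add: haar_state_measure_def)
  have s: "sets \<mu> = sets (\<Pi>\<^sub>M i\<in>{..<N}. borel)" using h by (simp add: haar_state_measure_def)
  have ae: "AE \<theta> in \<mu>. pure_state N (vec N \<theta>)" using h by (simp add: haar_state_measure_def)
  define q where "q \<epsilon> = vec N (\<lambda>i. complex_of_real (\<epsilon> i / sqrt (real N)))" for \<epsilon> :: "nat \<Rightarrow> real"
  have q: "pure_state N (q \<epsilon>)" if e: "\<epsilon> \<in> signs N" for \<epsilon>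
  proof -
    have "(\<epsilon> i)\<^sup>2 = 1" if "i < N" for i using e that by (auto simp: signs_def PiE_def Pi_def power2_eq_1_iff)
    then show ?thesis using N by (simp add: pure_state_iff q_def norm_divide power_divide)
  qed
  have meas: "(\<lambda>\<theta>. (cmod (vec N \<theta> \<bullet>c z)) ^ (2 * t)) \<in> borel_measurable \<mu>" if "z \<in> carrier_vec N" for z
    using haar_moment_measurable[OF that] measurable_cong_sets[OF s refl] by blast
  have int: "integrable \<mu> (\<lambda>\<theta>. (cmod (vec N \<theta> \<bullet>c z)) ^ (2 * t))" if "pure_state N z" for z
  proof (rule integrable_const_bound[where B = 1])
    show "AE \<theta> in \<mu>. norm ((cmod (vec N \<theta> \<bullet>c z)) ^ (2 * t)) \<le> 1"
      using ae by eventually_elim (use that in \<open>auto intro!: power_le_one pure_inner_le_1\<close>)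
  qed (rule meas[OF pure_stateD(1)[OF that]])
  have "(\<integral>\<theta>. (cmod (vec N \<theta> \<bullet>c p)) ^ (2 * t) \<partial>\<mu>)
     = (\<Sum>\<epsilon>\<in>signs N. \<integral>\<theta>. (cmod (vec N \<theta> \<bullet>c q \<epsilon>)) ^ (2 * t) \<partial>\<mu>) / 2 ^ N"
    by (simp add: card_signs haar_moment_transport[OF h p q, symmetric] cong: sum.cong)
  also have "\<dots> = (\<integral>\<theta>. (\<Sum>\<epsilon>\<in>signs N. (cmod (vec N \<theta> \<bullet>c q \<epsilon>)) ^ (2 * t)) / 2 ^ N \<partial>\<mu>)"
    by (subst Bochner_Integration.integral_sum[symmetric]) (auto intro: int q)
  also have "\<dots> \<le> (\<integral>\<theta>. 1 / 2 ^ t + 4 * exp (- real N / 8) \<partial>\<mu>)"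
  proof (rule integral_mono_AE)
    show "integrable \<mu> (\<lambda>\<theta>. (\<Sum>\<epsilon>\<in>signs N. (cmod (vec N \<theta> \<bullet>c q \<epsilon>)) ^ (2 * t)) / 2 ^ N)"
      by (intro integrable_divide_zero Bochner_Integration.integrable_sum int q) auto
    show "AE \<theta> in \<mu>. (\<Sum>\<epsilon>\<in>signs N. (cmod (vec N \<theta> \<bullet>c q \<epsilon>)) ^ (2 * t)) / 2 ^ N \<le> 1 / 2 ^ t + 4 * exp (- real N / 8)"
      using ae
    proof eventually_elim
      case (elim \<theta>)
      then have "(\<Sum>i<N. (cmod (\<theta> i))\<^sup>2) = 1" by (simp add: pure_state_iff)
      from sign_average_bound[OF N this, of t] show ?case
        by (simp add: cscalar_prod_eq[where N = N] q_def)
    qed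
  qed simp
  also have "\<dots> = 1 / 2 ^ t + 4 * exp (- real N / 8)" by (simp add: prob_space)
  finally show ?thesis .
qed


section \<open>Negligible functions and the parameters\<close>

text \<open>With this form, closure under sums and under polynomial factors is arithmetic of
  limits.\<close>

lemma negligible_iff_tendsto: "negligible_fun f \<longleftrightarrow> (\<forall>k. (\<lambda>l. real l ^ k * f l) \<longlonglongrightarrow> 0)"
proof
  assume f: "negligible_fun f"
  show "\<forall>k. (\<lambda>l. real l ^ k * f l) \<longlonglongrightarrow> 0"
  proof
    fix k
    have "\<forall>\<^sub>F l in sequentially. norm (real l ^ k * f l) \<le> inverse (real l)"
      using f[unfolded negligible_fun_def, rule_format, of "Suc k"] eventually_gt_at_top[of 0]
      by eventually_elim (simp add: abs_mult field_simps)
    then show "(\<lambda>l. real l ^ k * f l) \<longlonglongrightarrow> 0"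
      by (rule Lim_null_comparison) (rule lim_inverse_n)
  qed
next
  assume f: "\<forall>k. (\<lambda>l. real l ^ k * f l) \<longlonglongrightarrow> 0"
  show "negligible_fun f" unfolding negligible_fun_def
  proof
    fix k
    have "\<forall>\<^sub>F l in sequentially. dist (real l ^ k * f l) 0 < 1"
      using f tendstoD[of "\<lambda>l. real l ^ k * f l" 0 sequentially 1] by simp
    then show "\<forall>\<^sub>F l in sequentially. \<bar>f l\<bar> < 1 / real l ^ k"
      using eventually_gt_at_top[of 0] by eventually_elim (simp add: abs_mult field_simps)
  qed
qed

lemma negligible_add: "negligible_fun f \<Longrightarrow> negligible_fun g \<Longrightarrow> negligible_fun (\<lambda>l. f l + g l)"
  unfolding negligible_iff_tendsto distrib_left by (metis (full_types) tendsto_add_zero)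

lemma negligible_cmult: "negligible_fun f \<Longrightarrow> negligible_fun (\<lambda>l. c * f l)"
  unfolding negligible_iff_tendsto mult.left_commute[of _ c] using tendsto_mult_right_zero by blast

lemma negligible_times_n: "negligible_fun f \<Longrightarrow> negligible_fun (\<lambda>l. real l * f l)"
  unfolding negligible_iff_tendsto
proof
  fix k assume "\<forall>k. (\<lambda>l. real l ^ k * f l) \<longlonglongrightarrow> 0"
  from this[rule_format, of "Suc k"] show "(\<lambda>l. real l ^ k * (real l * f l)) \<longlonglongrightarrow> 0"
    by (simp add: mult_ac)
qed

lemma negligible_mono:
  assumes "negligible_fun g" "\<forall>\<^sub>F l in sequentially. \<bar>f l\<bar> \<le> g l"
  shows "negligible_fun f"
  unfolding negligible_fun_def
proof
  fix c
  show "\<forall>\<^sub>F l in sequentially. \<bar>f l\<bar> < 1 / real l ^ c"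
    using assms(1)[unfolded negligible_fun_def, rule_format, of c] assms(2) by eventually_elim linarith
qed

lemma negligible_exp:
  assumes "a > 0" shows "negligible_fun (\<lambda>l. exp (- (a * real l)))"
  unfolding negligible_iff_tendsto
proof
  fix k
  have "filterlim (\<lambda>l. a * real l) at_top sequentially"
    using assms by (intro filterlim_tendsto_pos_mult_at_top[OF tendsto_const] filterlim_real_sequentially)
  then have "(\<lambda>l. (a * real l) ^ k / exp (a * real l)) \<longlonglongrightarrow> 0"
    by (rule filterlim_compose[OF tendsto_power_div_exp_0])
  then have "(\<lambda>l. (1 / a ^ k) * ((a * real l) ^ k / exp (a * real l))) \<longlonglongrightarrow> 0"
    by (rule tendsto_mult_right_zero)
  then show "(\<lambda>l. real l ^ k * exp (- (a * real l))) \<longlonglongrightarrow> 0"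
    using assms by (simp add: power_mult_distrib exp_minus field_simps)
qed

lemma negligible_geometric:
  assumes "0 < c" "c < 1" shows "negligible_fun (\<lambda>l. c ^ l)"
proof -
  have "exp (- (- ln c * real l)) = c ^ l" for l
    using assms exp_of_nat_mult[of l "ln c"] by (simp add: mult.commute)
  then show ?thesis using negligible_exp[of "- ln c"] assms by simp
qed

text \<open>\<open>poly_bounded\<close> has a single constant for exponent and summand. The exponent
  absorbs the coefficient, as K \<le> 2 ^ K \<le> l ^ K for l \<ge> 2, and the summand covers the
  arguments 0 and 1.\<close>

lemma poly_bounded_quadratic:
  assumes "\<And>l. f l \<le> K * l\<^sup>2 + K" shows "poly_bounded f"
  unfolding poly_bounded_def
proof (intro exI allI)
  fix l
  have "K * l\<^sup>2 + K \<le> l ^ (2 * K + 2) + (2 * K + 2)"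
  proof (cases "l \<le> 1")
    case True then show ?thesis by (cases l) auto
  next
    case False
    then have "K \<le> l ^ K" using less_exp[of K] power_mono[of 2 l K] by simp
    also have "\<dots> \<le> l ^ (2 * K)" using False by (intro power_increasing) auto
    finally have "K * l\<^sup>2 \<le> l ^ (2 * K) * l\<^sup>2" by (rule mult_right_mono) simp
    moreover have "l ^ (2 * K + 2) = l ^ (2 * K) * l\<^sup>2" by (rule power_add)
    ultimately show ?thesis by linarith
  qed
  then show "f l \<le> l ^ (2 * K + 2) + (2 * K + 2)" using assms[of l] by linarith
qed

section \<open>Sizes of the parameters\<close>

lemma log2_le: "log 2 (real m) \<le> real m"
proof (cases "m = 0")
  case False
  have "real m \<le> 2 ^ m" using of_nat_mono[OF less_imp_le[OF less_exp[of m]], where 'a = real] by simp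
  then have "log 2 (real m) \<le> log 2 (2 ^ m)" using False by (intro log_mono) auto
  then show ?thesis by (simp add: log_nat_power)
qed (simp add: log_def)

lemma out_len_le: "out_len l \<le> 3 * l"
proof -
  have "3 * log 2 (real l) \<le> 3 * real l" using log2_le[of l] by simp
  then have "\<lceil>3 * log 2 (real l)\<rceil> \<le> int (3 * l)" by (simp add: ceiling_le_iff)
  then show ?thesis by (simp add: out_len_def nat_le_iff)
qed

lemma in_len_le: "in_len l \<le> 3 * l"
proof (cases "l = 0 \<or> out_len l = 0")
  case False
  then have "3 * real l / real (out_len l) \<le> real (3 * l)" by (simp add: divide_le_eq)
  then have "log 2 (3 * real l / real (out_len l)) \<le> log 2 (real (3 * l))"
    using False by (intro log_mono) auto
  also have "\<dots> \<le> real (3 * l)" by (rule log2_le)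
  finally have "\<lceil>log 2 (3 * real l / real (out_len l))\<rceil> \<le> int (3 * l)" by (simp add: ceiling_le_iff)
  then show ?thesis by (simp add: in_len_def nat_le_iff)
qed (auto simp: in_len_def log_def)

lemma out_len_ge: "1 \<le> l \<Longrightarrow> real l ^ 3 \<le> 2 ^ out_len l"
proof -
  assume l: "1 \<le> l"
  have "real l ^ 3 = 2 powr (3 * log 2 (real l))"
    using l by (simp add: powr_powr[symmetric] mult.commute[of 3] powr_numeral)
  also have "\<dots> \<le> 2 powr (real (out_len l))"
    unfolding out_len_def by (intro powr_mono) linarith+
  finally show ?thesis by (simp add: powr_realpow)
qed

lemma out_len_pos: "2 \<le> l \<Longrightarrow> 0 < out_len l"
  by (simp add: out_len_def)

text \<open>This provides the input bit that controls the swap. It amounts to n < 3 \<lambda>, which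
  follows from \<lambda> \<le> 2 ^ (\<lambda> - 1). At \<lambda> = 1 the input length is 0.\<close>

lemma in_len_pos:
  assumes "2 \<le> l" shows "0 < in_len l"
proof -
  have "l \<le> 2 ^ (l - 1)" using less_exp[of "l - 1"] by linarith
  then have "real l \<le> 2 ^ (l - 1)" by (metis of_nat_le_iff of_nat_numeral of_nat_power)
  then have "log 2 (real l) \<le> log 2 (2 ^ (l - 1))" using assms by (intro log_mono) auto
  then have "3 * log 2 (real l) \<le> 3 * real l - 3" using assms by (simp add: log_nat_power of_nat_diff)
  then have "\<lceil>3 * log 2 (real l)\<rceil> \<le> 3 * int l - 3" by (simp add: ceiling_le_iff)
  then have "out_len l < 3 * l" using assms by (simp add: out_len_def)
  then have "1 < 3 * real l / real (out_len l)" using out_len_pos[OF assms] by (simp add: less_divide_eq)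
  then show ?thesis by (simp add: in_len_def)
qed

text \<open>Rounding the logarithm up at most doubles 3 \<lambda> / n, and n is at least 1. The
  union bound over the inputs thus costs only a factor linear in \<lambda>.\<close>

lemma in_len_card:
  assumes "2 \<le> l" shows "2 ^ in_len l \<le> 6 * real l"
proof -
  let ?y = "3 * real l / real (out_len l)"
  have n: "1 \<le> real (out_len l)" using out_len_pos[OF assms] by simp
  have y: "0 < ?y" using n assms by simp
  have "real (in_len l) \<le> log 2 ?y + 1"
    using in_len_pos[OF assms] unfolding in_len_def by linarith
  then have "2 powr real (in_len l) \<le> 2 powr (log 2 ?y + 1)" by (intro powr_mono) auto
  also have "\<dots> = 2 * ?y" using y by (simp add: powr_add)
  also have "\<dots> \<le> 6 * real l" using n by (simp add: divide_le_eq mult_le_cancel_left1)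
  finally show ?thesis by (simp add: powr_realpow)
qed

lemma negligible_haar: "negligible_fun (\<lambda>l. exp (- (2 ^ out_len l) / 8))"
proof (rule negligible_mono[OF negligible_exp[of "1 / 8"]])
  show "\<forall>\<^sub>F l in sequentially. \<bar>exp (- (2 ^ out_len l) / 8)\<bar> \<le> exp (- (1 / 8 * real l))"
    using eventually_ge_at_top[of 1]
  proof eventually_elim
    case (elim l)
    have "real l \<le> 2 ^ out_len l"
      using order_trans[OF power_increasing[of 1 3 "real l"] out_len_ge[OF elim]] elim by simp
    then show ?case by simp
  qed
qed simp


section \<open>The abort probability\<close>

lemma index_tensor_ket:
  assumes "v \<in> carrier_vec N" "i < N"
  shows "tensor_vec (ket [c]) v $ (i + of_bool b * N) = of_bool (b = c) * v $ i"
  using assms by (cases b; cases c) (simp_all add: tensor_vec_def ket_def index_of_bits_def)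

lemma pure_ket: "pure_state 2 (ket [c])"
  by (cases c) (simp_all add: pure_state_def ket_def index_of_bits_def cscalar_prod_eq[where N = 2] lessThan_nat_numeral lessThan_Suc numeral_2_eq_2)

lemma pure_ket_tensor: "pure_state (2 ^ n) v \<Longrightarrow> pure_state (2 ^ (n + 1)) (tensor_vec (ket [c]) v)"
  using pure_tensor[of 1 "ket [c]" n v] pure_ket[of c] by simp

lemma trace_out_first_mix:
  assumes "v \<in> carrier_vec (2 ^ n)" "w \<in> carrier_vec (2 ^ n)"
  shows "trace_out_first n (mix \<eta> (tensor_vec (ket [False]) v) (tensor_vec (ket [True]) w)) = mix \<eta> v w"
proof (rule eq_matI)
  fix i j assume "i < dim_row (mix \<eta> v w)" "j < dim_col (mix \<eta> v w)"
  then have ij: "i < 2 ^ n" "j < 2 ^ n" using assms by auto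
  have c: "tensor_vec (ket [c]) z \<in> carrier_vec (2 * 2 ^ n)" if "z \<in> carrier_vec (2 ^ n)" for c z
    using that by (intro carrier_vecI) (simp add: ket_def)
  have lt: "i + of_bool b * 2 ^ n < 2 * 2 ^ n" if "i < 2 ^ n" for i :: nat and b :: bool using that by (cases b) auto
  have "trace_out_first n (mix \<eta> (tensor_vec (ket [False]) v) (tensor_vec (ket [True]) w)) $$ (i, j)
    = mix \<eta> (tensor_vec (ket [False]) v) (tensor_vec (ket [True]) w) $$ (i + of_bool False * 2 ^ n, j + of_bool False * 2 ^ n)
    + mix \<eta> (tensor_vec (ket [False]) v) (tensor_vec (ket [True]) w) $$ (i + of_bool True * 2 ^ n, j + of_bool True * 2 ^ n)"
    using ij by (simp add: trace_out_first_def numeral_2_eq_2 lessThan_Suc add.commute)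
  also have "\<dots> = mix \<eta> v w $$ (i, j)"
    unfolding index_mix[OF c[OF assms(1)] c[OF assms(2)] lt[OF ij(1)] lt[OF ij(2)]]
      index_outer[OF c[OF assms(1)] lt[OF ij(1)] lt[OF ij(2)]] index_outer[OF c[OF assms(2)] lt[OF ij(1)] lt[OF ij(2)]]
      index_tensor_ket[OF assms(1) ij(1)] index_tensor_ket[OF assms(2) ij(1)] 
      index_tensor_ket[OF assms(1) ij(2)] index_tensor_ket[OF assms(2) ij(2)] 
    by (simp add: index_mix[OF assms ij] index_outer[OF assms(1) ij] index_outer[OF assms(2) ij])
  finally show "trace_out_first n (mix \<eta> (tensor_vec (ket [False]) v) (tensor_vec (ket [True]) w)) $$ (i, j) = mix \<eta> v w $$ (i, j)" .
qed (use assms in \<open>auto simp: trace_out_first_def\<close>)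

text \<open>The same \<eta> and \<psi> describe both generators. Hence what pseudorandomness of
  \<open>G\<close> implies for \<eta> is a statement about the abort weight of \<open>Ghat\<close>,
  the generator that the scheme uses.\<close>

lemma recognizable_abort_mix:
  assumes "recognizable_abort d n G Ghat bot_hat" "k \<in> bits l" "x \<in> bits (d l)"
  shows "\<exists>\<eta> \<psi>. 0 \<le> \<eta> \<and> \<eta> \<le> 1 \<and> pure_state (2 ^ n l) \<psi> \<and>
    Ghat l k x = mix \<eta> (tensor_vec (ket [False]) \<psi>) (bot_state (bot_hat l)) \<and> G l k x = mix \<eta> \<psi> (bot_hat l)"
proof -
  have b: "pure_state (2 ^ n l) (bot_hat l)" using assms by (auto simp: recognizable_abort_def)
  obtain \<eta> \<psi> where *: "0 \<le> \<eta>" "\<eta> \<le> 1" "pure_state (2 ^ n l) \<psi>"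
    "Ghat l k x = complex_of_real \<eta> \<cdot>\<^sub>m (outer (ket [False]) \<Otimes> outer \<psi>)
                        + complex_of_real (1 - \<eta>) \<cdot>\<^sub>m outer (bot_state (bot_hat l))"
    "G l k x = trace_out_first (n l) (Ghat l k x)"
    using assms unfolding recognizable_abort_def by metis
  then have g: "Ghat l k x = mix \<eta> (tensor_vec (ket [False]) \<psi>) (bot_state (bot_hat l))"
    by (simp add: mix_def outer_tensor)
  moreover have "G l k x = mix \<eta> \<psi> (bot_hat l)"
    using *(5) trace_out_first_mix[OF pure_stateD(1)[OF *(3)] pure_stateD(1)[OF b]]
    unfolding g bot_state_def by simp
  ultimately show ?thesis using * by blast
qed

text \<open>A distinguisher has to be a valid circuit of positive width at every security parameter.
  Where no input bit can control the swap, an empty circuit with one ancilla fills the gap.\<close>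

definition test_family :: "(nat \<Rightarrow> nat) \<Rightarrow> (nat \<Rightarrow> nat) \<Rightarrow> nat \<Rightarrow> circuit" where
  "test_family d m l = (if d l = 0 then Circuit (2 * m l) 1 [] else swap_circuit (d l) (m l))"

text \<open>The security game for one input. The copies and the advice together must fill exactly
  the two blocks of the swap, which is the hypothesis on \<open>t l * n l + a l\<close>.\<close>

lemma prfs_single_input:
  assumes G: "prfs_generator haar d n G" and X: "\<And>l. X l \<in> bits (d l)"
    and t: "poly_bounded t" and sz: "poly_bounded (\<lambda>l. d l + 5 * m l + 2)"
    and m: "\<And>l. t l * n l + a l = 2 * m l" and \<alpha>: "\<And>l. density_matrix (2 ^ a l) (\<alpha> l)"
  obtains \<epsilon> where "negligible_fun \<epsilon>"
    "\<And>l. 0 < d l \<Longrightarrow> \<bar>prfs_prob G l (swap_circuit (d l) (m l)) [X l] (t l) (\<alpha> l)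
       - haar_prob haar (n l) (swap_circuit (d l) (m l)) [X l] (t l) (\<alpha> l)\<bar> \<le> \<epsilon> l"
proof -
  \<comment> \<open>If there is a control bit, the circuit has d + 2 m qubits, 3 m Toffoli gates and
    two Hadamard gates.\<close>
  have size: "circuit_size (test_family d m l) \<le> d l + 5 * m l + 2" for l
    by (simp add: test_family_def circuit_size_def width_def swap_circuit_def length_swap_gates)
  have "poly_bounded (\<lambda>l. circuit_size (test_family d m l))"
    using sz size unfolding poly_bounded_def by (meson order_trans)
  moreover have "valid_circuit (test_family d m l) \<and> 0 < width (test_family d m l) \<and>
     inputs (test_family d m l) = 1 * d l + 1 * t l * n l + a l" for l
    using m[of l] valid_swap_circuit[of "d l" "m l"]
    by (auto simp: test_family_def swap_circuit_def valid_circuit_def width_def)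
  ultimately have "distinguisher d n (\<lambda>_. 1) t (test_family d m) a \<alpha>"
    using \<alpha> by (simp add: distinguisher_def)
  moreover have "poly_bounded (\<lambda>_. 1)" by (auto simp: poly_bounded_def intro!: exI[of _ 1])
  moreover have "\<forall>l. distinct [X l] \<and> length [X l] = 1 \<and> set [X l] \<subseteq> bits (d l)" using X by simp
  ultimately obtain \<epsilon> where e: "negligible_fun \<epsilon>"
    "\<And>l. \<bar>prfs_prob G l (test_family d m l) [X l] (t l) (\<alpha> l)
       - haar_prob haar (n l) (test_family d m l) [X l] (t l) (\<alpha> l)\<bar> \<le> \<epsilon> l"
    using G t unfolding prfs_generator_def by meson
  show ?thesis
  proof (rule that[OF e(1)])
    fix l assume "0 < d l"
    then show "\<bar>prfs_prob G l (swap_circuit (d l) (m l)) [X l] (t l) (\<alpha> l)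
       - haar_prob haar (n l) (swap_circuit (d l) (m l)) [X l] (t l) (\<alpha> l)\<bar> \<le> \<epsilon> l"
      using e(2)[of l] by (simp add: test_family_def)
  qed
qed

section \<open>The two tests on Haar random states\<close>

lemma integral_PiM_single:
  assumes "prob_space M" "h \<in> borel_measurable M"
  shows "(\<integral>\<theta>. h (\<theta> 0) \<partial>(\<Pi>\<^sub>M i\<in>{..<1::nat}. M)) = (\<integral>\<theta>. (h \<theta> :: real) \<partial>M)"
proof -
  have "(\<integral>\<theta>. h \<theta> \<partial>M) = (\<integral>\<theta>. h \<theta> \<partial>distr (\<Pi>\<^sub>M i\<in>{..<1::nat}. M) M (\<lambda>\<omega>. \<omega> 0))"
    using distr_PiM_component[of "{..<1::nat}" "\<lambda>_. M" 0] assms(1) by simp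
  also have "\<dots> = (\<integral>\<theta>. h (\<theta> 0) \<partial>(\<Pi>\<^sub>M i\<in>{..<1::nat}. M))"
    by (rule integral_distr) (use assms(2) in auto)
  finally show ?thesis ..
qed

lemma haar_prob_single:
  assumes h: "haar_state_measure (2 ^ n) (haar (2 ^ n))"
    and acc: "\<And>\<theta>. accept_prob C [x] t [outer (vec (2 ^ n) \<theta>)] \<alpha> = f \<theta>"
    and f: "f \<in> borel_measurable (\<Pi>\<^sub>M i\<in>{..<2 ^ n}. borel)"
  shows "haar_prob haar n C [x] t \<alpha> = (\<integral>\<theta>. f \<theta> \<partial>haar (2 ^ n))"
proof -
  have s: "sets (haar (2 ^ n)) = sets (\<Pi>\<^sub>M i\<in>{..<2 ^ n}. borel)" using h by (simp add: haar_state_measure_def)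
  have "f \<in> borel_measurable (haar (2 ^ n))"
    using f unfolding measurable_cong_sets[OF s refl] .
  then show ?thesis
    using integral_PiM_single[of "haar (2 ^ n)" f] h
    by (simp add: haar_prob_def acc haar_state_measure_def)
qed

text \<open>Since its modulus is 1, this sign of the control qubit drops out of every distinguishing
  gap, by \<open>sgr_abs\<close>.\<close>

definition sgr :: "bool \<Rightarrow> real" where "sgr b = (if b then -1 else 1)"

lemma Re_sgb_eq: "Re (sgb b) = sgr b"
  by (simp add: sgb_def sgr_def)

lemma Re_sgb: "Re (sgb b * z) = sgr b * Re z"
  by (simp add: sgb_def sgr_def)

lemma sgr_abs: "\<bar>sgr b * y\<bar> = \<bar>y\<bar>"
  by (simp add: sgr_def)

definition key_avg :: "nat \<Rightarrow> (bool list \<Rightarrow> real) \<Rightarrow> real" where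
  "key_avg l f = (\<Sum>k\<in>bits l. f k) / 2 ^ l"

lemma key_avg_affine: "key_avg l (\<lambda>k. (1 - s * f k) / 2) = (1 - s * key_avg l f) / 2"
  by (simp add: key_avg_def sum_divide_distrib[symmetric] sum_subtractf sum_distrib_left[symmetric] field_simps)

lemma haar_purity:
  assumes h: "haar_state_measure (2 ^ n) (haar (2 ^ n))" and d: "0 < d" "x \<in> bits d"
  shows "haar_prob haar n (swap_circuit d n) [x] 2 (1\<^sub>m 1) = (1 - sgr (hd x)) / 2"
proof -
  let ?S = "\<lambda>\<theta>. \<Sum>i<2 ^ n. (cmod (\<theta> i))\<^sup>2"
  interpret prob_space "haar (2 ^ n)" using h by (simp add: haar_state_measure_def)
  have s: "sets (haar (2 ^ n)) = sets (\<Pi>\<^sub>M i\<in>{..<2 ^ n}. borel)" using h by (simp add: haar_state_measure_def)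
  have self: "vec (2 ^ n) \<theta> \<bullet>c vec (2 ^ n) \<theta> = complex_of_real (?S \<theta>)" for \<theta>
    by (subst cscalar_prod_self[where N = "2 ^ n"]) auto
  have "accept_prob (swap_circuit d n) [x] 2 [outer (vec (2 ^ n) \<theta>)] (1\<^sub>m 1) = (?S \<theta> * ?S \<theta> - sgr (hd x) * (?S \<theta>)\<^sup>2) / 2" for \<theta>
    using d by (subst accept_purity_test)
      (simp_all add: btrace_outer overlap_outer self Re_sgb Re_sgb_eq sum_nonneg del: of_real_sum of_real_power of_real_mult flip: of_real_mult)
  then have "haar_prob haar n (swap_circuit d n) [x] 2 (1\<^sub>m 1) = (\<integral>\<theta>. (?S \<theta> * ?S \<theta> - sgr (hd x) * (?S \<theta>)\<^sup>2) / 2 \<partial>haar (2 ^ n))"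
    by (rule haar_prob_single[of n haar, OF h]) measurable
  also have "\<dots> = (\<integral>\<theta>. (1 - sgr (hd x)) / 2 \<partial>haar (2 ^ n))"
  proof (rule integral_cong_AE)
    show "(\<lambda>\<theta>. (?S \<theta> * ?S \<theta> - sgr (hd x) * (?S \<theta>)\<^sup>2) / 2) \<in> borel_measurable (haar (2 ^ n))"
      unfolding measurable_cong_sets[OF s refl] by measurable
    have "AE \<theta> in haar (2 ^ n). pure_state (2 ^ n) (vec (2 ^ n) \<theta>)" using h by (simp add: haar_state_measure_def)
    then show "AE \<theta> in haar (2 ^ n). (?S \<theta> * ?S \<theta> - sgr (hd x) * (?S \<theta>)\<^sup>2) / 2 = (1 - sgr (hd x)) / 2"
      by eventually_elim (simp add: pure_state_iff)
  qed simp
  also have "\<dots> = (1 - sgr (hd x)) / 2" by (simp add: prob_space)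
  finally show ?thesis .
qed

lemma haar_overlap:
  assumes h: "haar_state_measure (2 ^ n) (haar (2 ^ n))" and d: "0 < d" "x \<in> bits d"
    and p: "pure_state (2 ^ n) p"
  obtains M where "0 \<le> M" "M \<le> 1 / 2 ^ t + 4 * exp (- (2 ^ n) / 8)"
    "haar_prob haar n (swap_circuit d (t * n)) [x] t (tensor_list (replicate t (outer p))) = (1 - sgr (hd x) * M) / 2"
proof -
  let ?S = "\<lambda>\<theta>. \<Sum>i<2 ^ n. (cmod (\<theta> i))\<^sup>2"
  let ?F = "\<lambda>\<theta>. (cmod (vec (2 ^ n) \<theta> \<bullet>c p)) ^ (2 * t)"
  interpret prob_space "haar (2 ^ n)" using h by (simp add: haar_state_measure_def)
  have s: "sets (haar (2 ^ n)) = sets (\<Pi>\<^sub>M i\<in>{..<2 ^ n}. borel)" using h by (simp add: haar_state_measure_def)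
  note pc = pure_stateD(1)[OF p]
  have self: "vec (2 ^ n) \<theta> \<bullet>c vec (2 ^ n) \<theta> = complex_of_real (?S \<theta>)" for \<theta>
    by (subst cscalar_prod_self[where N = "2 ^ n"]) auto
  have acc: "accept_prob (swap_circuit d (t * n)) [x] t [outer (vec (2 ^ n) \<theta>)] (tensor_list (replicate t (outer p)))
      = (?S \<theta> ^ t - sgr (hd x) * ?F \<theta>) / 2" for \<theta>
  proof -
    have o: "overlap n (outer (vec (2 ^ n) \<theta>)) (outer p) ^ t = complex_of_real (?F \<theta>)"
      using pc by (simp add: overlap_outer power_mult)
    have b: "btrace n (outer (vec (2 ^ n) \<theta>)) ^ t * btrace n (outer p) ^ t = complex_of_real (?S \<theta> ^ t)"
      using pc pure_stateD(2)[OF p] by (simp add: btrace_outer self)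
    show ?thesis
      using accept_overlap_test[OF d outer_carrier[OF vec_carrier] outer_carrier[OF pc], of t \<theta>]
      unfolding o b Re_sgb by (simp only: Re_complex_of_real)
  qed
  have Fm: "?F \<in> borel_measurable (\<Pi>\<^sub>M i\<in>{..<2 ^ n}. borel)" by (rule haar_moment_measurable[OF pc])
  have fm: "(\<lambda>\<theta>. (?S \<theta> ^ t - sgr (hd x) * ?F \<theta>) / 2) \<in> borel_measurable (\<Pi>\<^sub>M i\<in>{..<2 ^ n}. borel)"
    using Fm by measurable
  have ae: "AE \<theta> in haar (2 ^ n). pure_state (2 ^ n) (vec (2 ^ n) \<theta>)" using h by (simp add: haar_state_measure_def)
  have int: "integrable (haar (2 ^ n)) ?F"
  proof (rule integrable_const_bound[where B = 1])
    show "AE \<theta> in haar (2 ^ n). norm (?F \<theta>) \<le> 1"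
      using ae by eventually_elim (use p in \<open>auto intro!: power_le_one pure_inner_le_1\<close>)
  qed (use Fm measurable_cong_sets[OF s refl] in blast)
  have "haar_prob haar n (swap_circuit d (t * n)) [x] t (tensor_list (replicate t (outer p)))
     = (\<integral>\<theta>. (?S \<theta> ^ t - sgr (hd x) * ?F \<theta>) / 2 \<partial>haar (2 ^ n))"
    by (rule haar_prob_single[of n haar, OF h _ fm]) (rule acc)
  also have "\<dots> = (\<integral>\<theta>. (1 - sgr (hd x) * ?F \<theta>) / 2 \<partial>haar (2 ^ n))"
  proof (rule integral_cong_AE)
    show "(\<lambda>\<theta>. (?S \<theta> ^ t - sgr (hd x) * ?F \<theta>) / 2) \<in> borel_measurable (haar (2 ^ n))"
      using fm measurable_cong_sets[OF s refl] by blast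
    show "(\<lambda>\<theta>. (1 - sgr (hd x) * ?F \<theta>) / 2) \<in> borel_measurable (haar (2 ^ n))"
      using borel_measurable_integrable[OF int] by measurable
    show "AE \<theta> in haar (2 ^ n). (?S \<theta> ^ t - sgr (hd x) * ?F \<theta>) / 2 = (1 - sgr (hd x) * ?F \<theta>) / 2"
      using ae by eventually_elim (simp add: pure_state_iff)
  qed
  also have "\<dots> = (1 - sgr (hd x) * (\<integral>\<theta>. ?F \<theta> \<partial>haar (2 ^ n))) / 2"
    using int by (simp add: prob_space)
  finally have eq: "haar_prob haar n (swap_circuit d (t * n)) [x] t (tensor_list (replicate t (outer p)))
    = (1 - sgr (hd x) * (\<integral>\<theta>. ?F \<theta> \<partial>haar (2 ^ n))) / 2" .
  show ?thesis
  proof (rule that[OF _ _ eq])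
    show "0 \<le> (\<integral>\<theta>. ?F \<theta> \<partial>haar (2 ^ n))" by (rule Bochner_Integration.integral_nonneg) simp
    show "(\<integral>\<theta>. ?F \<theta> \<partial>haar (2 ^ n)) \<le> 1 / 2 ^ t + 4 * exp (- (2 ^ n) / 8)"
      using haar_moment_bound[OF h p, of t] by simp
  qed
qed

section \<open>What the two tests imply for the generator\<close>

lemma key_avg_mono: "(\<And>k. k \<in> bits l \<Longrightarrow> f k \<le> g k) \<Longrightarrow> key_avg l f \<le> key_avg l g"
  by (simp add: key_avg_def divide_right_mono sum_mono)

lemma key_avg_add: "key_avg l (\<lambda>k. f k + g k) = key_avg l f + key_avg l g"
  by (simp add: key_avg_def sum.distrib add_divide_distrib)

lemma key_avg_cmult: "key_avg l (\<lambda>k. c * f k) = c * key_avg l f"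
  by (simp add: key_avg_def sum_distrib_left)

lemma key_avg_const: "key_avg l (\<lambda>k. c) = c"
  by (simp add: key_avg_def)

text \<open>On Haar states the purity is 1, so the gap is half of the average purity deficit; the 2
  in the deficit of \<open>overlap_mix_mix\<close> cancels this half.\<close>

lemma purity_gap:
  assumes h: "haar_state_measure (2 ^ n) (haar (2 ^ n))" and d: "0 < d" "x \<in> bits d"
    and G: "\<And>k. k \<in> bits l \<Longrightarrow> G l k x = mix (\<eta> k) (\<psi> k) b \<and> 0 \<le> \<eta> k \<and> \<eta> k \<le> 1 \<and> pure_state (2 ^ n) (\<psi> k)"
    and b: "pure_state (2 ^ n) b"
    and e: "\<bar>prfs_prob G l (swap_circuit d n) [x] 2 (1\<^sub>m 1) - haar_prob haar n (swap_circuit d n) [x] 2 (1\<^sub>m 1)\<bar> \<le> e"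
  shows "key_avg l (\<lambda>k. \<eta> k * (1 - \<eta> k) * (1 - (cmod (\<psi> k \<bullet>c b))\<^sup>2)) \<le> e"
proof -
  let ?v = "\<lambda>k. \<eta> k * (1 - \<eta> k) * (1 - (cmod (\<psi> k \<bullet>c b))\<^sup>2)"
  have acc: "accept_prob (swap_circuit d n) [x] 2 [G l k x] (1\<^sub>m 1) = (1 - sgr (hd x) * (1 - 2 * ?v k)) / 2"
    if k: "k \<in> bits l" for k
  proof -
    have c: "G l k x \<in> carrier_mat (2 ^ n) (2 ^ n)" using G[OF k] b by (auto intro!: mix_carrier pure_stateD(1))
    have "btrace n (G l k x) * btrace n (G l k x) = complex_of_real 1"
      using G[OF k] b by (simp add: btrace_mix)
    moreover have "overlap n (G l k x) (G l k x) = complex_of_real (1 - 2 * ?v k)"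
      using G[OF k] b overlap_mix_mix[of n "\<psi> k" b "\<eta> k"] by (simp only: mult.assoc)
    ultimately show ?thesis
      using accept_purity_test[OF d c] by (simp only: Re_sgb Re_complex_of_real)
  qed
  have "prfs_prob G l (swap_circuit d n) [x] 2 (1\<^sub>m 1) = key_avg l (\<lambda>k. (1 - sgr (hd x) * (1 - 2 * ?v k)) / 2)"
    by (simp add: prfs_prob_def key_avg_def acc del: One_nat_def)
  also have "\<dots> = (1 - sgr (hd x) * key_avg l (\<lambda>k. 1 - 2 * ?v k)) / 2" by (rule key_avg_affine)
  also have "key_avg l (\<lambda>k. 1 - 2 * ?v k) = 1 - 2 * key_avg l ?v"
    using key_avg_add[of l "\<lambda>_. 1" "\<lambda>k. (-2) * ?v k"] key_avg_cmult[of l "-2" ?v]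
    by (simp add: key_avg_const)
  finally have eq: "prfs_prob G l (swap_circuit d n) [x] 2 (1\<^sub>m 1) = (1 - sgr (hd x) * (1 - 2 * key_avg l ?v)) / 2" .
  have "\<bar>(1 - sgr (hd x) * (1 - 2 * key_avg l ?v)) / 2 - (1 - sgr (hd x)) / 2\<bar> \<le> e"
    using e unfolding haar_purity[of n haar, OF h d] eq .
  then have "\<bar>sgr (hd x) * key_avg l ?v\<bar> \<le> e" by (simp add: field_simps)
  then show ?thesis by (simp add: sgr_abs)
qed

text \<open>The base of the power is the overlap \<eta> g + (1 - \<eta>) of the generated state with
  the abort state, where g is the squared inner product. The factor 2 undoes the half in the
  acceptance probability; the rest bounds the Haar moment.\<close>

lemma overlap_gap:
  assumes h: "haar_state_measure (2 ^ n) (haar (2 ^ n))" and d: "0 < d" "x \<in> bits d"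
    and G: "\<And>k. k \<in> bits l \<Longrightarrow> G l k x = mix (\<eta> k) (\<psi> k) b \<and> 0 \<le> \<eta> k \<and> \<eta> k \<le> 1 \<and> pure_state (2 ^ n) (\<psi> k)"
    and b: "pure_state (2 ^ n) b"
    and e: "\<bar>prfs_prob G l (swap_circuit d (t * n)) [x] t (tensor_list (replicate t (outer b)))
       - haar_prob haar n (swap_circuit d (t * n)) [x] t (tensor_list (replicate t (outer b)))\<bar> \<le> e"
  shows "key_avg l (\<lambda>k. (1 - \<eta> k * (1 - (cmod (\<psi> k \<bullet>c b))\<^sup>2)) ^ t) \<le> 2 * e + 1 / 2 ^ t + 4 * exp (- (2 ^ n) / 8)"
proof -
  let ?f = "\<lambda>k. 1 - \<eta> k * (1 - (cmod (\<psi> k \<bullet>c b))\<^sup>2)"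
  obtain M where M: "0 \<le> M" "M \<le> 1 / 2 ^ t + 4 * exp (- (2 ^ n) / 8)"
    "haar_prob haar n (swap_circuit d (t * n)) [x] t (tensor_list (replicate t (outer b))) = (1 - sgr (hd x) * M) / 2"
    using haar_overlap[where haar = haar and t = t, OF h d b] by blast
  have acc: "accept_prob (swap_circuit d (t * n)) [x] t [G l k x] (tensor_list (replicate t (outer b)))
     = (1 - sgr (hd x) * ?f k ^ t) / 2"
    if k: "k \<in> bits l" for k
  proof -
    have c: "G l k x \<in> carrier_mat (2 ^ n) (2 ^ n)" using G[OF k] b by (auto intro!: mix_carrier pure_stateD(1))
    have "btrace n (G l k x) ^ t * btrace n (outer b) ^ t = complex_of_real 1"
      using G[OF k] b by (simp add: btrace_mix btrace_outer pure_stateD)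
    moreover have "overlap n (G l k x) (outer b) ^ t = complex_of_real (?f k ^ t)"
    proof -
      have "\<eta> k * (cmod (\<psi> k \<bullet>c b))\<^sup>2 + (1 - \<eta> k) = ?f k" by (simp add: algebra_simps)
      then show ?thesis
        using G[OF k] overlap_mix_outer[of n "\<psi> k" b "\<eta> k"] b by (simp only: of_real_power)
    qed
    ultimately show ?thesis
      using accept_overlap_test[OF d c outer_carrier[OF pure_stateD(1)[OF b]], of t]
      by (simp only: Re_sgb Re_complex_of_real)
  qed
  have "prfs_prob G l (swap_circuit d (t * n)) [x] t (tensor_list (replicate t (outer b)))
      = key_avg l (\<lambda>k. (1 - sgr (hd x) * ?f k ^ t) / 2)"
    by (simp add: prfs_prob_def key_avg_def acc)
  also have "\<dots> = (1 - sgr (hd x) * key_avg l (\<lambda>k. ?f k ^ t)) / 2" by (rule key_avg_affine)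
  finally have eq: "prfs_prob G l (swap_circuit d (t * n)) [x] t (tensor_list (replicate t (outer b)))
    = (1 - sgr (hd x) * key_avg l (\<lambda>k. ?f k ^ t)) / 2" .
  have "\<bar>(1 - sgr (hd x) * key_avg l (\<lambda>k. ?f k ^ t)) / 2 - (1 - sgr (hd x) * M) / 2\<bar> \<le> e"
    using e unfolding M(3) eq .
  moreover have "(1 - sgr (hd x) * key_avg l (\<lambda>k. ?f k ^ t)) / 2 - (1 - sgr (hd x) * M) / 2
     = sgr (hd x) * ((M - key_avg l (\<lambda>k. ?f k ^ t)) / 2)" by (simp add: field_simps)
  ultimately have "\<bar>(M - key_avg l (\<lambda>k. ?f k ^ t)) / 2\<bar> \<le> e" by (simp only: sgr_abs)
  then show ?thesis using M(2) by (simp add: abs_le_iff)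
qed

text \<open>A state that aborts with noticeable probability is either close to the abort state, so that it has a
  large overlap with it, or far from pure.\<close>

lemma abort_weight_bound:
  fixes \<eta> g :: real
  assumes "0 \<le> \<eta>" "\<eta> \<le> 1" "0 \<le> g" "g \<le> 1" "0 < t"
  shows "1 - \<eta> \<le> 2 * (1 - \<eta> * (1 - g)) ^ t + 2 * real t * (\<eta> * (1 - \<eta>) * (1 - g))"
proof -
  define u where "u = \<eta> * (1 - g)"
  have u: "0 \<le> u" "u \<le> 1" using assms by (auto simp: u_def mult_le_one)
  have "1 - \<eta> \<le> 2 * (1 - u) ^ t + 2 * real t * ((1 - \<eta>) * u)"
  \<comment> \<open>The threshold is u = 1 / (2 t). Below it, Bernoulli's inequality gives (1 - u) ^
    t \<ge> 1 / 2; above it, the second summand alone is at least 1 - \<eta>.\<close>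
  proof (cases "2 * real t * u \<le> 1")
    case True
    have "1 + real t * (- u) \<le> (1 + (- u)) ^ t" using u by (intro Bernoulli_inequality) auto
    then have "1 \<le> 2 * (1 - u) ^ t" using True by simp
    moreover have "0 \<le> 2 * real t * ((1 - \<eta>) * u)" using u assms by simp
    ultimately show ?thesis using assms by linarith
  next
    case False
    then have "(1 - \<eta>) * 1 \<le> (1 - \<eta>) * (2 * real t * u)" using assms by (intro mult_left_mono) auto
    moreover have "0 \<le> (1 - u) ^ t" using u by simp
    ultimately show ?thesis by (simp add: algebra_simps)
  qed
  then show ?thesis by (simp add: u_def mult_ac)
qed

lemma abort_negligible:
  assumes haar: "\<And>N. 1 \<le> N \<Longrightarrow> haar_state_measure N (haar N)"
    and G: "prfs_generator haar in_len out_len G"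
    and b: "\<And>l. pure_state (2 ^ out_len l) (bot_hat l)"
    and mix: "\<And>l k x. k \<in> bits l \<Longrightarrow> x \<in> bits (in_len l) \<Longrightarrow> G l k x = mix (\<eta> l k x) (\<psi> l k x) (bot_hat l)
      \<and> 0 \<le> \<eta> l k x \<and> \<eta> l k x \<le> 1 \<and> pure_state (2 ^ out_len l) (\<psi> l k x)"
  shows "\<exists>\<delta>. negligible_fun \<delta> \<and> (\<forall>\<^sub>F l in sequentially. \<forall>x\<in>bits (in_len l). key_avg l (\<lambda>k. 1 - \<eta> l k x) \<le> \<delta> l)"
proof -
  \<comment> \<open>One negligible function has to serve all inputs. As security is granted for any
    fixed family of inputs, each \<open>l\<close> is given an input with the largest average abort
    probability.\<close>
  have "\<exists>x\<in>bits (in_len l). \<forall>y\<in>bits (in_len l). key_avg l (\<lambda>k. 1 - \<eta> l k y) \<le> key_avg l (\<lambda>k. 1 - \<eta> l k x)" for l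
  proof -
    let ?f = "\<lambda>x. key_avg l (\<lambda>k. 1 - \<eta> l k x)"
    have "Max (?f ` bits (in_len l)) \<in> ?f ` bits (in_len l)" by (intro Max_in) auto
    then obtain x where "x \<in> bits (in_len l)" "Max (?f ` bits (in_len l)) = ?f x" by blast
    then show ?thesis using Max_ge[of "?f ` bits (in_len l)"] by auto
  qed
  then obtain X where X: "\<And>l. X l \<in> bits (in_len l)"
    "\<And>l y. y \<in> bits (in_len l) \<Longrightarrow> key_avg l (\<lambda>k. 1 - \<eta> l k y) \<le> key_avg l (\<lambda>k. 1 - \<eta> l k (X l))"
    by metis
  have sq: "l \<le> l\<^sup>2" for l :: nat by (cases l) (auto simp: power2_eq_square)
  obtain \<epsilon>1 where e1: "negligible_fun \<epsilon>1"
    "\<And>l. 0 < in_len l \<Longrightarrow> \<bar>prfs_prob G l (swap_circuit (in_len l) (out_len l)) [X l] 2 (1\<^sub>m 1)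
       - haar_prob haar (out_len l) (swap_circuit (in_len l) (out_len l)) [X l] 2 (1\<^sub>m 1)\<bar> \<le> \<epsilon>1 l"
  \<comment> \<open>Two copies fill both blocks, so the advice is empty.\<close>
  proof (rule prfs_single_input[OF G X(1), where t = "\<lambda>_. 2" and m = out_len and a = "\<lambda>_. 0" and \<alpha> = "\<lambda>_. 1\<^sub>m 1"])
    show "poly_bounded (\<lambda>_. 2)" by (rule poly_bounded_quadratic[where K = 2]) simp
    show "poly_bounded (\<lambda>l. in_len l + 5 * out_len l + 2)"
    proof (rule poly_bounded_quadratic)
      fix l show "in_len l + 5 * out_len l + 2 \<le> 20 * l\<^sup>2 + 20"
        using in_len_le[of l] out_len_le[of l] sq[of l] by linarith
    qed
    show "density_matrix (2 ^ 0) (1\<^sub>m 1)" using density_one by simp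
  qed auto
  obtain \<epsilon>2 where e2: "negligible_fun \<epsilon>2"
    "\<And>l. 0 < in_len l \<Longrightarrow> \<bar>prfs_prob G l (swap_circuit (in_len l) (l * out_len l)) [X l] l (tensor_list (replicate l (outer (bot_hat l))))
       - haar_prob haar (out_len l) (swap_circuit (in_len l) (l * out_len l)) [X l] l (tensor_list (replicate l (outer (bot_hat l))))\<bar> \<le> \<epsilon>2 l"
  \<comment> \<open>The copies fill one block and the advice the other. Their number has to grow for
    1 / 2 ^ l to be negligible, and polynomial growth keeps the factor 2 l in front of
    \<open>\<epsilon>1\<close> harmless.\<close>
  proof (rule prfs_single_input[OF G X(1), where t = "\<lambda>l. l" and m = "\<lambda>l. l * out_len l" and a = "\<lambda>l. l * out_len l"
        and \<alpha> = "\<lambda>l. tensor_list (replicate l (outer (bot_hat l)))"])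
    show "poly_bounded (\<lambda>l. l)"
    proof (rule poly_bounded_quadratic)
      show "l \<le> 1 * l\<^sup>2 + 1" for l :: nat using sq[of l] by linarith
    qed
    show "poly_bounded (\<lambda>l. in_len l + 5 * (l * out_len l) + 2)"
    proof (rule poly_bounded_quadratic)
      fix l
      have "l * out_len l \<le> l * (3 * l)" by (intro mult_left_mono out_len_le) simp
      then have "l * out_len l \<le> 3 * l\<^sup>2" by (simp add: power2_eq_square)
      then show "in_len l + 5 * (l * out_len l) + 2 \<le> 20 * l\<^sup>2 + 20"
        using in_len_le[of l] sq[of l] by linarith
    qed
    show "density_matrix (2 ^ (l * out_len l)) (tensor_list (replicate l (outer (bot_hat l))))" for l
      by (rule density_tensor_power[OF b])
  qed auto
  \<comment> \<open>\<open>abort_weight_bound\<close> at \<open>t = l\<close>, with the bounds of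
    \<open>overlap_gap\<close> and \<open>purity_gap\<close> inserted.\<close>
  define \<delta> where "\<delta> l = 4 * \<epsilon>2 l + (2 * (1 / 2) ^ l + 8 * exp (- (2 ^ out_len l) / 8)) + 2 * (real l * \<epsilon>1 l)" for l
  have "negligible_fun \<delta>"
    unfolding \<delta>_def
    by (intro negligible_add negligible_cmult negligible_times_n negligible_haar negligible_geometric e1(1) e2(1)) auto
  moreover have "\<forall>\<^sub>F l in sequentially. \<forall>x\<in>bits (in_len l). key_avg l (\<lambda>k. 1 - \<eta> l k x) \<le> \<delta> l"
    using eventually_ge_at_top[of 2]
  proof eventually_elim
    case (elim l)
    let ?x = "X l" and ?n = "out_len l" and ?d = "in_len l"
    let ?g = "\<lambda>k. (cmod (\<psi> l k ?x \<bullet>c bot_hat l))\<^sup>2"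
    have d: "0 < ?d" by (rule in_len_pos[OF elim])
    have h: "haar_state_measure (2 ^ ?n) (haar (2 ^ ?n))" by (rule haar) simp
    have g: "0 \<le> ?g k" "?g k \<le> 1" if "k \<in> bits l" for k
      using pure_inner_le_1[of "2 ^ ?n" "\<psi> l k ?x" "bot_hat l"] mix[OF that X(1)] b by (auto simp: power_le_one)
    have 1: "key_avg l (\<lambda>k. \<eta> l k ?x * (1 - \<eta> l k ?x) * (1 - ?g k)) \<le> \<epsilon>1 l"
      by (rule purity_gap[where G = G, OF h d X(1) mix[OF _ X(1)] b e1(2)[OF d]])
    have 2: "key_avg l (\<lambda>k. (1 - \<eta> l k ?x * (1 - ?g k)) ^ l) \<le> 2 * \<epsilon>2 l + 1 / 2 ^ l + 4 * exp (- (2 ^ ?n) / 8)"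
      by (rule overlap_gap[where G = G, OF h d X(1) mix[OF _ X(1)] b e2(2)[OF d]])
    have "key_avg l (\<lambda>k. 1 - \<eta> l k ?x) \<le> key_avg l (\<lambda>k. 2 * (1 - \<eta> l k ?x * (1 - ?g k)) ^ l
        + 2 * real l * (\<eta> l k ?x * (1 - \<eta> l k ?x) * (1 - ?g k)))"
      using elim mix[OF _ X(1)] g by (intro key_avg_mono abort_weight_bound) auto
    also have "\<dots> = 2 * key_avg l (\<lambda>k. (1 - \<eta> l k ?x * (1 - ?g k)) ^ l)
        + 2 * real l * key_avg l (\<lambda>k. \<eta> l k ?x * (1 - \<eta> l k ?x) * (1 - ?g k))"
      by (simp only: key_avg_add key_avg_cmult)
    also have "\<dots> \<le> 2 * (2 * \<epsilon>2 l + 1 / 2 ^ l + 4 * exp (- (2 ^ ?n) / 8)) + 2 * real l * \<epsilon>1 l"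
      by (intro add_mono mult_left_mono 1 2) auto
    also have "\<dots> = \<delta> l" by (simp add: \<delta>_def power_one_over)
    finally show ?case using X(2) by (meson order_trans)
  qed
  ultimately show ?thesis by blast
qed


section \<open>Probabilities of honest tomography\<close>

lemma prob_bind_pmf: "measure_pmf.prob (bind_pmf p f) B = measure_pmf.expectation p (\<lambda>x. measure_pmf.prob (f x) B)"
proof -
  have *: "measure_pmf.prob q B = pmf (map_pmf (\<lambda>y. y \<in> B) q) True" for q
    by (simp add: pmf_map vimage_def)
  show ?thesis by (simp add: * map_bind_pmf pmf_bind)
qed

lemma integrable_indicator_pmf [simp]: "integrable (measure_pmf p) (indicator A :: 'a \<Rightarrow> real)"
  by (rule measure_pmf.integrable_const_bound[where B = 1]) auto

text \<open>Splits a two-stage experiment by whether its first stage went wrong. The bounds for the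
  key, the commit phase and the reveal phase are chained by it.\<close>

lemma prob_bind_le:
  assumes "measure_pmf.prob p {x. \<not> Q x} \<le> a" "0 \<le> b"
    and "\<And>x. x \<in> set_pmf p \<Longrightarrow> Q x \<Longrightarrow> measure_pmf.prob (f x) B \<le> b"
  shows "measure_pmf.prob (bind_pmf p f) B \<le> a + b"
proof -
  have int: "integrable (measure_pmf p) (\<lambda>x. measure_pmf.prob (f x) B)"
    by (rule measure_pmf.integrable_const_bound[where B = 1]) auto
  have "measure_pmf.prob (bind_pmf p f) B \<le> measure_pmf.expectation p (\<lambda>x. indicator {x. \<not> Q x} x + b)"
    unfolding prob_bind_pmf
  proof (rule integral_mono_AE[OF int])
    show "AE x in measure_pmf p. measure_pmf.prob (f x) B \<le> indicator {x. \<not> Q x} x + b"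
      using assms(2,3) by (auto simp: AE_measure_pmf_iff indicator_def intro: add_increasing2)
    show "integrable (measure_pmf p) (\<lambda>x. indicator {x. \<not> Q x} x + b)"
      by simp
  qed
  also have "\<dots> = measure_pmf.prob p {x. \<not> Q x} + b" by simp
  finally show ?thesis using assms(1) by simp
qed

lemma prob_Pi_pmf_union:
  assumes "finite A" "\<And>x. x \<in> A \<Longrightarrow> measure_pmf.prob (p x) {y. \<not> Q x y} \<le> b"
  shows "measure_pmf.prob (Pi_pmf A d p) {f. \<not> (\<forall>x\<in>A. Q x (f x))} \<le> real (card A) * b"
proof -
  have "measure_pmf.prob (Pi_pmf A d p) {f. \<not> Q x (f x)} \<le> b" if "x \<in> A" for x
  proof -
    have "measure_pmf.prob (Pi_pmf A d p) {f. \<not> Q x (f x)} = measure_pmf.prob (map_pmf (\<lambda>f. f x) (Pi_pmf A d p)) {y. \<not> Q x y}"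
      by (simp add: vimage_def)
    then show ?thesis using assms that by (simp add: Pi_pmf_component)
  qed
  moreover have "{f. \<not> (\<forall>x\<in>A. Q x (f x))} = (\<Union>x\<in>A. {f. \<not> Q x (f x)})" by auto
  ultimately show ?thesis
    using measure_pmf.finite_measure_subadditive_finite[OF assms(1), of "\<lambda>x. {f. \<not> Q x (f x)}" "Pi_pmf A d p"]
      sum_bounded_above[of A "\<lambda>x. measure_pmf.prob (Pi_pmf A d p) {f. \<not> Q x (f x)}" b] by simp
qed

text \<open>A Chernoff bound: the exponential moment of the number of failures, with base 3, is at most
  \<open>(3 / 2) ^ l\<close>.\<close>

lemma prob_failures:
  assumes "measure_pmf.prob p {x. \<not> Q x} \<le> 1 / 4"
  shows "measure_pmf.prob (replicate_pmf l p) {xs. m \<le> length (filter (\<lambda>x. \<not> Q x) xs)} \<le> (3 / 2) ^ l / 3 ^ m"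
proof (induction l arbitrary: m)
  case 0
  then show ?case by (cases m) auto
next
  case (Suc l)
  define C :: real where "C = (3 / 2) ^ l / 3 ^ m"
  let ?r = "\<lambda>x. bind_pmf (replicate_pmf l p) (\<lambda>xs. return_pmf (x # xs))"
  let ?B = "{xs. m \<le> length (filter (\<lambda>x. \<not> Q x) xs)}"
  have step: "measure_pmf.prob (?r x) ?B \<le> C * (1 + 2 * indicator {x. \<not> Q x} x)" for x
  proof -
    have r: "?r x = map_pmf (\<lambda>xs. x # xs) (replicate_pmf l p)" by (simp add: map_pmf_def)
    show ?thesis
    proof (cases "Q x")
      case True
      then show ?thesis using Suc[of m] unfolding r by (simp add: C_def vimage_def)
    next
      case False
      \<comment> \<open>For \<open>m = 0\<close> the subtraction is truncated, and the claim reads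
        \<open>C \<le> 3 * C\<close>.\<close>
      have "(3 / 2) ^ l / 3 ^ (m - 1) \<le> 3 * C"
        by (cases m) (auto simp: C_def)
      moreover have "measure_pmf.prob (?r x) ?B = measure_pmf.prob (replicate_pmf l p) {xs. m - 1 \<le> length (filter (\<lambda>x. \<not> Q x) xs)}"
        unfolding r measure_map_pmf
        by (intro arg_cong[where f = "measure_pmf.prob _"]) (use False in auto)
      ultimately show ?thesis using Suc[of "m - 1"] False by simp
    qed
  qed
  have "measure_pmf.prob (replicate_pmf (Suc l) p) ?B \<le> measure_pmf.expectation p (\<lambda>x. C * (1 + 2 * indicator {x. \<not> Q x} x))"
    unfolding replicate_pmf.simps prob_bind_pmf
  proof (rule integral_mono)
    show "integrable (measure_pmf p) (\<lambda>x. measure_pmf.expectation (replicate_pmf l p) (\<lambda>xs. measure_pmf.prob (return_pmf (x # xs)) ?B))"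
      unfolding prob_bind_pmf[symmetric] by (rule measure_pmf.integrable_const_bound[where B = 1]) auto
    show "integrable (measure_pmf p) (\<lambda>x. C * (1 + 2 * indicator {x. \<not> Q x} x))"
      by (intro integrable_mult_right Bochner_Integration.integrable_add) auto
  qed (use step in \<open>auto simp: prob_bind_pmf\<close>)
  also have "\<dots> = C * (1 + 2 * measure_pmf.prob p {x. \<not> Q x})" by simp
  \<comment> \<open>One run contributes 1 + 2 / 4 = 3 / 2.\<close>
  also have "\<dots> \<le> C * (3 / 2)" using assms by (intro mult_left_mono) (auto simp: C_def)
  finally show ?case by (simp add: C_def)
qed

section \<open>The Frobenius norm and the majority choice\<close>

lemma frobenius_L2: "frobenius_norm A = L2_set (\<lambda>p. cmod (A $$ p)) ({..<dim_row A} \<times> {..<dim_col A})"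
  by (simp add: frobenius_norm_def L2_set_def sum.cartesian_product case_prod_unfold)

lemma frobenius_nonneg [simp]: "0 \<le> frobenius_norm A"
  by (simp add: frobenius_L2 L2_set_nonneg)

lemma frobenius_triangle:
  assumes "A \<in> carrier_mat N N" "B \<in> carrier_mat N N" "C \<in> carrier_mat N N"
  shows "frobenius_norm (A - B) \<le> frobenius_norm (A - C) + frobenius_norm (C - B)"
proof -
  let ?I = "{..<N} \<times> {..<N}"
  have "frobenius_norm (A - B) \<le> L2_set (\<lambda>p. cmod ((A - C) $$ p) + cmod ((C - B) $$ p)) ?I"
    unfolding frobenius_L2 using assms
  proof (simp, intro L2_set_mono)
    fix p assume "p \<in> ?I"
    then have "(A - B) $$ p = (A - C) $$ p + (C - B) $$ p" using assms by auto
    then show "cmod ((A - B) $$ p) \<le> cmod ((A - C) $$ p) + cmod ((C - B) $$ p)" by (simp add: norm_triangle_ineq)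
  qed simp
  also have "\<dots> \<le> frobenius_norm (A - C) + frobenius_norm (C - B)"
    using L2_set_triangle_ineq[of "\<lambda>p. cmod ((A - C) $$ p)" "\<lambda>p. cmod ((C - B) $$ p)" ?I] assms
    by (simp add: frobenius_L2)
  finally show ?thesis .
qed

lemma frobenius_commute:
  assumes "A \<in> carrier_mat N N" "B \<in> carrier_mat N N"
  shows "frobenius_norm (A - B) = frobenius_norm (B - A)"
proof -
  have "(\<Sum>i<N. \<Sum>j<N. (cmod ((A - B) $$ (i, j)))\<^sup>2) = (\<Sum>i<N. \<Sum>j<N. (cmod ((B - A) $$ (i, j)))\<^sup>2)"
    using assms by (intro sum.cong refl) (simp add: norm_minus_commute)
  then show ?thesis using assms by (simp add: frobenius_norm_def)
qed

text \<open>Cauchy-Schwarz for the entries of \<open>D\<close> against those of the projector on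
  \<open>v\<close>, which has Frobenius norm 1.\<close>

lemma frobenius_inner:
  assumes D: "D \<in> carrier_mat N N" and v: "pure_state N v"
  shows "cmod ((D *\<^sub>v v) \<bullet>c v) \<le> frobenius_norm D"
proof -
  let ?I = "{..<N} \<times> {..<N}" and ?w = "\<lambda>(i, j). cmod (v $ i) * cmod (v $ j)"
  have "(D *\<^sub>v v) \<bullet>c v = (\<Sum>(i, j)\<in>?I. D $$ (i, j) * v $ j * cnj (v $ i))"
    using mat_vec_inner[OF D pure_stateD(1)[OF v] pure_stateD(1)[OF v]] by (simp add: sum.cartesian_product)
  also have "cmod \<dots> \<le> (\<Sum>p\<in>?I. \<bar>cmod (D $$ p)\<bar> * \<bar>?w p\<bar>)"
    by (rule order_trans[OF norm_sum]) (auto intro!: sum_mono simp: norm_mult)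
  also have "\<dots> \<le> L2_set (\<lambda>p. cmod (D $$ p)) ?I * L2_set ?w ?I" by (rule L2_set_mult_ineq)
  also have "L2_set ?w ?I = 1"
  proof -
    have "(\<Sum>p\<in>?I. (?w p)\<^sup>2) = (\<Sum>i<N. (cmod (v $ i))\<^sup>2) * (\<Sum>j<N. (cmod (v $ j))\<^sup>2)"
      by (simp add: sum_product sum.cartesian_product power_mult_distrib case_prod_unfold)
    then show ?thesis using v by (simp add: pure_state_iff L2_set_def)
  qed
  finally show ?thesis using D by (simp add: frobenius_L2)
qed

text \<open>Two majorities meet. Good estimates are within 2 r of each other, so some index
  qualifies. Whichever one is selected, a good estimate is among its neighbours, and the distances 2
  r and r add up to 3 r.\<close>

lemma select_majority_close:
  assumes Ms: "set Ms \<subseteq> carrier_mat N N" and \<rho>: "\<rho> \<in> carrier_mat N N" and r: "0 \<le> r"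
    and good: "length Ms < 2 * length (filter (\<lambda>M. frobenius_norm (M - \<rho>) \<le> r) Ms)"
  shows "\<exists>M. select_majority (4 * r\<^sup>2) Ms = Some M \<and> M \<in> carrier_mat N N \<and> frobenius_norm (M - \<rho>) \<le> 3 * r"
proof -
  define S where "S = {j. j < length Ms \<and> frobenius_norm (Ms ! j - \<rho>) \<le> r}"
  define R where "R i = {j. j < length Ms \<and> (frobenius_norm (Ms ! j - Ms ! i))\<^sup>2 \<le> 4 * r\<^sup>2}" for i
  have c: "Ms ! j \<in> carrier_mat N N" if "j < length Ms" for j using Ms that nth_mem by blast
  have S: "length Ms < 2 * card S" using good by (simp add: S_def length_filter_conv_card)
  have sq: "a\<^sup>2 \<le> 4 * r\<^sup>2 \<longleftrightarrow> a \<le> 2 * r" if "0 \<le> a" for a :: real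
    using power_mono_iff[of a "2 * r" 2] that r by (simp add: power_mult_distrib)
  have "S \<noteq> {}" using S by auto
  then obtain i where i: "i \<in> S" by blast
  have "S \<subseteq> R i"
  proof
    fix j assume j: "j \<in> S"
    have "frobenius_norm (Ms ! j - Ms ! i) \<le> frobenius_norm (Ms ! j - \<rho>) + frobenius_norm (\<rho> - Ms ! i)"
      using i j by (intro frobenius_triangle[of _ N] c \<rho>) (auto simp: S_def)
    also have "\<dots> \<le> 2 * r" using i j frobenius_commute[OF \<rho> c[of i]] by (auto simp: S_def)
    finally show "j \<in> R i" using j by (simp add: R_def S_def sq)
  qed
  then have "card S \<le> card (R i)" by (intro card_mono) (auto simp: R_def)
  then have "in_majority (4 * r\<^sup>2) Ms i" using S i by (simp add: in_majority_def R_def S_def)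
  then have ex: "\<exists>i. in_majority (4 * r\<^sup>2) Ms i" ..
  define k where "k = (SOME i. in_majority (4 * r\<^sup>2) Ms i)"
  have k: "in_majority (4 * r\<^sup>2) Ms k" unfolding k_def by (rule someI_ex[OF ex])
  then have kl: "k < length Ms" and kR: "length Ms < 2 * card (R k)" by (auto simp: in_majority_def R_def)
  have "card (S \<union> R k) \<le> card {..<length Ms}" by (intro card_mono) (auto simp: S_def R_def)
  moreover have "card S + card (R k) = card (S \<union> R k) + card (S \<inter> R k)"
    by (rule card_Un_Int) (auto simp: S_def R_def)
  ultimately have "0 < card (S \<inter> R k)" using S kR by simp
  then obtain j where j: "j \<in> S" "j \<in> R k" by (auto simp: card_gt_0_iff)
  have "frobenius_norm (Ms ! k - \<rho>) \<le> frobenius_norm (Ms ! k - Ms ! j) + frobenius_norm (Ms ! j - \<rho>)"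
    using j kl by (intro frobenius_triangle[of _ N] c \<rho>) (auto simp: S_def)
  also have "\<dots> \<le> 3 * r"
    using j frobenius_commute[OF c[OF kl] c[of j]] by (auto simp: S_def R_def sq)
  finally show ?thesis using ex c[OF kl] by (auto simp: select_majority_def k_def)
qed

text \<open>The expectation in \<open>tomography_procedure\<close> is a Bochner integral, which is 0
  for functions that are not integrable. Finite support, inherited from the finitely many measured
  strings, makes the squared error integrable, so that a bound on its expectation is
  meaningful.\<close>

lemma tomography_finite_support:
  assumes "tomography_procedure T" "1 \<le> s" "1 \<le> N" "density_matrix N \<rho>"
  shows "finite (set_pmf (T s N \<rho>))"
proof -
  from conjunct2[OF assms(1)[unfolded tomography_procedure_def]]
  obtain C r and dec :: "nat \<Rightarrow> nat \<Rightarrow> bool list \<Rightarrow> complex mat" where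
    "\<forall>s N. 1 \<le> s \<longrightarrow> 1 \<le> N \<longrightarrow>
           inputs (C [s, N]) = s * N\<^sup>2 * qubits_for N \<and> r s N \<le> width (C [s, N]) \<and>
           (\<forall>\<rho> M. density_matrix N \<rho> \<longrightarrow>
              pmf (T s N \<rho>) M =
                (\<Sum>bs | bs \<in> bits (r s N) \<and> dec s N bs = M.
                   outcome_prob (C [s, N]) (tensor_list (replicate (s * N\<^sup>2) (store N \<rho>))) bs))"
    by (elim exE conjE) (rule that)
  then have *: "\<And>M. pmf (T s N \<rho>) M = (\<Sum>bs | bs \<in> bits (r s N) \<and> dec s N bs = M.
                   outcome_prob (C [s, N]) (tensor_list (replicate (s * N\<^sup>2) (store N \<rho>))) bs)"
    using assms(2-4) by blast
  have "set_pmf (T s N \<rho>) \<subseteq> dec s N ` bits (r s N)"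
  proof
    fix M assume "M \<in> set_pmf (T s N \<rho>)"
    then have "{bs. bs \<in> bits (r s N) \<and> dec s N bs = M} \<noteq> {}"
      using *[of M] by (auto simp: set_pmf_iff simp del: Collect_empty_eq)
    then show "M \<in> dec s N ` bits (r s N)" by auto
  qed
  then show ?thesis by (rule finite_subset) simp
qed

text \<open>The squared error is cut off at four times its guaranteed mean. The resulting 1 / 4 lies
  far enough below 1 / 2 for a majority of the runs to succeed.\<close>

lemma tomography_markov:
  assumes T: "tomography_procedure T" and s: "1 \<le> s" and N: "1 \<le> N" and \<rho>: "density_matrix N \<rho>"
    and r: "0 < r" "4 * (real N / real s) = r\<^sup>2"
  shows "measure_pmf.prob (T s N \<rho>) {M. \<not> frobenius_norm (M - \<rho>) \<le> r} \<le> 1 / 4"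
proof -
  let ?p = "T s N \<rho>" and ?f = "\<lambda>M. (frobenius_norm (M - \<rho>))\<^sup>2"
  have int: "integrable (measure_pmf ?p) ?f" "integrable (measure_pmf ?p) (\<lambda>M. ?f M / r\<^sup>2)"
    by (rule integrable_measure_pmf_finite[OF tomography_finite_support[OF T s N \<rho>]])+
  have "measure_pmf.prob ?p {M. \<not> frobenius_norm (M - \<rho>) \<le> r} = measure_pmf.expectation ?p (indicator {M. \<not> frobenius_norm (M - \<rho>) \<le> r})"
    by simp
  also have "\<dots> \<le> measure_pmf.expectation ?p (\<lambda>M. ?f M / r\<^sup>2)"
  proof (rule integral_mono[OF _ int(2)])
    fix M show "indicator {M. \<not> frobenius_norm (M - \<rho>) \<le> r} M \<le> ?f M / r\<^sup>2"
      using r power_mono[of r "frobenius_norm (M - \<rho>)" 2] by (auto simp: indicator_def field_simps)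
  qed simp
  also have "\<dots> = measure_pmf.expectation ?p ?f / r\<^sup>2" by simp
  also have "\<dots> \<le> (real N / real s) / r\<^sup>2"
    using T s N \<rho> unfolding tomography_procedure_def by (intro divide_right_mono) auto
  also have "\<dots> = 1 / 4" unfolding r(2)[symmetric] using s N by simp
  finally show ?thesis .
qed

text \<open>Origin of 1 / 27: as N / s = 1 / 3 ^ 8, a single run on 4 s N^2 copies has an error
  above 1 / 81 with probability at most 1 / 4, and the majority choice triples the error. Two such
  estimates differ by at most 2 / 27, whose square is the 4 / 729 in \<open>verify\<close>, and 2 /
  27 + 1 / 27 is its threshold 1 / 9.\<close>

definition close_estimate :: "nat \<Rightarrow> complex mat \<Rightarrow> complex mat option \<Rightarrow> bool" where
  "close_estimate l \<rho> Mo \<longleftrightarrow> (\<exists>M. Mo = Some M \<and> M \<in> carrier_mat (2 ^ (out_len l + 1)) (2 ^ (out_len l + 1))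
     \<and> frobenius_norm (M - \<rho>) \<le> 1 / 27)"

lemma tomography_close:
  assumes T: "tomography_procedure T" and \<rho>: "density_matrix (2 ^ (out_len l + 1)) \<rho>"
  shows "measure_pmf.prob (tomography T l \<rho>) {Mo. \<not> close_estimate l \<rho> Mo} \<le> (7 / 8) ^ l"
proof -
  define N :: nat where "N = 2 ^ (out_len l + 1)"
  define s :: nat where "s = 3 ^ 8 * N"
  have N: "1 \<le> N" and s: "1 \<le> 4 * s" by (auto simp: N_def s_def)
  have rs: "real N / real s = 1 / 3 ^ 8" using N by (simp add: s_def)
  note \<rho>' = \<rho>[folded N_def]
  have \<rho>c: "\<rho> \<in> carrier_mat N N" using \<rho>' by (simp add: density_matrix_def)
  let ?Q = "\<lambda>M. frobenius_norm (M - \<rho>) \<le> 1 / 81" and ?p = "replicate_pmf l (T (4 * s) N \<rho>)"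
  \<comment> \<open>Half of \<open>l\<close>, rounded up: with fewer than \<open>m\<close> failures
    the successes are a strict majority for either parity of \<open>l\<close>.\<close>
  define m where "m = (l + 1) div 2"
  have mk: "measure_pmf.prob (T (4 * s) N \<rho>) {M. \<not> ?Q M} \<le> 1 / 4"
  proof (rule tomography_markov[OF T s N \<rho>'])
    show "4 * (real N / real (4 * s)) = (1 / 81)\<^sup>2" using rs by (simp add: power2_eq_square)
  qed simp
  have tom: "tomography T l \<rho> = map_pmf (select_majority (4 * (1 / 81)\<^sup>2)) ?p"
  proof -
    have "4 * real N / real s = 4 * (1 / 81)\<^sup>2" using rs by (simp add: power2_eq_square)
    then show ?thesis
      unfolding tomography_def tomography_imp_def N_def[symmetric] s_def[symmetric] by (simp only:)
  qed
  have "measure_pmf.prob (tomography T l \<rho>) {Mo. \<not> close_estimate l \<rho> Mo}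
     = measure_pmf.prob ?p {Ms. \<not> close_estimate l \<rho> (select_majority (4 * (1 / 81)\<^sup>2) Ms)}"
    by (simp add: tom vimage_def)
  also have "\<dots> \<le> measure_pmf.prob ?p {Ms. m \<le> length (filter (\<lambda>M. \<not> ?Q M) Ms)}"
  proof (rule measure_pmf.finite_measure_mono_AE)
    show "AE Ms in measure_pmf ?p. Ms \<in> {Ms. \<not> close_estimate l \<rho> (select_majority (4 * (1 / 81)\<^sup>2) Ms)}
       \<longrightarrow> Ms \<in> {Ms. m \<le> length (filter (\<lambda>M. \<not> ?Q M) Ms)}"
      unfolding AE_measure_pmf_iff
    proof (intro ballI impI, rule ccontr)
      fix Ms assume Ms: "Ms \<in> set_pmf ?p"
        and bad: "Ms \<in> {Ms. \<not> close_estimate l \<rho> (select_majority (4 * (1 / 81)\<^sup>2) Ms)}"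
        and "Ms \<notin> {Ms. m \<le> length (filter (\<lambda>M. \<not> ?Q M) Ms)}"
      then have few: "length (filter (\<lambda>M. \<not> ?Q M) Ms) < m" by simp
      have "set_pmf (T (4 * s) N \<rho>) \<subseteq> carrier_mat N N"
        using T s N \<rho>' unfolding tomography_procedure_def by blast
      then have len: "length Ms = l" and c: "set Ms \<subseteq> carrier_mat N N"
        using Ms by (auto simp: set_replicate_pmf)
      have "length (filter ?Q Ms) + length (filter (\<lambda>M. \<not> ?Q M) Ms) = l"
        using sum_length_filter_compl[of ?Q Ms] len by simp
      then have "length Ms < 2 * length (filter ?Q Ms)" using few len by (simp add: m_def)
      from select_majority_close[OF c \<rho>c _ this] bad show False
        by (auto simp: close_estimate_def N_def)
    qed
  qed simp
  also have "\<dots> \<le> (3 / 2) ^ l / 3 ^ m" by (rule prob_failures[OF mk])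
  also have "\<dots> \<le> (7 / 8) ^ l"
  proof -
    \<comment> \<open>The true rate is (3 / 2) / sqrt 3, slightly below 7 / 8. The rational 12 / 7 =
      (3 / 2) / (7 / 8) stands in for sqrt 3, its square 144 / 49 being less than 3.\<close>
    have "((12 / 7) ^ l)\<^sup>2 = ((12 / 7)\<^sup>2 :: real) ^ l" by (simp add: power_mult[symmetric] mult.commute)
    also have "\<dots> \<le> 3 ^ l" by (intro power_mono) (auto simp: power2_eq_square)
    also have "\<dots> \<le> 3 ^ (2 * m)" by (intro power_increasing) (auto simp: m_def)
    also have "\<dots> = (3 ^ m)\<^sup>2" by (simp add: power_mult[symmetric] mult.commute)
    finally have "(12 / 7) ^ l \<le> (3 ^ m :: real)" by (rule power2_le_imp_le) simp
    then have "(7 / 8) ^ l * (12 / 7) ^ l \<le> (7 / 8) ^ l * (3 ^ m :: real)" by (intro mult_left_mono) auto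
    moreover have "(7 / 8) ^ l * (12 / 7) ^ l = (3 / 2 :: real) ^ l" by (simp flip: power_mult_distrib)
    ultimately show ?thesis by (simp add: divide_le_eq)
  qed
  finally show ?thesis .
qed

lemma verify_accepts:
  assumes T: "tomography_procedure T" and \<rho>: "density_matrix (2 ^ (out_len l + 1)) \<rho>"
    and b: "pure_state (2 ^ (out_len l + 1)) b" and small: "Re ((\<rho> *\<^sub>v b) \<bullet>c b) \<le> 2 / 27"
    and Mo: "close_estimate l \<rho> Mo"
  shows "measure_pmf.prob (verify T b l \<rho> Mo) {v. \<not> v} \<le> (7 / 8) ^ l"
proof -
  let ?N = "2 ^ (out_len l + 1)"
  obtain M where M: "Mo = Some M" "M \<in> carrier_mat ?N ?N" "frobenius_norm (M - \<rho>) \<le> 1 / 27"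
    using Mo by (auto simp: close_estimate_def)
  have \<rho>c: "\<rho> \<in> carrier_mat ?N ?N" using \<rho> by (simp add: density_matrix_def)
  note bc = pure_stateD(1)[OF b]
  have "(M *\<^sub>v b) \<bullet>c b = (\<rho> *\<^sub>v b) \<bullet>c b + ((M - \<rho>) *\<^sub>v b) \<bullet>c b"
    using mat_vec_inner[OF M(2) bc bc] mat_vec_inner[OF \<rho>c bc bc] mat_vec_inner[OF minus_carrier_mat[OF \<rho>c, of M] bc bc] M(2) \<rho>c
    by (simp add: algebra_simps sum_subtractf)
  moreover have "Re (((M - \<rho>) *\<^sub>v b) \<bullet>c b) \<le> 1 / 27"
    using frobenius_inner[OF minus_carrier_mat[OF \<rho>c, of M] b] complex_Re_le_cmod M(3) by (meson order_trans)
  ultimately have inner: "Re ((M *\<^sub>v b) \<bullet>c b) \<le> 1 / 9" using small by simp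
  have dist: "(frobenius_norm (M - M'))\<^sup>2 \<le> 4 / 729" if "M' \<in> carrier_mat ?N ?N" "frobenius_norm (M' - \<rho>) \<le> 1 / 27" for M'
  proof -
    have "frobenius_norm (M - M') \<le> frobenius_norm (M - \<rho>) + frobenius_norm (\<rho> - M')"
      by (intro frobenius_triangle[of _ ?N] M(2) that \<rho>c)
    also have "\<dots> \<le> 2 / 27" using frobenius_commute[OF \<rho>c that(1)] that(2) M(3) by simp
    finally have "(frobenius_norm (M - M'))\<^sup>2 \<le> (2 / 27)\<^sup>2" by (intro power_mono) auto
    then show ?thesis by (simp add: power2_eq_square)
  qed
  \<comment> \<open>\<open>M\<close> is fixed and accurate by now, so only an inaccurate estimate of
    the receiver can cause rejection.\<close>
  have "measure_pmf.prob (verify T b l \<rho> Mo) {v. \<not> v} \<le> measure_pmf.prob (tomography T l \<rho>) {Mo. \<not> close_estimate l \<rho> Mo}"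
    unfolding verify_def measure_map_pmf
    by (intro measure_pmf.finite_measure_mono) (use M(1) inner dist in \<open>auto simp: close_estimate_def split: option.splits\<close>)
  then show ?thesis using tomography_close[OF T \<rho>] by simp
qed


section \<open>Pauli operators and the honest execution\<close>

lemma mat_eq_entryI:
  assumes "A \<in> carrier_mat (2 ^ (p + q)) (2 ^ (p + q))" "B \<in> carrier_mat (2 ^ (p + q)) (2 ^ (p + q))"
    and "\<And>u v u' v'. u \<in> bits p \<Longrightarrow> v \<in> bits q \<Longrightarrow> u' \<in> bits p \<Longrightarrow> v' \<in> bits q \<Longrightarrow>
      entry A (u @ v) (u' @ v') = entry B (u @ v) (u' @ v')"
  shows "A = B"
proof (rule eq_matI)
  fix i j assume "i < dim_row B" "j < dim_col B"
  then have ij: "i < 2 ^ (p + q)" "j < 2 ^ (p + q)" using assms(2) by auto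
  have split: "\<exists>u\<in>bits p. \<exists>v\<in>bits q. i = index_of_bits (u @ v)" if "i < 2 ^ (p + q)" for i
  proof -
    let ?w = "bits_of_index (p + q) i"
    have "take p ?w \<in> bits p" "drop p ?w \<in> bits q" by (auto simp: bits_def)
    moreover have "i = index_of_bits (take p ?w @ drop p ?w)" using index_of_bits_of_index[OF that] by simp
    ultimately show ?thesis by blast
  qed
  obtain u v u' v' where "u \<in> bits p" "v \<in> bits q" "i = index_of_bits (u @ v)"
    "u' \<in> bits p" "v' \<in> bits q" "j = index_of_bits (u' @ v')" using split[OF ij(1)] split[OF ij(2)] by blast
  then show "A $$ (i, j) = B $$ (i, j)" using assms(3)[of u v u' v'] by (simp add: entry_def)
qed (use assms in auto)

lemma tensor_adjoint:
  assumes "A \<in> carrier_mat (2 ^ p) (2 ^ p)" "B \<in> carrier_mat (2 ^ q) (2 ^ q)"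
  shows "mat_adjoint (A \<Otimes> B) = mat_adjoint A \<Otimes> mat_adjoint B"
proof (rule mat_eq_entryI[of _ p q])
  note c = tensor_carrier[OF assms, folded power_add]
  show "mat_adjoint (A \<Otimes> B) \<in> carrier_mat (2 ^ (p + q)) (2 ^ (p + q))" using c by simp
  show "mat_adjoint A \<Otimes> mat_adjoint B \<in> carrier_mat (2 ^ (p + q)) (2 ^ (p + q))"
    using tensor_carrier[OF mat_adjoint_carrier[OF assms(1)] mat_adjoint_carrier[OF assms(2)]] by (simp add: power_add)
  fix u v u' v' assume *: "u \<in> bits p" "v \<in> bits q" "u' \<in> bits p" "v' \<in> bits q"
  show "entry (mat_adjoint (A \<Otimes> B)) (u @ v) (u' @ v') = entry (mat_adjoint A \<Otimes> mat_adjoint B) (u @ v) (u' @ v')"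
    unfolding entry_adjoint[OF c append_in_bits[OF *(1,2)] append_in_bits[OF *(3,4)]]
      entry_tensor[OF assms *(3,4,1,2)]
      entry_tensor[OF mat_adjoint_carrier[OF assms(1)] mat_adjoint_carrier[OF assms(2)] *]
      entry_adjoint[OF assms(1) *(1,3)] entry_adjoint[OF assms(2) *(2,4)] by simp
qed

lemma tensor_mult:
  assumes A: "A \<in> carrier_mat (2 ^ p) (2 ^ p)" and B: "B \<in> carrier_mat (2 ^ q) (2 ^ q)"
    and C: "C \<in> carrier_mat (2 ^ p) (2 ^ p)" and D: "D \<in> carrier_mat (2 ^ q) (2 ^ q)"
  shows "(A \<Otimes> B) * (C \<Otimes> D) = (A * C) \<Otimes> (B * D)"
proof (rule mat_eq_entryI[of _ p q])
  note AB = tensor_carrier[OF A B, folded power_add] and CD = tensor_carrier[OF C D, folded power_add]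
    and AC = mult_carrier_mat[OF A C] and BD = mult_carrier_mat[OF B D]
  show "(A \<Otimes> B) * (C \<Otimes> D) \<in> carrier_mat (2 ^ (p + q)) (2 ^ (p + q))" by (rule mult_carrier_mat[OF AB CD])
  show "(A * C) \<Otimes> (B * D) \<in> carrier_mat (2 ^ (p + q)) (2 ^ (p + q))"
    by (rule tensor_carrier[OF AC BD, folded power_add])
  fix u v u' v' assume *: "u \<in> bits p" "v \<in> bits q" "u' \<in> bits p" "v' \<in> bits q"
  have "entry ((A \<Otimes> B) * (C \<Otimes> D)) (u @ v) (u' @ v')
     = (\<Sum>a\<in>bits p. \<Sum>b\<in>bits q. (entry A u a * entry B v b) * (entry C a u' * entry D b v'))"
    unfolding entry_mult[OF AB CD append_in_bits[OF *(1,2)] append_in_bits[OF *(3,4)]] sum_bits_add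
    by (intro sum.cong refl arg_cong2[where f = "(*)"] entry_tensor[OF A B *(1,2)] entry_tensor[OF C D _ _ *(3,4)])
  also have "\<dots> = (\<Sum>a\<in>bits p. \<Sum>b\<in>bits q. (entry A u a * entry C a u') * (entry B v b * entry D b v'))"
    by (intro sum.cong refl) (simp only: mult_ac)
  also have "\<dots> = entry (A * C) u u' * entry (B * D) v v'"
    unfolding entry_mult[OF A C *(1,3)] entry_mult[OF B D *(2,4)] by (rule sum_product[symmetric])
  also have "\<dots> = entry ((A * C) \<Otimes> (B * D)) (u @ v) (u' @ v')" by (rule entry_tensor[OF AC BD *, symmetric])
  finally show "entry ((A \<Otimes> B) * (C \<Otimes> D)) (u @ v) (u' @ v') = entry ((A * C) \<Otimes> (B * D)) (u @ v) (u' @ v')" .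
qed

lemma tensor_one: "(1\<^sub>m (2 ^ p) :: complex mat) \<Otimes> 1\<^sub>m (2 ^ q) = 1\<^sub>m (2 ^ (p + q))"
proof (rule mat_eq_entryI[of _ p q])
  show "1\<^sub>m (2 ^ p) \<Otimes> 1\<^sub>m (2 ^ q) \<in> carrier_mat (2 ^ (p + q)) (2 ^ (p + q))"
    using tensor_carrier[of "1\<^sub>m (2 ^ p)" "2 ^ p" "2 ^ p" "1\<^sub>m (2 ^ q)" "2 ^ q" "2 ^ q"] by (simp add: power_add)
  fix u v u' v' assume *: "u \<in> bits p" "v \<in> bits q" "u' \<in> bits p" "v' \<in> bits q"
  then have "u @ v = u' @ v' \<longleftrightarrow> u = u' \<and> v = v'" by (auto simp: bits_def)
  then show "entry (1\<^sub>m (2 ^ p) \<Otimes> 1\<^sub>m (2 ^ q)) (u @ v) (u' @ v') = entry (1\<^sub>m (2 ^ (p + q))) (u @ v) (u' @ v')"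
    unfolding entry_tensor[OF one_carrier_mat one_carrier_mat *] entry_one[OF *(1,3)] entry_one[OF *(2,4)]
      entry_one[OF append_in_bits[OF *(1,2)] append_in_bits[OF *(3,4)]] by simp
qed simp

text \<open>Hermitian and involutory, hence unitary. The property passes to tensor products and to
  the powers 0 and 1, and it makes the sandwich in \<open>Phi\<close>, which is written without an
  adjoint, a unitary conjugation.\<close>

definition self_inverse_observable :: "nat \<Rightarrow> complex mat \<Rightarrow> bool" where
  "self_inverse_observable N Q \<longleftrightarrow> Q \<in> carrier_mat N N \<and> mat_adjoint Q = Q \<and> Q * Q = 1\<^sub>m N"

lemma index_mult_square:
  "A \<in> carrier_mat N N \<Longrightarrow> B \<in> carrier_mat N N \<Longrightarrow> i < N \<Longrightarrow> j < N \<Longrightarrow>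
   (A * B) $$ (i, j) = (\<Sum>k<N. A $$ (i, k) * B $$ (k, j))"
  by (simp add: scalar_prod_def atLeast0LessThan)

lemma pauli_observable:
  assumes "Q \<in> pauli_set" shows "self_inverse_observable 2 Q"
proof -
  have c: "Q \<in> carrier_mat 2 2" using assms by (auto simp: pauli_set_def mat_of_rows_list_def)
  have "mat_adjoint Q = Q"
  proof (rule eq_matI)
    fix i j assume "i < dim_row Q" "j < dim_col Q"
    then have ij: "i < 2" "j < 2" using c by auto
    then have "mat_adjoint Q $$ (i, j) = cnj (Q $$ (j, i))" using c by simp
    also have "\<dots> = Q $$ (i, j)"
      using assms ij by (auto simp: pauli_set_def mat_of_rows_list_def less_2_cases_iff)
    finally show "mat_adjoint Q $$ (i, j) = Q $$ (i, j)" .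
  qed (use c in auto)
  moreover have "Q * Q = 1\<^sub>m 2"
  proof (rule eq_matI)
    fix i j assume "i < dim_row (1\<^sub>m 2 :: complex mat)" "j < dim_col (1\<^sub>m 2 :: complex mat)"
    then have ij: "i < 2" "j < 2" by auto
    have "(Q * Q) $$ (i, j) = Q $$ (i, 0) * Q $$ (0, j) + Q $$ (i, 1) * Q $$ (1, j)"
      using index_mult_square[OF c c ij] by (simp add: numeral_2_eq_2 lessThan_Suc add.commute)
    also have "\<dots> = 1\<^sub>m 2 $$ (i, j)"
      using assms ij by (auto simp: pauli_set_def mat_of_rows_list_def less_2_cases_iff)
    finally show "(Q * Q) $$ (i, j) = 1\<^sub>m 2 $$ (i, j)" .
  qed (use c in auto)
  ultimately show ?thesis using c by (simp add: self_inverse_observable_def)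
qed

lemma paulis_observable:
  assumes "P \<in> paulis n" shows "self_inverse_observable (2 ^ n) P"
proof -
  have "self_inverse_observable (2 ^ length Ps) (tensor_list Ps)" if "set Ps \<subseteq> pauli_set" for Ps
    using that
  proof (induction Ps)
    case Nil
    show ?case by (auto simp: self_inverse_observable_def intro!: eq_matI)
  next
    case (Cons A Ps)
    then have A: "self_inverse_observable 2 A" and B: "self_inverse_observable (2 ^ length Ps) (tensor_list Ps)"
      using pauli_observable by auto
    have Ac: "A \<in> carrier_mat (2 ^ 1) (2 ^ 1)" and Bc: "tensor_list Ps \<in> carrier_mat (2 ^ length Ps) (2 ^ length Ps)"
      using A B by (auto simp: self_inverse_observable_def)
    show ?case
      using tensor_carrier[OF Ac Bc] tensor_adjoint[OF Ac Bc] tensor_mult[OF Ac Bc Ac Bc] tensor_one[of 1 "length Ps"] A B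
      by (simp add: self_inverse_observable_def tensor_list_Cons)
  qed
  then show ?thesis using assms by (auto simp: paulis_def)
qed

lemma observable_power:
  assumes "self_inverse_observable N P" "b \<in> {0, 1 :: nat}"
  shows "self_inverse_observable N (P ^\<^sub>m b)"
  using assms by (auto simp: self_inverse_observable_def intro!: eq_matI)

lemma observable_pure:
  assumes Q: "self_inverse_observable N Q" and v: "pure_state N v"
  shows "pure_state N (Q *\<^sub>v v)"
proof -
  have Qc: "Q \<in> carrier_mat N N" and adj: "mat_adjoint Q = Q" and sq: "Q * Q = 1\<^sub>m N"
    using Q by (auto simp: self_inverse_observable_def)
  note vc = pure_stateD(1)[OF v]
  have Qv: "Q *\<^sub>v v \<in> carrier_vec N" using Qc vc by simp
  have herm: "cnj (Q $$ (i, j)) = Q $$ (j, i)" if "i < N" "j < N" for i j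
    using arg_cong[OF adj, of "\<lambda>A. A $$ (j, i)"] Qc that by simp
  have "(Q *\<^sub>v v) \<bullet>c (Q *\<^sub>v v) = (\<Sum>i<N. \<Sum>j<N. Q $$ (i, j) * v $ j * cnj ((Q *\<^sub>v v) $ i))"
    by (rule mat_vec_inner[OF Qc vc Qv])
  also have "\<dots> = (\<Sum>j<N. v $ j * cnj (\<Sum>i<N. Q $$ (j, i) * (Q *\<^sub>v v) $ i))"
    by (subst sum.swap) (simp add: herm sum_distrib_left mult_ac)
  also have "\<dots> = v \<bullet>c (Q *\<^sub>v (Q *\<^sub>v v))"
    using Qc Qv by (simp add: cscalar_prod_eq[where N = N] mult_mat_vec_def scalar_prod_def atLeast0LessThan)
  also have "Q *\<^sub>v (Q *\<^sub>v v) = v"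
    using assoc_mult_mat_vec[OF Qc Qc vc] sq vc by simp
  finally show ?thesis using Qv pure_stateD(2)[OF v] by (simp add: pure_state_def)
qed

text \<open>As \<open>U\<close> is Hermitian, the right factor acts as its adjoint.\<close>

lemma conj_outer:
  assumes U: "U \<in> carrier_mat N N" "mat_adjoint U = U" and v: "v \<in> carrier_vec N"
  shows "U * outer v * U = outer (U *\<^sub>v v)"
proof (rule eq_matI)
  fix i j assume "i < dim_row (outer (U *\<^sub>v v))" "j < dim_col (outer (U *\<^sub>v v))"
  then have ij: "i < N" "j < N" using U by (auto simp: outer_def)
  have herm: "cnj (U $$ (i, j)) = U $$ (j, i)" if "i < N" "j < N" for i j
    using arg_cong[OF U(2), of "\<lambda>A. A $$ (j, i)"] U(1) that by simp
  have Uv: "(U *\<^sub>v v) $ i = (\<Sum>j<N. U $$ (i, j) * v $ j)" if "i < N" for i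
    using U(1) v that by (simp add: scalar_prod_def atLeast0LessThan)
  have "(U * outer v * U) $$ (i, j) = (\<Sum>k<N. (\<Sum>m<N. U $$ (i, m) * outer v $$ (m, k)) * U $$ (k, j))"
    unfolding index_mult_square[OF mult_carrier_mat[OF U(1) outer_carrier[OF v]] U(1) ij]
    by (intro sum.cong refl arg_cong2[where f = "(*)"] index_mult_square[OF U(1) outer_carrier[OF v] ij(1)]) simp
  also have "\<dots> = (\<Sum>k<N. (U *\<^sub>v v) $ i * cnj (U $$ (j, k) * v $ k))"
    using ij by (intro sum.cong refl) (simp add: Uv index_outer[OF v] herm sum_distrib_right sum_distrib_left mult_ac)
  also have "\<dots> = (U *\<^sub>v v) $ i * cnj ((U *\<^sub>v v) $ j)"
    by (simp add: Uv[OF ij(2)] sum_distrib_left)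
  also have "\<dots> = outer (U *\<^sub>v v) $$ (i, j)" using U(1) ij by (simp add: outer_def)
  finally show "(U * outer v * U) $$ (i, j) = outer (U *\<^sub>v v) $$ (i, j)" .
qed (use U v in \<open>auto simp: outer_def\<close>)

lemma conj_mix:
  assumes U: "U \<in> carrier_mat N N" "mat_adjoint U = U" and v: "v \<in> carrier_vec N" and w: "w \<in> carrier_vec N"
  shows "U * mix \<eta> v w * U = mix \<eta> (U *\<^sub>v v) (U *\<^sub>v w)"
proof -
  note o = outer_carrier[OF v] outer_carrier[OF w]
  have "U * mix \<eta> v w = complex_of_real \<eta> \<cdot>\<^sub>m (U * outer v) + complex_of_real (1 - \<eta>) \<cdot>\<^sub>m (U * outer w)"
    unfolding mix_def using U(1) o
    by (simp add: mult_add_distrib_mat[where nc = N] mult_smult_distrib[OF U(1)] del: of_real_diff)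
  also have "\<dots> * U = complex_of_real \<eta> \<cdot>\<^sub>m (U * outer v * U) + complex_of_real (1 - \<eta>) \<cdot>\<^sub>m (U * outer w * U)"
    unfolding add_mult_distrib_mat[OF smult_carrier_mat[OF mult_carrier_mat[OF U(1) o(1)]]
        smult_carrier_mat[OF mult_carrier_mat[OF U(1) o(2)]] U(1)]
      mult_smult_assoc_mat[OF mult_carrier_mat[OF U(1) o(1)] U(1)]
      mult_smult_assoc_mat[OF mult_carrier_mat[OF U(1) o(2)] U(1)] ..
  finally show ?thesis by (simp add: conj_outer[OF U v] conj_outer[OF U w] mix_def)
qed

section \<open>Splitting off the flag qubit\<close>

lemma sum_half_split: "(\<Sum>i<2 * N. f i) = (\<Sum>b\<in>UNIV. \<Sum>i<N. f (i + of_bool b * N))" for f :: "nat \<Rightarrow> complex"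
proof -
  have "(\<Sum>i<2 * N. f i) = (\<Sum>i<N. f i) + (\<Sum>i<N. f (i + N))"
    using sum.atLeastLessThan_concat[of 0 N "N + N" f] sum.shift_bounds_nat_ivl[of f 0 N N]
    by (simp only: atLeast0LessThan mult_2 add_0 le_add1 zero_le)
  then show ?thesis by (simp add: UNIV_bool)
qed

lemma ket_tensor_carrier: "v \<in> carrier_vec N \<Longrightarrow> tensor_vec (ket [c]) v \<in> carrier_vec (2 * N)"
  by (intro carrier_vecI) (simp add: ket_def)

lemma inner_ket_tensor:
  assumes "v \<in> carrier_vec N" "w \<in> carrier_vec N"
  shows "tensor_vec (ket [c]) v \<bullet>c tensor_vec (ket [c']) w = of_bool (c = c') * (v \<bullet>c w)"
  unfolding cscalar_prod_eq[OF ket_tensor_carrier[OF assms(2)]] sum_half_split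
  by (cases c; cases c') (simp_all add: UNIV_bool index_tensor_ket[OF assms(1), of _ _ True, simplified]
      index_tensor_ket[OF assms(1), of _ _ False, simplified]
      index_tensor_ket[OF assms(2), of _ _ True, simplified] index_tensor_ket[OF assms(2), of _ _ False, simplified]
      cscalar_prod_eq[OF assms(2)])

lemma one_tensor_mat_vec:
  assumes Q: "Q \<in> carrier_mat N N" and v: "v \<in> carrier_vec N"
  shows "(1\<^sub>m 2 \<Otimes> Q) *\<^sub>v tensor_vec (ket [c]) v = tensor_vec (ket [c]) (Q *\<^sub>v v)"
proof (rule eq_vecI)
  have Qv: "Q *\<^sub>v v \<in> carrier_vec N" using Q v by simp
  show "dim_vec ((1\<^sub>m 2 \<Otimes> Q) *\<^sub>v tensor_vec (ket [c]) v) = dim_vec (tensor_vec (ket [c]) (Q *\<^sub>v v))"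
    using Q by (simp add: ket_def)
  fix k assume "k < dim_vec (tensor_vec (ket [c]) (Q *\<^sub>v v))"
  then have k: "k < 2 * N" using Q by (simp add: ket_def)
  then obtain i b where i: "k = i + of_bool b * N" "i < N"
    by (cases "k < N") (auto intro: that[of k False] that[of "k - N" True])
  have ent: "(1\<^sub>m 2 \<Otimes> Q) $$ (i + of_bool b * N, j + of_bool b' * N) = of_bool (b = b') * Q $$ (i, j)"
    if "j < N" for j b'
    using Q i(2) that by (cases b; cases b') (simp_all add: index_tensor)
  have "((1\<^sub>m 2 \<Otimes> Q) *\<^sub>v tensor_vec (ket [c]) v) $ k = (\<Sum>j<2 * N. (1\<^sub>m 2 \<Otimes> Q) $$ (k, j) * tensor_vec (ket [c]) v $ j)"
    using k Q v by (simp add: scalar_prod_def atLeast0LessThan ket_def)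
  also have "\<dots> = (\<Sum>b'\<in>UNIV. \<Sum>j<N. of_bool (b = b') * Q $$ (i, j) * (of_bool (b' = c) * v $ j))"
    unfolding sum_half_split i(1)
    by (intro sum.cong refl arg_cong2[where f = "(*)"] ent index_tensor_ket[OF v]) auto
  also have "\<dots> = of_bool (b = c) * (\<Sum>j<N. Q $$ (i, j) * v $ j)"
    by (cases b; cases c) (simp_all add: UNIV_bool)
  also have "\<dots> = of_bool (b = c) * (Q *\<^sub>v v) $ i"
    using Q v i(2) by (simp add: scalar_prod_def atLeast0LessThan)
  also have "\<dots> = tensor_vec (ket [c]) (Q *\<^sub>v v) $ k"
    unfolding i(1) by (rule index_tensor_ket[OF Qv i(2), symmetric])
  finally show "((1\<^sub>m 2 \<Otimes> Q) *\<^sub>v tensor_vec (ket [c]) v) $ k = tensor_vec (ket [c]) (Q *\<^sub>v v) $ k" .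
qed

text \<open>The Pauli operator leaves the flag qubit alone. The component with flag 0 is orthogonal
  to the abort state; the other one, of weight 1 - \<eta>, is a rotated abort state, whose squared
  overlap with the original is at most 1.\<close>

lemma Phi_properties:
  assumes P: "P \<in> paulis n" and b: "b \<in> {0, 1}" and \<psi>: "pure_state (2 ^ n) \<psi>" and \<phi>: "pure_state (2 ^ n) \<phi>"
    and \<eta>: "0 \<le> \<eta>" "\<eta> \<le> 1" and G: "Ghat l k x = mix \<eta> (tensor_vec (ket [False]) \<psi>) (bot_state \<phi>)"
  shows "density_matrix (2 ^ (n + 1)) (Phi Ghat l P k x b)"
    and "Re ((Phi Ghat l P k x b *\<^sub>v bot_state \<phi>) \<bullet>c bot_state \<phi>) \<le> 1 - \<eta>"
proof -
  let ?Q = "P ^\<^sub>m b" and ?N = "2 ^ n :: nat"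
  have Q: "self_inverse_observable ?N ?Q" by (intro observable_power paulis_observable P b)
  then have Qc: "?Q \<in> carrier_mat ?N ?N" and Qh: "mat_adjoint ?Q = ?Q" by (auto simp: self_inverse_observable_def)
  let ?U = "1\<^sub>m 2 \<Otimes> ?Q"
  have U: "?U \<in> carrier_mat (2 * ?N) (2 * ?N)" by (rule tensor_carrier[OF one_carrier_mat Qc])
  have "mat_adjoint (1\<^sub>m 2 :: complex mat) = 1\<^sub>m 2" by (rule eq_matI) auto
  then have Uh: "mat_adjoint ?U = ?U"
    using tensor_adjoint[of "1\<^sub>m 2" 1 ?Q n] Qc Qh by simp
  note c = pure_stateD(1)[OF \<psi>] pure_stateD(1)[OF \<phi>]
  have Phi: "Phi Ghat l P k x b = mix \<eta> (tensor_vec (ket [False]) (?Q *\<^sub>v \<psi>)) (tensor_vec (ket [True]) (?Q *\<^sub>v \<phi>))"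
    unfolding Phi_def G bot_state_def conj_mix[OF U Uh ket_tensor_carrier[OF c(1)] ket_tensor_carrier[OF c(2)]]
      one_tensor_mat_vec[OF Qc c(1)] one_tensor_mat_vec[OF Qc c(2)] ..
  note pure = observable_pure[OF Q \<psi>] observable_pure[OF Q \<phi>]
  show "density_matrix (2 ^ (n + 1)) (Phi Ghat l P k x b)"
    unfolding Phi by (intro density_mix pure_ket_tensor pure \<eta>)
  note pc = pure_stateD(1)[OF pure(1)] pure_stateD(1)[OF pure(2)]
  have "Re ((Phi Ghat l P k x b *\<^sub>v bot_state \<phi>) \<bullet>c bot_state \<phi>) = (1 - \<eta>) * (cmod ((?Q *\<^sub>v \<phi>) \<bullet>c \<phi>))\<^sup>2"
    unfolding Phi bot_state_def mix_inner[OF ket_tensor_carrier[OF pc(1)] ket_tensor_carrier[OF pc(2)] ket_tensor_carrier[OF c(2)]]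
      inner_ket_tensor[OF pc(1) c(2)] inner_ket_tensor[OF pc(2) c(2)] by simp
  also have "\<dots> \<le> (1 - \<eta>) * 1"
    using \<eta> pure_inner_le_1[OF pure(2) \<phi>] by (intro mult_left_mono power_le_one) auto
  finally show "Re ((Phi Ghat l P k x b *\<^sub>v bot_state \<phi>) \<bullet>c bot_state \<phi>) \<le> 1 - \<eta>" by simp
qed

lemma finite_paulis: "finite (paulis n)" and paulis_nonempty: "paulis n \<noteq> {}"
proof -
  have "paulis n = tensor_list ` {Ps. set Ps \<subseteq> pauli_set \<and> length Ps = n}" by (auto simp: paulis_def)
  moreover have "finite pauli_set" by (simp add: pauli_set_def)
  ultimately show "finite (paulis n)" by (simp add: finite_lists_length_eq)
  have "tensor_list (replicate n (mat_of_rows_list 2 [[1, 0], [0, 1]])) \<in> paulis n"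
    by (auto simp: paulis_def pauli_set_def intro!: exI[of _ "replicate n (mat_of_rows_list 2 [[1, 0], [0, 1]])"])
  then show "paulis n \<noteq> {}" by blast
qed

lemma receiver_commit_paulis:
  assumes "P \<in> set_pmf (receiver_commit l)" "x \<in> bits (in_len l)"
  shows "P x \<in> paulis (out_len l)"
proof -
  have "P x \<in> set_pmf (map_pmf (\<lambda>f. f x) (receiver_commit l))" using assms by auto
  then show ?thesis
    using assms(2) finite_paulis paulis_nonempty
    by (simp add: receiver_commit_def Pi_pmf_component del: set_map_pmf pmf.set_map)
qed

text \<open>Markov's inequality over the uniform key for each input, then a union bound over the
  inputs.\<close>

lemma prob_key_le:
  assumes f: "\<And>k x. k \<in> bits l \<Longrightarrow> x \<in> A \<Longrightarrow> 0 \<le> f k x" and A: "finite A"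
    and avg: "\<And>x. x \<in> A \<Longrightarrow> key_avg l (\<lambda>k. f k x) \<le> \<delta>" and c: "0 < c"
  shows "measure_pmf.prob (pmf_of_set (bits l)) {k. \<not> (\<forall>x\<in>A. f k x \<le> c)} \<le> real (card A) * (\<delta> / c)"
proof -
  let ?p = "pmf_of_set (bits l)"
  have one: "measure_pmf.prob ?p {k. \<not> f k x \<le> c} \<le> \<delta> / c" if x: "x \<in> A" for x
  proof -
    have "real (card (bits l \<inter> {k. \<not> f k x \<le> c})) * c = (\<Sum>k\<in>bits l \<inter> {k. \<not> f k x \<le> c}. c)" by simp
    also have "\<dots> \<le> (\<Sum>k\<in>bits l \<inter> {k. \<not> f k x \<le> c}. f k x)" by (intro sum_mono) auto
    also have "\<dots> \<le> (\<Sum>k\<in>bits l. f k x)" using f x by (intro sum_mono2) auto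
    also have "\<dots> \<le> \<delta> * 2 ^ l" using avg[OF x] by (simp add: key_avg_def divide_le_eq)
    finally show ?thesis using c by (simp add: measure_pmf_of_set field_simps)
  qed
  have "{k. \<not> (\<forall>x\<in>A. f k x \<le> c)} = (\<Union>x\<in>A. {k. \<not> f k x \<le> c})" by auto
  then show ?thesis
    using measure_pmf.finite_measure_subadditive_finite[OF A, of "\<lambda>x. {k. \<not> f k x \<le> c}" ?p]
      sum_bounded_above[of A "\<lambda>x. measure_pmf.prob ?p {k. \<not> f k x \<le> c}" "\<delta> / c"] one by simp
qed

text \<open>Each of the 2 ^ d inputs is charged for three bad events: an abort probability above 2 /
  27, which costs 27 / 2 times \<delta> by Markov's inequality, and a failed tomography on either
  side.\<close>

lemma honest_execution_bound:
  assumes T: "tomography_procedure T" and b: "b \<in> {0, 1}"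
    and bot: "pure_state (2 ^ out_len l) (bot_hat l)"
    and mix: "\<And>k x. k \<in> bits l \<Longrightarrow> x \<in> bits (in_len l) \<Longrightarrow>
      Ghat l k x = mix (\<eta> k x) (tensor_vec (ket [False]) (\<psi> k x)) (bot_state (bot_hat l))
      \<and> 0 \<le> \<eta> k x \<and> \<eta> k x \<le> 1 \<and> pure_state (2 ^ out_len l) (\<psi> k x)"
    and \<delta>: "\<And>x. x \<in> bits (in_len l) \<Longrightarrow> key_avg l (\<lambda>k. 1 - \<eta> k x) \<le> \<delta>"
  shows "1 - pmf (honest_execution T Ghat bot_hat l b) (Some b) \<le> 2 ^ in_len l * (27 / 2 * \<delta> + 2 * (7 / 8) ^ l)"
proof -
  let ?D = "bits (in_len l)" and ?B = "{out. out \<noteq> Some b}" and ?d = "2 ^ in_len l :: real"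
  let ?good = "\<lambda>k. \<forall>x\<in>?D. 1 - \<eta> k x \<le> 2 / 27"
  define close where "close P k M \<longleftrightarrow> (\<forall>x\<in>?D. close_estimate l (Phi Ghat l (P x) k x b) (M x))" for P k M
  have bot': "pure_state (2 ^ (out_len l + 1)) (bot_state (bot_hat l))"
    unfolding bot_state_def by (rule pure_ket_tensor[OF bot])
  have Phi: "density_matrix (2 ^ (out_len l + 1)) (Phi Ghat l (P x) k x b)"
    "?good k \<Longrightarrow> Re ((Phi Ghat l (P x) k x b *\<^sub>v bot_state (bot_hat l)) \<bullet>c bot_state (bot_hat l)) \<le> 2 / 27"
    if "P \<in> set_pmf (receiver_commit l)" "k \<in> bits l" "x \<in> ?D" for P k x
    using Phi_properties[OF receiver_commit_paulis[OF that(1,3)] b _ bot, of "\<psi> k x" "\<eta> k x" Ghat l k x] mix[OF that(2,3)] that(3)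
    by (auto intro: order_trans)
  have reveal: "measure_pmf.prob (receiver_reveal T Ghat bot_hat l P M (k, b)) ?B \<le> ?d * (7 / 8) ^ l"
    if P: "P \<in> set_pmf (receiver_commit l)" and k: "k \<in> bits l" "?good k" and M: "close P k M" for P k M
  proof -
    let ?V = "Pi_pmf ?D False (\<lambda>x. verify T (bot_state (bot_hat l)) l (Phi Ghat l (P x) k x b) (M x))"
    have "measure_pmf.prob ?V {v. \<not> (\<forall>x\<in>?D. v x)} \<le> real (card ?D) * (7 / 8) ^ l"
      using M by (intro prob_Pi_pmf_union verify_accepts T Phi[OF P k(1)] bot' k(2)) (auto simp: close_def)
    moreover have "receiver_reveal T Ghat bot_hat l P M (k, b) = map_pmf (\<lambda>v. if \<forall>x\<in>?D. v x then Some b else None) ?V"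
      using b by (auto simp: receiver_reveal_def map_pmf_def)
    moreover have "(\<lambda>v. if \<forall>x\<in>?D. v x then Some b else None) -` ?B = {v. \<not> (\<forall>x\<in>?D. v x)}" by auto
    ultimately show ?thesis by simp
  qed
  have commit: "measure_pmf.prob (committer_commit T Ghat l P b) {(k, M). \<not> (k \<in> bits l \<and> ?good k \<and> close P k M)}
      \<le> ?d * (\<delta> / (2 / 27)) + ?d * (7 / 8) ^ l" (is "measure_pmf.prob _ ?C \<le> _")
    if P: "P \<in> set_pmf (receiver_commit l)" for P
    unfolding committer_commit_def
  proof (rule prob_bind_le[where Q = ?good])
    show "measure_pmf.prob (pmf_of_set (bits l)) {k. \<not> ?good k} \<le> ?d * (\<delta> / (2 / 27))"
      using prob_key_le[of l ?D "\<lambda>k x. 1 - \<eta> k x" \<delta> "2 / 27"] mix \<delta> by simp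
    fix k assume "k \<in> set_pmf (pmf_of_set (bits l))" and good: "?good k"
    then have k: "k \<in> bits l" by simp
    let ?M = "Pi_pmf ?D None (\<lambda>x. tomography T l (Phi Ghat l (P x) k x b))"
    have "measure_pmf.prob ?M {M. \<not> close P k M} \<le> real (card ?D) * (7 / 8) ^ l"
      unfolding close_def by (intro prob_Pi_pmf_union tomography_close T Phi(1)[OF P k]) auto
    moreover have "Pair k -` ?C = {M. \<not> close P k M}" using good k by auto
    moreover have "bind_pmf ?M (\<lambda>M. return_pmf (k, M)) = map_pmf (Pair k) ?M" by (simp add: map_pmf_def)
    ultimately show "measure_pmf.prob (bind_pmf ?M (\<lambda>M. return_pmf (k, M))) ?C \<le> ?d * (7 / 8) ^ l" by simp
  qed simp
  have run: "measure_pmf.prob (bind_pmf (committer_commit T Ghat l P b) (\<lambda>(k, M). receiver_reveal T Ghat bot_hat l P M (k, b))) ?B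
     \<le> ?d * (\<delta> / (2 / 27)) + ?d * (7 / 8) ^ l + ?d * (7 / 8) ^ l"
    if P: "P \<in> set_pmf (receiver_commit l)" for P
  proof (rule prob_bind_le[where Q = "\<lambda>(k, M). k \<in> bits l \<and> ?good k \<and> close P k M"])
    show "measure_pmf.prob (committer_commit T Ghat l P b) {kM. \<not> (case kM of (k, M) \<Rightarrow> k \<in> bits l \<and> ?good k \<and> close P k M)}
      \<le> ?d * (\<delta> / (2 / 27)) + ?d * (7 / 8) ^ l"
      using commit[OF P] by (simp add: case_prod_unfold)
  qed (use reveal[OF P] in auto)
  have "measure_pmf.prob (honest_execution T Ghat bot_hat l b) ?B
     \<le> 0 + (?d * (\<delta> / (2 / 27)) + ?d * (7 / 8) ^ l + ?d * (7 / 8) ^ l)"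
    unfolding honest_execution_def
  proof (rule prob_bind_le[where Q = "\<lambda>_. True"])
    \<comment> \<open>A single input shows that \<delta> is nonnegative, because it bounds an
      average of abort probabilities. For d = 0 that input is the empty string.\<close>
    show "0 \<le> ?d * (\<delta> / (2 / 27)) + ?d * (7 / 8) ^ l + ?d * (7 / 8) ^ l"
    proof -
      have "0 \<le> key_avg l (\<lambda>k. 1 - \<eta> k x)" if "x \<in> ?D" for x
        using mix that by (auto simp: key_avg_def intro!: divide_nonneg_nonneg sum_nonneg)
      then have "0 \<le> \<delta>" using \<delta> bits_nonempty[of "in_len l"] by (meson ex_in_conv order_trans)
      then show ?thesis by simp
    qed
  qed (use run in auto)
  moreover have "?B = UNIV - {Some b}" by auto
  moreover have "measure_pmf.prob (honest_execution T Ghat bot_hat l b) (UNIV - {Some b}) = 1 - pmf (honest_execution T Ghat bot_hat l b) (Some b)"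
    using measure_pmf.prob_compl[of "{Some b}" "honest_execution T Ghat bot_hat l b"] by (simp add: measure_pmf_single)
  ultimately show ?thesis by (simp add: field_simps)
qed

theorem lemma8p5:
  fixes haar :: "nat \<Rightarrow> (nat \<Rightarrow> complex) measure"
    and T :: "nat \<Rightarrow> nat \<Rightarrow> complex mat \<Rightarrow> complex mat pmf"
    and G Ghat :: "nat \<Rightarrow> bool list \<Rightarrow> bool list \<Rightarrow> complex mat"
    and bot_hat :: "nat \<Rightarrow> complex vec"
  assumes "\<And>N. 1 \<le> N \<Longrightarrow> haar_state_measure N (haar N)"
    and "tomography_procedure T"
    and "prfs_generator haar in_len out_len G"
    and "recognizable_abort in_len out_len G Ghat bot_hat"
  shows "\<exists>\<nu>. negligible_fun \<nu> \<and>
    (\<forall>b\<in>{0, 1}. \<forall>l. pmf (honest_execution T Ghat bot_hat l b) (Some b) \<ge> 1 - \<nu> l)"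
proof -
  have bot: "pure_state (2 ^ out_len l) (bot_hat l)" for l
    using assms(4) by (simp add: recognizable_abort_def)
  define R where "R l k x \<eta> \<psi> \<longleftrightarrow> 0 \<le> \<eta> \<and> \<eta> \<le> 1 \<and> pure_state (2 ^ out_len l) \<psi> \<and>
    Ghat l k x = mix \<eta> (tensor_vec (ket [False]) \<psi>) (bot_state (bot_hat l)) \<and> G l k x = mix \<eta> \<psi> (bot_hat l)"
    for l k x \<eta> \<psi>
  have "\<forall>l k x. \<exists>\<eta> \<psi>. k \<in> bits l \<longrightarrow> x \<in> bits (in_len l) \<longrightarrow> R l k x \<eta> \<psi>"
    using recognizable_abort_mix[OF assms(4)] unfolding R_def by blast
  then obtain \<eta> \<psi> where R: "\<And>l k x. k \<in> bits l \<Longrightarrow> x \<in> bits (in_len l) \<Longrightarrow> R l k x (\<eta> l k x) (\<psi> l k x)"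
    by metis
  obtain \<delta> where \<delta>: "negligible_fun \<delta>"
    "\<forall>\<^sub>F l in sequentially. \<forall>x\<in>bits (in_len l). key_avg l (\<lambda>k. 1 - \<eta> l k x) \<le> \<delta> l"
    using abort_negligible[OF assms(1,3) bot, of \<eta> \<psi>] R unfolding R_def by blast
  define err where "err b l = 1 - pmf (honest_execution T Ghat bot_hat l b) (Some b)" for b l
  \<comment> \<open>Taking the actual error of the worse bit makes the inequality hold at every
    \<lambda>. The estimates, valid only for large \<lambda>, enter just through
    negligibility.\<close>
  define \<nu> where "\<nu> l = max (err 0 l) (err 1 l)" for l
  have nonneg: "0 \<le> err b l" for b l by (simp add: err_def pmf_le_1)
  have "negligible_fun \<nu>"
  proof (rule negligible_mono)
    show "negligible_fun (\<lambda>l. 6 * (real l * (27 / 2 * \<delta> l + 2 * (7 / 8) ^ l)))"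
      by (intro negligible_cmult negligible_times_n negligible_add negligible_geometric \<delta>(1)) auto
    show "\<forall>\<^sub>F l in sequentially. \<bar>\<nu> l\<bar> \<le> 6 * (real l * (27 / 2 * \<delta> l + 2 * (7 / 8) ^ l))"
      using \<delta>(2) eventually_ge_at_top[of 2]
    proof eventually_elim
      case (elim l)
      let ?e = "27 / 2 * \<delta> l + 2 * (7 / 8) ^ l"
      have e: "err b l \<le> 2 ^ in_len l * ?e" if "b \<in> {0, 1}" for b
        unfolding err_def
        by (rule honest_execution_bound[where \<eta> = "\<eta> l" and \<psi> = "\<psi> l", OF assms(2) that bot])
          (use R elim(1) in \<open>auto simp: R_def\<close>)
      \<comment> \<open>The sign of \<open>?e\<close> is read off from the error that it bounds; it
        is needed to replace 2 ^ d by 6 \<lambda> as a factor.\<close>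
      then have "0 \<le> 2 ^ in_len l * ?e" using nonneg[of 0 l] order_trans by blast
      then have "0 \<le> ?e" using mult_le_cancel_left_pos[of "2 ^ in_len l" 0 ?e] by simp
      then have "2 ^ in_len l * ?e \<le> 6 * real l * ?e" by (intro mult_right_mono in_len_card elim(2))
      then show ?case using e[of 0] e[of 1] nonneg[of 0 l] by (simp add: \<nu>_def)
    qed
  qed
  moreover have "pmf (honest_execution T Ghat bot_hat l b) (Some b) \<ge> 1 - \<nu> l" if "b \<in> {0, 1}" for b l
    using that by (auto simp: \<nu>_def err_def)
  ultimately show ?thesis by blast
qed

end
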